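(* Given three signed graphexes $\mathcal W_1,\mathcal W_2,\mathcal W_3$ with bounded graphon part (i.e., $\|W_i\|_\infty<\infty$ for $i=1,2,3$), $$\delta_\diamond(\mathcal W_1,\mathcal W_3)\le\delta_\diamond(\mathcal W_1,\mathcal W_2)+\delta_\diamond(\mathcal W_2,\mathcal W_3).$$ Therefore, $\delta_\diamond$ is a pseudometric on signed graphexes with bounded graphon part.
   Context: A signed graphex $\mathcal W=(W,S,I,\mathbf\Omega)$ consists of a $\sigma$-finite measure space $\mathbf\Omega=(\Omega,\mathcal F,\mu)$, a symmetric measurable $W\colon\Omega\times\Omega\to\mathbb R$ (the graphon part), a measurable $S\colon\Omega\to\mathbb R$ and $I\in\mathbb R$, such that (1) $W(\cdot,x)$ is integrable for almost all $x$, and (2) there is a measurable $\Omega'\subseteq\Omega$ with $\mu(\Omega\setminus\Omega')<\infty$ such that $\int_{\Omega'\times\Omega'}|W|+2\int_{\Omega'}|S|+2|I|<\infty$. The marginal is $D_{\mathcal W}(x)=\int_\Omega W(x,y)\,d\mu(y)+S(x)$, and $|\mathcal W|=(|W|,|S|,|I|,\mathbf\Omega)$. $\mathcal W$ is in $L^1\cap L^2$ if both $W$ and $D_{|\mathcal W|}$ are in $L^1\cap L^2$. Put $\rho(\mathcal W)=\int W+2\int S+2I$. Kernel norm: $\|U\|_{2\to2}=\sup\{\int f(x)U(x,y)g(y)\,d\mu(x)\,d\mu(y):\|f\|_2=\|g\|_2=1\}$. For signed graphexes in $L^1\cap L^2$ on the same measure space, $$d_{2\to2}(\mathcal W_1,\mathcal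 W_2)=\max\Big(\|W_1-W_2\|_{2\to2},\ \sqrt{\|D_{\mathcal W_1}-D_{\mathcal W_2}\|_2},\ \sqrt[3]{|\rho(\mathcal W_1)-\rho(\mathcal W_2)|}\Big).$$ A coupling of $\mu_1,\mu_2$ is a measure on $(\Omega_1\times\Omega_2,\mathcal F_1\times\mathcal F_2)$ with marginals $\mu_1,\mu_2$. For $\mu_1(\Omega_1)=\mu_2(\Omega_2)$, $\widetilde\delta_{2\to2}(\mathcal W_1,\mathcal W_2)=\inf_\mu d_{2\to2}(\mathcal W_1^{\pi_1,\mu},\mathcal W_2^{\pi_2,\mu})$ over all couplings $\mu$, where $\pi_i\colon\Omega_1\times\Omega_2\to\Omega_i$ is the projection and $\mathcal W_i^{\pi_i,\mu}=(W_i(\pi_i(\cdot),\pi_i(\cdot)),S_i\circ\pi_i,I_i)$ over $(\Omega_1\times\Omega_2,\mathcal F_1\times\mathcal F_2,\mu)$. A trivial extension of $\mathcal W$ is obtained by enlarging the $\sigma$-finite measure space $\Omega$ to a $\sigma$-finite $\Omega'\supseteq\Omega$ (with $\Omega$ measurable in $\Omega'$, $\sigma$-algebra and measure restricting to those of $\Omega$), extending $W$ by $0$ off $\Omega\times\Omega$ and $S$ by $0$ off $\Omega$, and keeping $I$. Then $\delta_{2\to2}(\mathcal W_1,\mathcal W_2)=\widetilde\delta_{2\to2}(\mathcal W_1',\mathcal W_2')$ where $\mathcal W_i'$ are trivial extensions of $\mathcal W_i$ to spaces of infinite total mass (the value does not depend on the choice of these extensions). For measures on the same measurable space and $r\ge0$,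 $\mu-r\le\mu'\le\mu$ means $\mu(B)-r\le\mu'(B)\le\mu(B)$ for all measurable $B$. For signed graphexes $\mathcal W_i$ over $(\Omega_i,\mathcal F_i,\mu_i)$ with $\|W_i\|_\infty<\infty$, the weak kernel distance $\delta_\diamond(\mathcal W_1,\mathcal W_2)$ is the infimum of all real $c$ for which there exist measures $\widetilde\mu_i$ on $(\Omega_i,\mathcal F_i)$ such that the signed graphexes $\widetilde{\mathcal W}_i$ obtained from $\mathcal W_i$ by replacing $\mu_i$ by $\widetilde\mu_i$ are in $L^1\cap L^2$, $\mu_i-c^2\le\widetilde\mu_i\le\mu_i$ for $i=1,2$, and $\delta_{2\to2}(\widetilde{\mathcal W}_1,\widetilde{\mathcal W}_2)\le c$. *)

theory Defs
  imports "HOL-Analysis.Analysis" "HOL-Probability.Essential_Supremum"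
begin

record 'a graphex =
  msp :: "'a measure"
  graphon :: "'a \<Rightarrow> 'a \<Rightarrow> real"
  star :: "'a \<Rightarrow> real"
  iso :: real

definition signed_graphex :: "'a graphex \<Rightarrow> bool" where
  "signed_graphex G \<longleftrightarrow>
     sigma_finite_measure (msp G) \<and>
     (\<lambda>(x, y). graphon G x y) \<in> borel_measurable (msp G \<Otimes>\<^sub>M msp G) \<and>
     (\<forall>x\<in>space (msp G). \<forall>y\<in>space (msp G). graphon G x y = graphon G y x) \<and>
     star G \<in> borel_measurable (msp G) \<and>
     (AE x in msp G. integrable (msp G) (\<lambda>y. graphon G y x)) \<and>
     (\<exists>A\<in>sets (msp G). emeasure (msp G) (space (msp G) - A) < \<infinity> \<and>
        (\<integral>\<^sup>+(x, y)\<in>A \<times> A. ennreal \<bar>graphon G x y\<bar> \<partial>(msp G \<Otimes>\<^sub>M msp G))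
          + 2 * (\<integral>\<^sup>+x\<in>A. ennreal \<bar>star G x\<bar> \<partial>msp G) + 2 * ennreal \<bar>iso G\<bar> < \<infinity>)"

definition marginal :: "'a graphex \<Rightarrow> 'a \<Rightarrow> real" where
  "marginal G x = (\<integral>y. graphon G x y \<partial>msp G) + star G x"

definition abs_graphex :: "'a graphex \<Rightarrow> 'a graphex" where
  "abs_graphex G = \<lparr>msp = msp G, graphon = (\<lambda>x y. \<bar>graphon G x y\<bar>),
     star = (\<lambda>x. \<bar>star G x\<bar>), iso = \<bar>iso G\<bar>\<rparr>"

definition rho :: "'a graphex \<Rightarrow> real" where
  "rho G = (\<integral>(x, y). graphon G x y \<partial>(msp G \<Otimes>\<^sub>M msp G)) + 2 * (\<integral>x. star G x \<partial>msp G) + 2 * iso G"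

definition L1_L2 :: "'a measure \<Rightarrow> ('a \<Rightarrow> real) \<Rightarrow> bool" where
  "L1_L2 M f \<longleftrightarrow> integrable M f \<and> integrable M (\<lambda>x. (f x)\<^sup>2)"

definition graphex_L1_L2 :: "'a graphex \<Rightarrow> bool" where
  "graphex_L1_L2 G \<longleftrightarrow>
     L1_L2 (msp G \<Otimes>\<^sub>M msp G) (\<lambda>(x, y). graphon G x y) \<and>
     L1_L2 (msp G) (marginal (abs_graphex G))"

definition L2_norm :: "'a measure \<Rightarrow> ('a \<Rightarrow> real) \<Rightarrow> real" where
  "L2_norm M f = sqrt (\<integral>x. (f x)\<^sup>2 \<partial>M)"

definition L2_unit :: "'a measure \<Rightarrow> ('a \<Rightarrow> real) set" where
  "L2_unit M = {f \<in> borel_measurable M. integrable M (\<lambda>x. (f x)\<^sup>2) \<and> L2_norm M f = 1}"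

definition kernel_norm :: "'a measure \<Rightarrow> ('a \<Rightarrow> 'a \<Rightarrow> real) \<Rightarrow> ereal" where
  "kernel_norm M U =
     (SUP (f, g)\<in>L2_unit M \<times> L2_unit M. ereal (\<integral>(x, y). f x * U x y * g y \<partial>(M \<Otimes>\<^sub>M M)))"

text \<open>Only meaningful for graphexes in \<open>L\<^sup>1 \<inter> L\<^sup>2\<close> over the same measure space
  \<open>msp G\<^sub>1 = msp G\<^sub>2\<close>.\<close>

definition d22 :: "'a graphex \<Rightarrow> 'a graphex \<Rightarrow> ereal" where
  "d22 G\<^sub>1 G\<^sub>2 =
     max (kernel_norm (msp G\<^sub>1) (\<lambda>x y. graphon G\<^sub>1 x y - graphon G\<^sub>2 x y))
       (max (ereal (sqrt (L2_norm (msp G\<^sub>1) (\<lambda>x. marginal G\<^sub>1 x - marginal G\<^sub>2 x))))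
         (ereal (root 3 \<bar>rho G\<^sub>1 - rho G\<^sub>2\<bar>)))"

definition coupling :: "'a measure \<Rightarrow> 'b measure \<Rightarrow> ('a \<times> 'b) measure \<Rightarrow> bool" where
  "coupling M\<^sub>1 M\<^sub>2 K \<longleftrightarrow>
     sets K = sets (M\<^sub>1 \<Otimes>\<^sub>M M\<^sub>2) \<and> distr K M\<^sub>1 fst = M\<^sub>1 \<and> distr K M\<^sub>2 snd = M\<^sub>2"

definition pullback :: "('b \<Rightarrow> 'a) \<Rightarrow> 'b measure \<Rightarrow> 'a graphex \<Rightarrow> 'b graphex" where
  "pullback p K G = \<lparr>msp = K, graphon = (\<lambda>x y. graphon G (p x) (p y)),
     star = (\<lambda>x. star G (p x)), iso = iso G\<rparr>"

text \<open>Only meaningful when both underlying spaces have the same total mass.\<close>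

definition coupling_dist22 :: "'a graphex \<Rightarrow> 'b graphex \<Rightarrow> ereal" where
  "coupling_dist22 G\<^sub>1 G\<^sub>2 =
     (INF K\<in>{K. coupling (msp G\<^sub>1) (msp G\<^sub>2) K}. d22 (pullback fst K G\<^sub>1) (pullback snd K G\<^sub>2))"

text \<open>The value of \<open>\<delta>\<^bsub>2\<rightarrow>2\<^esub>\<close> does not depend on which trivial extensions of infinite total mass
  are chosen. We fix the disjoint union of the space with the Lebesgue line, which
  is \<open>\<sigma>\<close>-finite of infinite mass whatever the mass of the original space.\<close>

definition ext_measure :: "'a measure \<Rightarrow> ('a + real) measure" where
  "ext_measure M = measure_of (space M <+> space lborel)
     {A. A \<subseteq> space M <+> space lborel \<and> Inl -` A \<in> sets M \<and> Inr -` A \<in> sets lborel}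
     (\<lambda>A. emeasure M (Inl -` A) + emeasure lborel (Inr -` A))"

definition trivial_ext :: "'a graphex \<Rightarrow> ('a + real) graphex" where
  "trivial_ext G = \<lparr>msp = ext_measure (msp G),
     graphon = (\<lambda>u v. case (u, v) of (Inl x, Inl y) \<Rightarrow> graphon G x y | _ \<Rightarrow> 0),
     star = (\<lambda>u. case u of Inl x \<Rightarrow> star G x | Inr t \<Rightarrow> 0),
     iso = iso G\<rparr>"

definition delta22 :: "'a graphex \<Rightarrow> 'b graphex \<Rightarrow> ereal" where
  "delta22 G\<^sub>1 G\<^sub>2 = coupling_dist22 (trivial_ext G\<^sub>1) (trivial_ext G\<^sub>2)"

text \<open>The relation \<open>M - r \<le> M' \<le> M\<close>. Subtraction on \<open>ennreal\<close> truncates at \<open>0\<close>, which makes no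
  difference for a lower bound on a measure.\<close>

definition measure_within :: "'a measure \<Rightarrow> real \<Rightarrow> 'a measure \<Rightarrow> bool" where
  "measure_within M r M' \<longleftrightarrow> sets M' = sets M \<and>
     (\<forall>B\<in>sets M. emeasure M B - ennreal r \<le> emeasure M' B \<and> emeasure M' B \<le> emeasure M B)"

definition bounded_graphon :: "'a graphex \<Rightarrow> bool" where
  "bounded_graphon G \<longleftrightarrow>
     esssup (msp G \<Otimes>\<^sub>M msp G) (\<lambda>(x, y). ereal \<bar>graphon G x y\<bar>) < \<infinity>"

text \<open>The infimum is taken in the extended reals, so that it is \<open>\<infinity>\<close> (and not an arbitrary real)
  in case no \<open>c\<close> is admissible. Replacing the measure of a signed graphex by a smaller one again
  yields a signed graphex, so this is not demanded separately.\<close>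

definition delta_diamond :: "'a graphex \<Rightarrow> 'b graphex \<Rightarrow> ereal" where
  "delta_diamond G\<^sub>1 G\<^sub>2 = Inf (ereal ` {c. \<exists>M\<^sub>1 M\<^sub>2.
     measure_within (msp G\<^sub>1) (c\<^sup>2) M\<^sub>1 \<and> measure_within (msp G\<^sub>2) (c\<^sup>2) M\<^sub>2 \<and>
     graphex_L1_L2 (G\<^sub>1\<lparr>msp := M\<^sub>1\<rparr>) \<and> graphex_L1_L2 (G\<^sub>2\<lparr>msp := M\<^sub>2\<rparr>) \<and>
     delta22 (G\<^sub>1\<lparr>msp := M\<^sub>1\<rparr>) (G\<^sub>2\<lparr>msp := M\<^sub>2\<rparr>) \<le> ereal c})"

lemma sigma_algebra_ext:
  "sigma_algebra (space M <+> space lborel)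
     {A. A \<subseteq> space M <+> space (lborel :: real measure) \<and> Inl -` A \<in> sets M \<and> Inr -` A \<in> sets lborel}"
  (is "sigma_algebra ?S ?F")
proof (rule sigma_algebra_iff2[THEN iffD2], intro conjI ballI allI impI)
  show "?F \<subseteq> Pow ?S" by blast
  show "{} \<in> ?F" by simp
next
  fix A assume A: "A \<in> ?F"
  have 1: "Inl -` (?S - A) = space M - Inl -` A" "Inr -` (?S - A) = UNIV - Inr -` A" by auto
  have 2: "Inl -` A \<in> sets M" "Inr -` A \<in> sets borel" using A by auto
  have "space M - Inl -` A \<in> sets M" "UNIV - Inr -` A \<in> sets (borel :: real measure)"
    using sets.compl_sets[OF 2(1)] sets.compl_sets[OF 2(2)] by auto
  then show "?S - A \<in> ?F" unfolding 1 mem_Collect_eq by (simp add: Diff_subset)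
next
  fix A :: "nat \<Rightarrow> ('a + real) set" assume A: "range A \<subseteq> ?F"
  have "A i \<subseteq> ?S" "Inl -` A i \<in> sets M" "Inr -` A i \<in> sets borel" for i
    using A by (auto simp: image_subset_iff)
  then show "(\<Union>i. A i) \<in> ?F" unfolding mem_Collect_eq vimage_UN by (auto intro!: UN_least)
qed

lemma space_ext_measure [simp]: "space (ext_measure M) = space M <+> UNIV"
  unfolding ext_measure_def by (subst space_measure_of) auto

lemma sets_ext_measure:
  "sets (ext_measure M) = {A. A \<subseteq> space M <+> UNIV \<and> Inl -` A \<in> sets M \<and> Inr -` A \<in> sets borel}"
  unfolding ext_measure_def
  using sigma_algebra.sets_measure_of_eq[OF sigma_algebra_ext[of M]] by simp

lemma emeasure_ext_measure:
  assumes "A \<in> sets (ext_measure M)"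
  shows "emeasure (ext_measure M) A = emeasure M (Inl -` A) + emeasure lborel (Inr -` A)"
proof (rule emeasure_measure_of[OF ext_measure_def _ _ _ assms])
  let ?f = "\<lambda>A. emeasure M (Inl -` A) + emeasure lborel (Inr -` A)"
  show "positive (sets (ext_measure M)) ?f" by (simp add: positive_def)
  show "countably_additive (sets (ext_measure M)) ?f"
  proof (rule countably_additiveI)
    fix F :: "nat \<Rightarrow> _" assume F: "range F \<subseteq> sets (ext_measure M)" and d: "disjoint_family F"
    have m: "range (\<lambda>i. Inl -` F i) \<subseteq> sets M" "range (\<lambda>i. Inr -` F i) \<subseteq> sets lborel"
      using F by (auto simp: sets_ext_measure)
    have dd: "disjoint_family (\<lambda>i. Inl -` F i)" "disjoint_family (\<lambda>i. Inr -` F i)"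
      using d by (auto simp: disjoint_family_on_def)
    show "(\<Sum>i. ?f (F i)) = ?f (\<Union>i. F i)"
      using suminf_emeasure[OF m(1) dd(1)] suminf_emeasure[OF m(2) dd(2)]
      by (simp add: suminf_add[symmetric] vimage_UN)
  qed
qed auto

lemma emeasure_ext_measure_space: "emeasure (ext_measure M) (space (ext_measure M)) = \<infinity>"
proof -
  have "Inr -` (space M <+> (UNIV :: real set)) = (UNIV :: real set)" by auto
  then show ?thesis
    by (subst emeasure_ext_measure[OF sets.top]) simp
qed

lemma sigma_finite_ext_measure:
  assumes "sigma_finite_measure M"
  shows "sigma_finite_measure (ext_measure M)"
proof -
  obtain A where A: "countable A" "A \<subseteq> sets M" "\<Union>A = space M" "\<forall>a\<in>A. emeasure M a \<noteq> \<infinity>"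
    using sigma_finite_measure.sigma_finite_countable[OF assms] by blast
  obtain B :: "real set set" where B: "countable B" "B \<subseteq> sets lborel" "\<Union>B = space lborel"
      "\<forall>b\<in>B. emeasure lborel b \<noteq> \<infinity>"
    using lborel.sigma_finite_countable by blast
  have v: "Inl -` (Inl ` a) = a" "Inr -` (Inl ` a) = {}" "Inl -` (Inr ` b) = {}" "Inr -` (Inr ` b) = b"
    for a :: "'a set" and b :: "real set" by auto
  have a: "Inl ` a \<in> sets (ext_measure M)" if "a \<in> A" for a
    using that A(2) sets.sets_into_space[of a M] by (auto simp: sets_ext_measure v)
  have b: "Inr ` b \<in> sets (ext_measure M)" if "b \<in> B" for b
    using that B(2) by (auto simp: sets_ext_measure v)
  show ?thesis
  proof
    let ?C = "(\<lambda>a. Inl ` a) ` A \<union> (\<lambda>b. Inr ` b) ` B"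
    have u: "\<Union>?C = Inl ` \<Union>A \<union> Inr ` \<Union>B" by blast
    have "\<Union>?C = space (ext_measure M)"
      unfolding u A(3) B(3) by (simp add: Plus_def)
    moreover have "emeasure (ext_measure M) c \<noteq> \<infinity>" if "c \<in> ?C" for c
      using that a b A(4) B(4) by (auto simp: emeasure_ext_measure v)
    ultimately show "\<exists>C. countable C \<and> C \<subseteq> sets (ext_measure M) \<and>
        \<Union>C = space (ext_measure M) \<and> (\<forall>c\<in>C. emeasure (ext_measure M) c \<noteq> \<infinity>)"
      using A(1) B(1) a b by (intro exI[of _ ?C]) auto
  qed
qed

end

theory Submission
  imports Defs
begin

text \<open>
  For the triangle inequality take reduced measures \<open>M\<^sub>2\<close>, \<open>M\<^sub>2'\<close> of the middle space that are
  (nearly) optimal for the two distances and couplings of (trivial extensions of) \<open>M\<^sub>1, M\<^sub>2\<close> and of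
  \<open>M\<^sub>2', M\<^sub>3\<close> realising \<open>\<delta>\<^bsub>2\<rightarrow>2\<^esub> \<le> c\<close> and \<open>\<delta>\<^bsub>2\<rightarrow>2\<^esub> \<le> c'\<close>. Reweight both couplings through their
  second marginal so that it becomes \<open>min M\<^sub>2 M\<^sub>2'\<close>. This removes mass at most \<open>c'\<^sup>2\<close> from the first
  coupling, and the three components of its distance become at most \<open>c\<close>, \<open>c (c + c')\<close> and
  \<open>c (c + c')\<^sup>2\<close>; together with the symmetric bounds for the second coupling these add up to
  \<open>c + c'\<close>, \<open>(c + c')\<^sup>2\<close> and \<open>(c + c')\<^sup>3\<close>. Since couplings over arbitrary measure spaces cannot be
  glued exactly, the middle graphex is approximated in \<open>L\<^sup>2\<close> by a step function on countably many
  cells and the couplings are glued independently given the cell. Finally, only the behaviour of a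
  coupling on the original spaces matters: any measure with the right marginals there can be
  completed to a coupling of the extensions without changing the distance.
\<close>

section \<open>Square-integrable functions\<close>

text \<open>The exponents in \<open>d22\<close> and the mass budget c^2 fit together. Removing mass
  at most e^2 subtracts a weight of L2 norm at most e, so a kernel of operator norm c moves the
  marginal by at most c e, and \<open>rho\<close> by terms of degree three in c and e. Hence each
  component stays homogeneous and the bounds telescope without loss. At an outer space the two
  removed masses c^2 and c'^2 fit into (c + c')^2. The obstacle that shapes the middle of the proof
  is the added line: reweighting through the middle marginal also changes the outer marginal there,
  where it has to be Lebesgue measure. Therefore partial couplings are studied, with prescribed
  marginals on the original spaces only. A step approximation in L2 suffices because the operator
  norm is at most the L2 norm of the kernel; \<open>rho\<close> gets no error, since all
  measure-preserving pullbacks of the middle graphex share it. Finiteness and vanishing on the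
  diagonal are a separate matter: they require nearby measures for which the graphex lies in L1 and
  L2 at all, and this is where bounded graphons enter.\<close>

definition square_integrable :: "'a measure \<Rightarrow> ('a \<Rightarrow> real) \<Rightarrow> bool" where
  "square_integrable M f \<longleftrightarrow> f \<in> borel_measurable M \<and> integrable M (\<lambda>x. (f x)\<^sup>2)"

lemma square_integrableI:
  "f \<in> borel_measurable M \<Longrightarrow> integrable M (\<lambda>x. (f x)\<^sup>2) \<Longrightarrow> square_integrable M f"
  by (simp add: square_integrable_def)

lemma square_integrable_measurable[measurable_dest]:
  "square_integrable M f \<Longrightarrow> f \<in> borel_measurable M"
  by (simp add: square_integrable_def)

lemma L1_L2_square_integrable: "L1_L2 M f \<Longrightarrow> square_integrable M f"
  by (auto simp: L1_L2_def square_integrable_def)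

lemma square_integrable_bound:
  assumes "square_integrable M g" "f \<in> borel_measurable M" "AE x in M. \<bar>f x\<bar> \<le> \<bar>g x\<bar>"
  shows "square_integrable M f"
proof (rule square_integrableI)
  have "AE x in M. norm ((f x)\<^sup>2) \<le> norm ((g x)\<^sup>2)"
    using assms(3) by eventually_elim (simp add: abs_le_square_iff)
  moreover have "(\<lambda>x. (f x)\<^sup>2) \<in> borel_measurable M" using assms(2) by simp
  ultimately show "integrable M (\<lambda>x. (f x)\<^sup>2)"
    using assms(1) Bochner_Integration.integrable_bound unfolding square_integrable_def by blast
qed fact

lemma L1_L2_bound:
  assumes "L1_L2 M g" "f \<in> borel_measurable M" "AE x in M. \<bar>f x\<bar> \<le> \<bar>g x\<bar>"
  shows "L1_L2 M f"
proof -
  have "integrable M f"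
    using assms(3) by (intro Bochner_Integration.integrable_bound[OF _ assms(2), of g])
      (use assms(1) in \<open>simp_all add: L1_L2_def\<close>)
  then show ?thesis
    using square_integrable_bound[OF L1_L2_square_integrable[OF assms(1)] assms(2,3)]
    by (simp add: L1_L2_def square_integrable_def)
qed

lemma square_integrable_mult:
  assumes "square_integrable M f" "square_integrable M g"
  shows "integrable M (\<lambda>x. f x * g x)"
proof (rule Bochner_Integration.integrable_bound[of M "\<lambda>x. (f x)\<^sup>2 + (g x)\<^sup>2"])
  have "\<bar>a * b\<bar> \<le> a\<^sup>2 + b\<^sup>2" for a b :: real
  proof -
    have "\<bar>a * b\<bar> = \<bar>a\<bar> * \<bar>b\<bar>" by (simp add: abs_mult)
    also have "\<dots> \<le> \<bar>a\<bar>\<^sup>2 + \<bar>b\<bar>\<^sup>2"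
      using sum_squares_bound[of "\<bar>a\<bar>" "\<bar>b\<bar>"] mult_nonneg_nonneg[OF abs_ge_zero[of a] abs_ge_zero[of b]]
      by linarith
    finally show ?thesis by simp
  qed
  then show "AE x in M. norm (f x * g x) \<le> norm ((f x)\<^sup>2 + (g x)\<^sup>2)"
    by auto
qed (use assms in \<open>auto simp: square_integrable_def\<close>)

lemma square_integrable_cong:
  "(\<And>x. x \<in> space M \<Longrightarrow> f x = g x) \<Longrightarrow> square_integrable M f \<longleftrightarrow> square_integrable M g"
  unfolding square_integrable_def
  by (intro conj_cong measurable_cong Bochner_Integration.integrable_cong) auto

lemma square_integrable_zero: "square_integrable M (\<lambda>x. 0)"
  by (simp add: square_integrable_def)

lemma square_integrable_uminus: "square_integrable M f \<Longrightarrow> square_integrable M (\<lambda>x. - f x)"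
  by (simp add: square_integrable_def)

lemma square_integrable_add:
  assumes "square_integrable M f" "square_integrable M g"
  shows "square_integrable M (\<lambda>x. f x + g x)"
  using square_integrable_mult[OF assms] assms
  by (auto simp: square_integrable_def power2_sum mult.assoc)

lemma square_integrable_diff:
  assumes "square_integrable M f" "square_integrable M g"
  shows "square_integrable M (\<lambda>x. f x - g x)"
  using square_integrable_add[OF assms(1) square_integrable_uminus[OF assms(2)]] by simp

lemma square_integrable_cmult: "square_integrable M f \<Longrightarrow> square_integrable M (\<lambda>x. c * f x)"
  by (auto simp: square_integrable_def power_mult_distrib)

lemma L2_norm_nonneg[simp]: "0 \<le> L2_norm M f"
  by (simp add: L2_norm_def)

lemma L2_norm_power2: "(L2_norm M f)\<^sup>2 = (\<integral>x. (f x)\<^sup>2 \<partial>M)"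
  by (simp add: L2_norm_def)

lemma L2_norm_cmult: "L2_norm M (\<lambda>x. c * f x) = \<bar>c\<bar> * L2_norm M f"
  by (simp add: L2_norm_def power_mult_distrib real_sqrt_mult)

lemma L2_norm_uminus: "L2_norm M (\<lambda>x. - f x) = L2_norm M f"
  by (simp add: L2_norm_def)

lemma L2_norm_cong_AE:
  assumes "f \<in> borel_measurable M" "g \<in> borel_measurable M" "AE x in M. f x = g x"
  shows "L2_norm M f = L2_norm M g"
  unfolding L2_norm_def using assms by (intro arg_cong[where f=sqrt] integral_cong_AE) auto

lemma L2_norm_cong: "(\<And>x. x \<in> space M \<Longrightarrow> f x = g x) \<Longrightarrow> L2_norm M f = L2_norm M g"
  unfolding L2_norm_def by (intro arg_cong[where f=sqrt] Bochner_Integration.integral_cong) auto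

lemma L2_norm_eq_0_AE:
  assumes "square_integrable M f" "L2_norm M f = 0"
  shows "AE x in M. f x = 0"
proof -
  have "(\<integral>x. (f x)\<^sup>2 \<partial>M) = 0" using assms(2) by (simp add: L2_norm_def)
  then have "AE x in M. (f x)\<^sup>2 = 0"
    using assms(1) integral_nonneg_eq_0_iff_AE[of M "\<lambda>x. (f x)\<^sup>2"] by (auto simp: square_integrable_def)
  then show ?thesis by simp
qed

text \<open>Pointwise f^2 \<le> |C| |f|. Both halves of \<open>regular_truncation\<close> get square
  integrability in this way: the graphon from its essential bound, the absolute marginal from a cut
  at a fixed height.\<close>

lemma L1_L2_bounded:
  assumes i: "integrable M f" and b: "AE x in M. \<bar>f x\<bar> \<le> C"
  shows "L1_L2 M f"
proof -
  have "integrable M (\<lambda>x. (f x)\<^sup>2)"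
  proof (rule Bochner_Integration.integrable_bound)
    show "integrable M (\<lambda>x. C * f x)" using i by simp
    show "AE x in M. norm ((f x)\<^sup>2) \<le> norm (C * f x)"
      using b
    proof eventually_elim
      case (elim x)
      then have "\<bar>f x\<bar> * \<bar>f x\<bar> \<le> \<bar>C\<bar> * \<bar>f x\<bar>" by (intro mult_right_mono) auto
      then show ?case by (simp add: power2_eq_square abs_mult)
    qed
  qed (use i in auto)
  then show ?thesis using i by (simp add: L1_L2_def)
qed

lemma L2_Cauchy_Schwarz:
  assumes f: "square_integrable M f" and g: "square_integrable M g"
  shows "\<bar>\<integral>x. f x * g x \<partial>M\<bar> \<le> L2_norm M f * L2_norm M g"
proof (cases "L2_norm M f = 0 \<or> L2_norm M g = 0")
  case True
  then have "AE x in M. f x * g x = 0"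
    using L2_norm_eq_0_AE[OF f] L2_norm_eq_0_AE[OF g] by auto
  then have "(\<integral>x. f x * g x \<partial>M) = (\<integral>x. 0 \<partial>M)"
    using f g by (intro integral_cong_AE) (auto simp: square_integrable_def)
  then show ?thesis by simp
next
  case False
  define a where "a = L2_norm M f"
  define b where "b = L2_norm M g"
  have ab: "a > 0" "b > 0" using False by (auto simp: a_def b_def less_le)
  \<comment> \<open>Weighted arithmetic-geometric mean; the weights b/a and a/b make each of the two
    terms contribute a b / 2 to the integral.\<close>
  have le: "\<bar>f x * g x\<bar> \<le> (b / a * (f x)\<^sup>2 + a / b * (g x)\<^sup>2) / 2" for x
  proof -
    have "0 \<le> (b * \<bar>f x\<bar> - a * \<bar>g x\<bar>)\<^sup>2 / (a * b)" using ab by simp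
    also have "\<dots> = b / a * (f x)\<^sup>2 + a / b * (g x)\<^sup>2 - 2 * \<bar>f x * g x\<bar>"
      using ab by (simp add: power2_diff abs_mult power_mult_distrib field_simps power2_eq_square)
    finally show ?thesis by simp
  qed
  have "\<bar>\<integral>x. f x * g x \<partial>M\<bar> \<le> (\<integral>x. \<bar>f x * g x\<bar> \<partial>M)" by (rule integral_abs_bound)
  also have "\<dots> \<le> (\<integral>x. (b / a * (f x)\<^sup>2 + a / b * (g x)\<^sup>2) / 2 \<partial>M)"
    using f g le square_integrable_mult[OF f g]
    by (intro integral_mono) (auto simp: square_integrable_def)
  also have "\<dots> = (b / a * a\<^sup>2 + a / b * b\<^sup>2) / 2"
    unfolding a_def b_def L2_norm_power2 using f g by (simp add: square_integrable_def)
  also have "\<dots> = a * b" using ab by (simp add: power2_eq_square)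
  finally show ?thesis by (simp add: a_def b_def)
qed

lemma L2_norm_triangle:
  assumes f: "square_integrable M f" and g: "square_integrable M g"
  shows "L2_norm M (\<lambda>x. f x + g x) \<le> L2_norm M f + L2_norm M g"
proof (rule power2_le_imp_le)
  have "(L2_norm M (\<lambda>x. f x + g x))\<^sup>2 = (\<integral>x. (f x)\<^sup>2 + (g x)\<^sup>2 + 2 * (f x * g x) \<partial>M)"
    by (simp add: L2_norm_power2 power2_sum mult.assoc)
  also have "\<dots> = (L2_norm M f)\<^sup>2 + (L2_norm M g)\<^sup>2 + 2 * (\<integral>x. f x * g x \<partial>M)"
    unfolding L2_norm_power2 using f g square_integrable_mult[OF f g] by (simp add: square_integrable_def)
  also have "\<dots> \<le> (L2_norm M f)\<^sup>2 + (L2_norm M g)\<^sup>2 + 2 * (L2_norm M f * L2_norm M g)"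
    using L2_Cauchy_Schwarz[OF f g] by linarith
  also have "\<dots> = (L2_norm M f + L2_norm M g)\<^sup>2" by (simp add: power2_sum)
  finally show "(L2_norm M (\<lambda>x. f x + g x))\<^sup>2 \<le> (L2_norm M f + L2_norm M g)\<^sup>2" .
qed simp

section \<open>Measure-preserving maps and densities\<close>

definition measure_preserving :: "('a \<Rightarrow> 'b) \<Rightarrow> 'a measure \<Rightarrow> 'b measure \<Rightarrow> bool" where
  "measure_preserving p K Y \<longleftrightarrow> p \<in> measurable K Y \<and> distr K Y p = Y"

lemma measure_preserving_measurable[measurable_dest]:
  "measure_preserving p K Y \<Longrightarrow> p \<in> measurable K Y"
  by (simp add: measure_preserving_def)

lemma measure_preserving_comp:
  assumes "measure_preserving p K Y" "measure_preserving q L K"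
  shows "measure_preserving (\<lambda>x. p (q x)) L Y"
proof -
  have "distr L Y (\<lambda>x. p (q x)) = distr (distr L K q) Y p"
    using assms by (subst distr_distr) (auto simp: measure_preserving_def comp_def)
  then show ?thesis using assms by (auto simp: measure_preserving_def)
qed

text \<open>Preimages of a countable cover by sets of finite measure form such a cover upstairs.
  Couplings and glued measures receive their sigma-finiteness from a marginal in this way.\<close>

lemma measure_preserving_sigma_finite:
  assumes "measure_preserving p K Y" "sigma_finite_measure Y"
  shows "sigma_finite_measure K"
  using assms sigma_finite_measure_distr[of K Y p] by (auto simp: measure_preserving_def)

lemma measure_preserving_AE:
  assumes "measure_preserving p K Y" "AE y in Y. P y"
  shows "AE x in K. P (p x)"
proof (rule AE_distrD[of p K Y P])
  show "p \<in> measurable K Y" using assms(1) by (simp add: measure_preserving_def)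
  have "distr K Y p = Y" using assms(1) by (simp add: measure_preserving_def)
  with assms(2) show "AE y in distr K Y p. P y" by metis
qed

lemma measure_preserving_integrable:
  fixes f :: "_ \<Rightarrow> real"
  assumes "measure_preserving p K Y" "f \<in> borel_measurable Y"
  shows "integrable K (\<lambda>x. f (p x)) \<longleftrightarrow> integrable Y f"
  using assms integrable_distr_eq[of p K Y f] by (auto simp: measure_preserving_def)

lemma measure_preserving_integral:
  fixes f :: "_ \<Rightarrow> real"
  assumes "measure_preserving p K Y" "f \<in> borel_measurable Y"
  shows "integral\<^sup>L K (\<lambda>x. f (p x)) = integral\<^sup>L Y f"
  using assms integral_distr[of p K Y f] by (auto simp: measure_preserving_def)

lemma measure_preserving_nn_integral:
  assumes "measure_preserving p K Y" "f \<in> borel_measurable Y"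
  shows "(\<integral>\<^sup>+x. f (p x) \<partial>K) = (\<integral>\<^sup>+x. f x \<partial>Y)"
  using assms nn_integral_distr[of p K Y f] by (auto simp: measure_preserving_def)

lemma measure_preserving_L2_norm:
  assumes "measure_preserving p K Y" "f \<in> borel_measurable Y"
  shows "L2_norm K (\<lambda>x. f (p x)) = L2_norm Y f"
  unfolding L2_norm_def using measure_preserving_integral[OF assms(1), of "\<lambda>x. (f x)\<^sup>2"] assms(2) by simp

lemma measure_preserving_square_integrable:
  assumes "measure_preserving p K Y" "f \<in> borel_measurable Y"
  shows "square_integrable K (\<lambda>x. f (p x)) \<longleftrightarrow> square_integrable Y f"
  using measure_preserving_integrable[OF assms(1), of "\<lambda>x. (f x)\<^sup>2"] assms
    measurable_compose[OF measure_preserving_measurable[OF assms(1)] assms(2)]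
  by (auto simp: square_integrable_def)

lemma measure_preserving_L1_L2:
  assumes "measure_preserving p K Y" "f \<in> borel_measurable Y"
  shows "L1_L2 K (\<lambda>x. f (p x)) \<longleftrightarrow> L1_L2 Y f"
  using measure_preserving_integrable[OF assms(1), of "\<lambda>x. (f x)\<^sup>2"] 
    measure_preserving_integrable[OF assms] assms(2)
  by (auto simp: L1_L2_def)

lemma measure_preserving_id: "measure_preserving (\<lambda>x. x) M M"
  by (simp add: measure_preserving_def)

lemma measure_preserving_map_prod:
  assumes "measure_preserving p K Y" "measure_preserving q L X" "sigma_finite_measure X"
  shows "measure_preserving (map_prod p q) (K \<Otimes>\<^sub>M L) (Y \<Otimes>\<^sub>M X)"
proof -
  have [measurable]: "p \<in> measurable K Y" "q \<in> measurable L X"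
    and d: "distr K Y p = Y" "distr L X q = X"
    using assms(1,2) by (auto simp: measure_preserving_def)
  have "distr K Y p \<Otimes>\<^sub>M distr L X q = distr (K \<Otimes>\<^sub>M L) (Y \<Otimes>\<^sub>M X) (\<lambda>(x, y). (p x, q y))"
    by (rule pair_measure_distr) (use d assms in auto)
  then show ?thesis
    by (simp add: measure_preserving_def d map_prod_def)
qed

section \<open>Measures reweighted by a density with values in [0, 1]\<close>

lemma pair_density_same:
  assumes "sigma_finite_measure M" "sigma_finite_measure (density M w)" "w \<in> borel_measurable M"
  shows "density M w \<Otimes>\<^sub>M density M w = density (M \<Otimes>\<^sub>M M) (\<lambda>(x, y). w x * w y)"
  using pair_measure_density[of w M w M] assms by simp

abbreviation reweight :: "'a measure \<Rightarrow> ('a \<Rightarrow> real) \<Rightarrow> 'a measure" where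
  "reweight M w \<equiv> density M (\<lambda>x. ennreal (w x))"

text \<open>The bounds hold at every point of the space and not just almost everywhere, so that
  estimates under the integral can be made pointwise; \<open>dominated_density\<close> arranges this
  by cutting a Radon-Nikodym derivative at 1.\<close>

definition weight :: "'a measure \<Rightarrow> ('a \<Rightarrow> real) \<Rightarrow> bool" where
  "weight M w \<longleftrightarrow> w \<in> borel_measurable M \<and> (\<forall>x\<in>space M. 0 \<le> w x \<and> w x \<le> 1)"

lemma sigma_finite_density_le:
  assumes "sigma_finite_measure M" "w \<in> borel_measurable M" "\<And>x. x \<in> space M \<Longrightarrow> w x \<le> 1"
  shows "sigma_finite_measure (density M w)"
proof -
  interpret sigma_finite_measure M by fact
  obtain A where A: "countable A" "A \<subseteq> sets M" "\<Union>A = space M" "\<forall>a\<in>A. emeasure M a \<noteq> \<infinity>"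
    using sigma_finite_countable by blast
  have "emeasure (density M w) a \<noteq> \<infinity>" if "a \<in> A" for a
  proof -
    have "emeasure (density M w) a = (\<integral>\<^sup>+x. w x * indicator a x \<partial>M)"
      using that A assms by (intro emeasure_density) auto
    also have "\<dots> \<le> (\<integral>\<^sup>+x. indicator a x \<partial>M)"
      by (intro nn_integral_mono) (auto simp: indicator_def assms)
    also have "\<dots> = emeasure M a" using that A by auto
    finally show ?thesis using A that by (auto simp: top_unique)
  qed
  then show ?thesis
    unfolding sigma_finite_measure_def using A by (intro exI[of _ A]) simp
qed

lemma weight_sigma_finite:
  "sigma_finite_measure M \<Longrightarrow> weight M w \<Longrightarrow> sigma_finite_measure (reweight M w)"
  by (rule sigma_finite_density_le) (auto simp: weight_def ennreal_le_1)

lemma weight_pair_density: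
  assumes "sigma_finite_measure M" "weight M w"
  shows "reweight M w \<Otimes>\<^sub>M reweight M w
    = density (M \<Otimes>\<^sub>M M) (\<lambda>z. ennreal (w (fst z) * w (snd z)))"
proof -
  have [measurable]: "w \<in> borel_measurable M" using assms by (simp add: weight_def)
  have "density (M \<Otimes>\<^sub>M M) (\<lambda>(x, y). ennreal (w x) * ennreal (w y))
    = density (M \<Otimes>\<^sub>M M) (\<lambda>z. ennreal (w (fst z) * w (snd z)))"
    using assms(2) by (intro density_cong AE_I2)
      (auto simp: weight_def split_beta space_pair_measure ennreal_mult)
  then show ?thesis
    by (subst pair_density_same[OF assms(1) weight_sigma_finite[OF assms]]) simp_all
qed

lemma weight_pair: "weight M w \<Longrightarrow> weight (M \<Otimes>\<^sub>M M) (\<lambda>z. w (fst z) * w (snd z))"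
  unfolding weight_def by (auto simp: space_pair_measure mult_le_one)

lemma weight_integral:
  fixes f :: "_ \<Rightarrow> real"
  assumes "weight M w" "f \<in> borel_measurable M"
  shows "integral\<^sup>L (reweight M w) f = (\<integral>x. w x * f x \<partial>M)"
  using assms by (subst integral_density) (auto simp: weight_def)

lemma weight_integrable:
  fixes f :: "_ \<Rightarrow> real"
  assumes "weight M w" "f \<in> borel_measurable M"
  shows "integrable (reweight M w) f \<longleftrightarrow> integrable M (\<lambda>x. w x * f x)"
  using assms by (subst integrable_density) (auto simp: weight_def)

lemma weight_integrable_mult:
  fixes f :: "_ \<Rightarrow> real"
  assumes "weight M w" "integrable M f"
  shows "integrable M (\<lambda>x. w x * f x)"
  using assms by (intro Bochner_Integration.integrable_bound[OF assms(2)])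
    (auto simp: weight_def abs_mult intro!: AE_I2 mult_left_le_one_le)

lemma weight_integrable_imp:
  fixes f :: "_ \<Rightarrow> real"
  assumes "weight M w" "integrable M f"
  shows "integrable (reweight M w) f"
  using weight_integrable[OF assms(1)] weight_integrable_mult[OF assms] assms(2) by auto

lemma weight_L1_L2: "weight M w \<Longrightarrow> L1_L2 M f \<Longrightarrow> L1_L2 (reweight M w) f"
  by (auto simp: L1_L2_def intro: weight_integrable_imp)

lemma weight_AE_density:
  assumes "weight M w" "AE x in M. P x"
  shows "AE x in reweight M w. P x"
  using assms by (subst AE_density) (auto simp: weight_def)

section \<open>Square-integrable kernels\<close>

lemma square_integrable_tensor:
  assumes "sigma_finite_measure M" "sigma_finite_measure N"
    and f: "square_integrable M f" and g: "square_integrable N g"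
  shows "square_integrable (M \<Otimes>\<^sub>M N) (\<lambda>(x, y). f x * g y)"
    and "L2_norm (M \<Otimes>\<^sub>M N) (\<lambda>(x, y). f x * g y) = L2_norm M f * L2_norm N g"
proof -
  interpret M: sigma_finite_measure M by fact
  interpret N: sigma_finite_measure N by fact
  interpret pair_sigma_finite M N by unfold_locales
  have [measurable]: "f \<in> borel_measurable M" "g \<in> borel_measurable N"
    using f g by (auto simp: square_integrable_def)
  have i: "integrable (M \<Otimes>\<^sub>M N) (\<lambda>(x, y). (f x)\<^sup>2 * (g y)\<^sup>2)"
    using f g by (intro Fubini_integrable) (auto simp: square_integrable_def)
  then show 1: "square_integrable (M \<Otimes>\<^sub>M N) (\<lambda>(x, y). f x * g y)"
    by (simp add: square_integrable_def split_beta' power_mult_distrib)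
  have "(\<integral>(x, y). (f x)\<^sup>2 * (g y)\<^sup>2 \<partial>(M \<Otimes>\<^sub>M N)) = (\<integral>x. (f x)\<^sup>2 \<partial>M) * (\<integral>y. (g y)\<^sup>2 \<partial>N)"
    using integral_fst'[OF i] by simp
  then show "L2_norm (M \<Otimes>\<^sub>M N) (\<lambda>(x, y). f x * g y) = L2_norm M f * L2_norm N g"
    by (simp add: L2_norm_def split_beta' power_mult_distrib real_sqrt_mult)
qed

lemma kernel_integrable:
  assumes "sigma_finite_measure M" "sigma_finite_measure N"
    and f: "square_integrable M f" and g: "square_integrable N g"
    and U: "square_integrable (M \<Otimes>\<^sub>M N) (\<lambda>(x, y). U x y)"
  shows "integrable (M \<Otimes>\<^sub>M N) (\<lambda>(x, y). f x * U x y * g y)"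
  using square_integrable_mult[OF square_integrable_tensor(1)[OF assms(1-4)] U]
  by (simp add: split_beta' mult_ac)

text \<open>Cauchy-Schwarz on the product space, applied to the kernel and the tensor product of the
  test functions: the operator norm is at most the Hilbert-Schmidt norm.\<close>

lemma kernel_bound_L2_norm:
  assumes "sigma_finite_measure M" "sigma_finite_measure N"
    and f: "square_integrable M f" and g: "square_integrable N g"
    and U: "square_integrable (M \<Otimes>\<^sub>M N) (\<lambda>(x, y). U x y)"
  shows "\<bar>\<integral>(x, y). f x * U x y * g y \<partial>(M \<Otimes>\<^sub>M N)\<bar>
    \<le> L2_norm (M \<Otimes>\<^sub>M N) (\<lambda>(x, y). U x y) * L2_norm M f * L2_norm N g"
proof -
  have "(\<integral>(x, y). f x * U x y * g y \<partial>(M \<Otimes>\<^sub>M N))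
    = (\<integral>z. (case z of (x, y) \<Rightarrow> U x y) * (case z of (x, y) \<Rightarrow> f x * g y) \<partial>(M \<Otimes>\<^sub>M N))"
    by (intro Bochner_Integration.integral_cong) (auto simp: mult_ac)
  then show ?thesis
    using L2_Cauchy_Schwarz[OF U square_integrable_tensor(1)[OF assms(1-4)]]
    unfolding square_integrable_tensor(2)[OF assms(1-4)] by (simp add: mult_ac)
qed

lemma kernel_Fubini:
  assumes "sigma_finite_measure M" "sigma_finite_measure N"
    and f: "square_integrable M f" and g: "square_integrable N g"
    and U: "square_integrable (M \<Otimes>\<^sub>M N) (\<lambda>(x, y). U x y)"
  shows "(\<integral>(x, y). f x * U x y * g y \<partial>(M \<Otimes>\<^sub>M N)) = (\<integral>x. f x * (\<integral>y. U x y * g y \<partial>N) \<partial>M)"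
    and "(\<integral>(x, y). f x * U x y * g y \<partial>(M \<Otimes>\<^sub>M N)) = (\<integral>y. (\<integral>x. f x * U x y \<partial>M) * g y \<partial>N)"
proof -
  interpret M: sigma_finite_measure M by fact
  interpret N: sigma_finite_measure N by fact
  interpret pair_sigma_finite M N by unfold_locales
  note i = kernel_integrable[OF assms]
  show "(\<integral>(x, y). f x * U x y * g y \<partial>(M \<Otimes>\<^sub>M N)) = (\<integral>x. f x * (\<integral>y. U x y * g y \<partial>N) \<partial>M)"
    using integral_fst'[OF i] by (simp add: mult.assoc)
  show "(\<integral>(x, y). f x * U x y * g y \<partial>(M \<Otimes>\<^sub>M N)) = (\<integral>y. (\<integral>x. f x * U x y \<partial>M) * g y \<partial>N)"
    using integral_snd[of "\<lambda>x y. f x * U x y * g y"] i by simp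
qed

text \<open>Cauchy-Schwarz in x on almost every section bounds the square of the image at y by the
  squared norm of f times the integral of U(x, y)^2 over x, and the latter is integrable in y by
  Fubini.\<close>

lemma kernel_apply_square_integrable:
  assumes "sigma_finite_measure M" "sigma_finite_measure N"
    and f: "square_integrable M f"
    and U: "square_integrable (M \<Otimes>\<^sub>M N) (\<lambda>(x, y). U x y)"
  shows "square_integrable N (\<lambda>y. \<integral>x. f x * U x y \<partial>M)"
proof -
  interpret M: sigma_finite_measure M by fact
  interpret N: sigma_finite_measure N by fact
  interpret pair_sigma_finite M N by unfold_locales
  have [measurable]: "f \<in> borel_measurable M" "(\<lambda>(x, y). U x y) \<in> borel_measurable (M \<Otimes>\<^sub>M N)"
    using f U by (auto simp: square_integrable_def)
  have i: "integrable (M \<Otimes>\<^sub>M N) (\<lambda>(x, y). (U x y)\<^sup>2)"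
    using U by (simp add: square_integrable_def split_beta')
  have ae: "AE y in N. (\<integral>x. f x * U x y \<partial>M)\<^sup>2 \<le> (L2_norm M f)\<^sup>2 * (\<integral>x. (U x y)\<^sup>2 \<partial>M)"
    using AE_integrable_snd[OF i] AE_space
  proof eventually_elim
    case (elim y)
    then have "square_integrable M (\<lambda>x. U x y)" by (auto simp: square_integrable_def)
    from power_mono[OF L2_Cauchy_Schwarz[OF f this], of 2] show ?case
      by (simp add: power_mult_distrib L2_norm_power2)
  qed
  show ?thesis
  proof (rule square_integrableI)
    show "(\<lambda>y. \<integral>x. f x * U x y \<partial>M) \<in> borel_measurable N" by measurable
    show "integrable N (\<lambda>y. (\<integral>x. f x * U x y \<partial>M)\<^sup>2)"
    proof (rule Bochner_Integration.integrable_bound)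
      show "integrable N (\<lambda>y. (L2_norm M f)\<^sup>2 * (\<integral>x. (U x y)\<^sup>2 \<partial>M))"
        using integrable_snd[OF i] by simp
      show "AE y in N. norm ((\<integral>x. f x * U x y \<partial>M)\<^sup>2) \<le> norm ((L2_norm M f)\<^sup>2 * (\<integral>x. (U x y)\<^sup>2 \<partial>M))"
        using ae by eventually_elim (simp add: abs_mult)
    qed measurable
  qed
qed

lemma kernel_transpose:
  assumes "sigma_finite_measure M" "sigma_finite_measure N"
    and U: "square_integrable (M \<Otimes>\<^sub>M N) (\<lambda>(x, y). U x y)"
  shows "square_integrable (N \<Otimes>\<^sub>M M) (\<lambda>(y, x). U x y)"
proof -
  interpret M: sigma_finite_measure M by fact
  interpret N: sigma_finite_measure N by fact
  interpret pair_sigma_finite M N by unfold_locales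
  have "integrable (N \<Otimes>\<^sub>M M) (\<lambda>(y, x). (U x y)\<^sup>2)"
    using U integrable_product_swap[of "\<lambda>(x, y). (U x y)\<^sup>2"]
    by (simp add: square_integrable_def split_beta')
  moreover have "(\<lambda>(y, x). U x y) \<in> borel_measurable (N \<Otimes>\<^sub>M M)"
    using U measurable_pair_swap'[of N M] unfolding square_integrable_def
    by (auto dest: measurable_compose[OF measurable_pair_swap'[of N M]] simp: split_beta')
  ultimately show ?thesis by (simp add: square_integrable_def split_beta')
qed

lemma kernel_apply_square_integrable':
  assumes "sigma_finite_measure M" "sigma_finite_measure N"
    and g: "square_integrable N g"
    and U: "square_integrable (M \<Otimes>\<^sub>M N) (\<lambda>(x, y). U x y)"
  shows "square_integrable M (\<lambda>x. \<integral>y. U x y * g y \<partial>N)"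
  using kernel_apply_square_integrable[OF assms(2,1) g kernel_transpose[OF assms(1,2) U]]
  by (simp add: mult.commute)

section \<open>Kernels as bilinear forms with a norm bound\<close>

definition kernel_le :: "'a measure \<Rightarrow> ('a \<Rightarrow> 'a \<Rightarrow> real) \<Rightarrow> real \<Rightarrow> bool" where
  "kernel_le M U c \<longleftrightarrow> (\<forall>f g. square_integrable M f \<longrightarrow> square_integrable M g \<longrightarrow>
     (\<integral>(x, y). f x * U x y * g y \<partial>(M \<Otimes>\<^sub>M M)) \<le> c * L2_norm M f * L2_norm M g)"

lemma kernel_leD:
  "kernel_le M U c \<Longrightarrow> square_integrable M f \<Longrightarrow> square_integrable M g \<Longrightarrow>
   (\<integral>(x, y). f x * U x y * g y \<partial>(M \<Otimes>\<^sub>M M)) \<le> c * L2_norm M f * L2_norm M g"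
  unfolding kernel_le_def by blast

lemma kernel_le_mono: "kernel_le M U a \<Longrightarrow> a \<le> b \<Longrightarrow> kernel_le M U b"
  unfolding kernel_le_def by (meson L2_norm_nonneg mult_right_mono order_trans)

lemma kernel_le_L2_norm:
  assumes "sigma_finite_measure M" "square_integrable (M \<Otimes>\<^sub>M M) (\<lambda>(x, y). U x y)"
  shows "kernel_le M U (L2_norm (M \<Otimes>\<^sub>M M) (\<lambda>(x, y). U x y))"
  unfolding kernel_le_def using kernel_bound_L2_norm[OF assms(1,1) _ _ assms(2)] abs_le_D1 by blast

text \<open>Homogeneity in f and g reduces the bound to unit vectors, and where a norm is 0 the form
  vanishes by \<open>kernel_bound_L2_norm\<close>. Spaces without unit vectors are covered: the
  supremum over the empty set is -\<infinity>, and the form is identically 0.\<close>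

lemma kernel_norm_le_iff:
  assumes M: "sigma_finite_measure M" and U: "square_integrable (M \<Otimes>\<^sub>M M) (\<lambda>(x, y). U x y)"
  shows "kernel_norm M U \<le> ereal c \<longleftrightarrow> kernel_le M U c"
proof
  assume "kernel_le M U c"
  then have "(\<integral>(x, y). f x * U x y * g y \<partial>(M \<Otimes>\<^sub>M M)) \<le> c"
    if "f \<in> L2_unit M" "g \<in> L2_unit M" for f g
    using that kernel_leD[of M U c f g] by (simp add: L2_unit_def square_integrable_def)
  then show "kernel_norm M U \<le> ereal c"
    unfolding kernel_norm_def by (auto intro!: SUP_least)
next
  assume k: "kernel_norm M U \<le> ereal c"
  show "kernel_le M U c"
    unfolding kernel_le_def
  proof (intro allI impI)
    fix f g assume f: "square_integrable M f" and g: "square_integrable M g"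
    let ?I = "\<lambda>f g. \<integral>(x, y). f x * U x y * g y \<partial>(M \<Otimes>\<^sub>M M)"
    show "?I f g \<le> c * L2_norm M f * L2_norm M g"
    proof (cases "L2_norm M f = 0 \<or> L2_norm M g = 0")
      case True
      then show ?thesis using kernel_bound_L2_norm[OF M M f g U] by auto
    next
      case False
      define a where "a = L2_norm M f"
      define b where "b = L2_norm M g"
      have ab: "a > 0" "b > 0" using False by (auto simp: a_def b_def less_le)
      have "(\<lambda>x. 1 / a * f x) \<in> L2_unit M" "(\<lambda>x. 1 / b * g x) \<in> L2_unit M"
        using square_integrable_cmult[OF f, of "1 / a"] square_integrable_cmult[OF g, of "1 / b"]
          L2_norm_cmult[of M "1 / a" f] L2_norm_cmult[of M "1 / b" g] ab
        by (auto simp: L2_unit_def square_integrable_def a_def[symmetric] b_def[symmetric])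
      then have "ereal (?I (\<lambda>x. 1 / a * f x) (\<lambda>x. 1 / b * g x)) \<le> kernel_norm M U"
        unfolding kernel_norm_def by (intro SUP_upper2[of "(\<lambda>x. 1 / a * f x, \<lambda>x. 1 / b * g x)"]) (auto simp: mult_ac)
      then have "?I (\<lambda>x. 1 / a * f x) (\<lambda>x. 1 / b * g x) \<le> c"
        using k order_trans ereal_less_eq(3) by blast
      moreover have "?I (\<lambda>x. 1 / a * f x) (\<lambda>x. 1 / b * g x) = 1 / (a * b) * ?I f g"
        unfolding integral_mult_right_zero[symmetric]
        by (intro Bochner_Integration.integral_cong) (auto simp: mult_ac)
      ultimately have "1 / (a * b) * ?I f g \<le> c" by linarith
      then have "a * b * (1 / (a * b) * ?I f g) \<le> a * b * c" using ab by (intro mult_left_mono) auto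
      then show ?thesis using ab by (simp add: a_def[symmetric] b_def[symmetric] mult_ac)
    qed
  qed
qed

lemma kernel_le_add:
  assumes "sigma_finite_measure M" "square_integrable (M \<Otimes>\<^sub>M M) (\<lambda>(x, y). U x y)"
    "square_integrable (M \<Otimes>\<^sub>M M) (\<lambda>(x, y). V x y)" "kernel_le M U a" "kernel_le M V b"
  shows "kernel_le M (\<lambda>x y. U x y + V x y) (a + b)"
  unfolding kernel_le_def
proof (intro allI impI)
  fix f g assume f: "square_integrable M f" and g: "square_integrable M g"
  have "(\<integral>(x, y). f x * (U x y + V x y) * g y \<partial>(M \<Otimes>\<^sub>M M)) =
    (\<integral>z. (case z of (x, y) \<Rightarrow> f x * U x y * g y) + (case z of (x, y) \<Rightarrow> f x * V x y * g y) \<partial>(M \<Otimes>\<^sub>M M))"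
    by (intro Bochner_Integration.integral_cong) (auto simp: algebra_simps)
  also have "\<dots> = (\<integral>(x, y). f x * U x y * g y \<partial>(M \<Otimes>\<^sub>M M)) + (\<integral>(x, y). f x * V x y * g y \<partial>(M \<Otimes>\<^sub>M M))"
    by (intro Bochner_Integration.integral_add kernel_integrable assms f g)
  also have "\<dots> \<le> (a + b) * L2_norm M f * L2_norm M g"
    using kernel_leD[OF assms(4) f g] kernel_leD[OF assms(5) f g] by (simp add: algebra_simps)
  finally show "(\<integral>(x, y). f x * (U x y + V x y) * g y \<partial>(M \<Otimes>\<^sub>M M)) \<le> (a + b) * L2_norm M f * L2_norm M g" .
qed

lemma kernel_le_uminus:
  assumes "kernel_le M U a"
  shows "kernel_le M (\<lambda>x y. - U x y) a"
  unfolding kernel_le_def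
proof (intro allI impI)
  fix f g assume f: "square_integrable M f" and g: "square_integrable M g"
  show "(\<integral>(x, y). f x * - U x y * g y \<partial>(M \<Otimes>\<^sub>M M)) \<le> a * L2_norm M f * L2_norm M g"
    using kernel_leD[OF assms square_integrable_uminus[OF f] g] by (simp add: L2_norm_uminus)
qed

text \<open>Testing the form against the image B of g itself gives that the squared norm of B is at
  most c times the norms of B and g; then one factor cancels.\<close>

lemma kernel_apply_L2_norm_le:
  assumes M: "sigma_finite_measure M" and U: "square_integrable (M \<Otimes>\<^sub>M M) (\<lambda>(x, y). U x y)"
    and k: "kernel_le M U c" and g: "square_integrable M g" and "c \<ge> 0"
  shows "L2_norm M (\<lambda>x. \<integral>y. U x y * g y \<partial>M) \<le> c * L2_norm M g"
proof -
  let ?B = "\<lambda>x. \<integral>y. U x y * g y \<partial>M"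
  have B: "square_integrable M ?B" by (rule kernel_apply_square_integrable'[OF M M g U])
  have "L2_norm M ?B * L2_norm M ?B = (\<integral>x. ?B x * ?B x \<partial>M)"
    unfolding power2_eq_square[symmetric] L2_norm_power2 ..
  also have "\<dots> \<le> c * L2_norm M ?B * L2_norm M g"
    using kernel_leD[OF k B g] kernel_Fubini(1)[OF M M B g U] by simp
  finally have "L2_norm M ?B * L2_norm M ?B \<le> L2_norm M ?B * (c * L2_norm M g)" by (simp add: mult_ac)
  then show ?thesis
    using L2_norm_nonneg[of M ?B] L2_norm_nonneg[of M g] \<open>c \<ge> 0\<close>
    by (cases "L2_norm M ?B = 0") (auto simp: less_le)
qed

text \<open>No conditional expectation is needed: for \<open>A = \<integral> f(z) U(p z, \<cdot>)\<close> one has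
  \<open>\<parallel>A\<parallel>\<^sup>2 = \<langle>f, (T A) \<circ> p\<rangle> \<le> \<parallel>f\<parallel> \<parallel>T A\<parallel> \<le> c \<parallel>f\<parallel> \<parallel>A\<parallel>\<close>, where \<open>T\<close> is the operator of \<open>U\<close> downstairs.\<close>

lemma kernel_le_pullback:
  assumes p: "measure_preserving p K Y" and Y: "sigma_finite_measure Y"
    and U: "square_integrable (Y \<Otimes>\<^sub>M Y) (\<lambda>(x, y). U x y)"
    and k: "kernel_le Y U c" and "c \<ge> 0"
  shows "kernel_le K (\<lambda>x y. U (p x) (p y)) c"
  unfolding kernel_le_def
proof (intro allI impI)
  fix f g assume f: "square_integrable K f" and g: "square_integrable K g"
  have K: "sigma_finite_measure K" by (rule measure_preserving_sigma_finite[OF p Y])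
  have Um: "(\<lambda>(x, y). U x y) \<in> borel_measurable (Y \<Otimes>\<^sub>M Y)" using U by (simp add: square_integrable_def)
  \<comment> \<open>The kernel pulled back in its first variable only: it carries functions on
    \<open>K\<close> to functions on \<open>Y\<close>.\<close>
  have V: "square_integrable (K \<Otimes>\<^sub>M Y) (\<lambda>(x, y). U (p x) y)"
    using measure_preserving_square_integrable[OF measure_preserving_map_prod[OF p measure_preserving_id Y] Um] U
    by (simp add: split_beta' map_prod_def)
  have UK: "square_integrable (K \<Otimes>\<^sub>M K) (\<lambda>(x, y). U (p x) (p y))"
    using measure_preserving_square_integrable[OF measure_preserving_map_prod[OF p p Y] Um] U
    by (simp add: split_beta' map_prod_def)
  let ?A = "\<lambda>y. \<integral>x. f x * U (p x) y \<partial>K"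
  let ?B = "\<lambda>x. \<integral>y. U x y * ?A y \<partial>Y"
  have A: "square_integrable Y ?A" by (rule kernel_apply_square_integrable[OF K Y f V])
  have B: "square_integrable Y ?B" by (rule kernel_apply_square_integrable'[OF Y Y A U])
  have Bp: "square_integrable K (\<lambda>x. ?B (p x))"
    using measure_preserving_square_integrable[OF p, of ?B] B by (simp add: square_integrable_def)
  have Ap: "square_integrable K (\<lambda>x. ?A (p x))"
    using measure_preserving_square_integrable[OF p, of ?A] A by (simp add: square_integrable_def)
  have "L2_norm Y ?A * L2_norm Y ?A = (\<integral>y. ?A y * ?A y \<partial>Y)"
    unfolding power2_eq_square[symmetric] L2_norm_power2 ..
  also have "\<dots> = (\<integral>x. f x * ?B (p x) \<partial>K)"
    using kernel_Fubini[OF K Y f A V] by simp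
  also have "\<dots> \<le> L2_norm K f * L2_norm K (\<lambda>x. ?B (p x))"
    using L2_Cauchy_Schwarz[OF f Bp] by simp
  also have "L2_norm K (\<lambda>x. ?B (p x)) = L2_norm Y ?B"
    using B by (intro measure_preserving_L2_norm[OF p]) (simp add: square_integrable_def)
  also have "L2_norm K f * L2_norm Y ?B \<le> L2_norm K f * (c * L2_norm Y ?A)"
    by (intro mult_left_mono kernel_apply_L2_norm_le[OF Y U k A \<open>c \<ge> 0\<close>]) simp
  finally have "L2_norm Y ?A * L2_norm Y ?A \<le> L2_norm Y ?A * (c * L2_norm K f)" by (simp add: mult_ac)
  then have le: "L2_norm Y ?A \<le> c * L2_norm K f"
    using L2_norm_nonneg[of Y ?A] L2_norm_nonneg[of K f] \<open>c \<ge> 0\<close>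
    by (cases "L2_norm Y ?A = 0") (auto simp: less_le)
  have "(\<integral>(x, y). f x * U (p x) (p y) * g y \<partial>(K \<Otimes>\<^sub>M K)) = (\<integral>y. ?A (p y) * g y \<partial>K)"
    using kernel_Fubini(2)[OF K K f g UK] by simp
  also have "\<dots> \<le> L2_norm K (\<lambda>x. ?A (p x)) * L2_norm K g"
    using L2_Cauchy_Schwarz[OF Ap g] by simp
  also have "L2_norm K (\<lambda>x. ?A (p x)) = L2_norm Y ?A"
    using A by (intro measure_preserving_L2_norm[OF p]) (simp add: square_integrable_def)
  also have "L2_norm Y ?A * L2_norm K g \<le> c * L2_norm K f * L2_norm K g"
    by (intro mult_right_mono le) simp
  finally show "(\<integral>(x, y). f x * U (p x) (p y) * g y \<partial>(K \<Otimes>\<^sub>M K)) \<le> c * L2_norm K f * L2_norm K g" .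
qed

text \<open>Composition with p turns test functions downstairs into test functions upstairs of the
  same norm, so the form downstairs is a special case of the form upstairs.\<close>

lemma kernel_le_pullbackD:
  assumes p: "measure_preserving p K Y" and Y: "sigma_finite_measure Y"
    and Um: "(\<lambda>(x, y). U x y) \<in> borel_measurable (Y \<Otimes>\<^sub>M Y)"
    and k: "kernel_le K (\<lambda>x y. U (p x) (p y)) c"
  shows "kernel_le Y U c"
  unfolding kernel_le_def
proof (intro allI impI)
  fix f g assume f: "square_integrable Y f" and g: "square_integrable Y g"
  have [measurable]: "f \<in> borel_measurable Y" "g \<in> borel_measurable Y"
    using f g by (auto simp: square_integrable_def)
  note [measurable] = Um
  have "(\<integral>(x, y). f x * U x y * g y \<partial>(Y \<Otimes>\<^sub>M Y)) = (\<integral>(x, y). f (p x) * U (p x) (p y) * g (p y) \<partial>(K \<Otimes>\<^sub>M K))"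
    using measure_preserving_integral[OF measure_preserving_map_prod[OF p p Y], of "\<lambda>(x, y). f x * U x y * g y"]
    by (simp add: split_beta' map_prod_def)
  also have "\<dots> \<le> c * L2_norm K (\<lambda>x. f (p x)) * L2_norm K (\<lambda>x. g (p x))"
    using f g by (intro kernel_leD[OF k]) (simp_all add: measure_preserving_square_integrable[OF p])
  also have "\<dots> = c * L2_norm Y f * L2_norm Y g"
    by (simp add: measure_preserving_L2_norm[OF p])
  finally show "(\<integral>(x, y). f x * U x y * g y \<partial>(Y \<Otimes>\<^sub>M Y)) \<le> c * L2_norm Y f * L2_norm Y g" .
qed

lemma weight_L2_norm_le:
  assumes w: "weight M w" and f: "square_integrable M f"
  shows "L2_norm (reweight M w) f \<le> L2_norm M f"
proof -
  have "(\<integral>x. w x * (f x)\<^sup>2 \<partial>M) \<le> (\<integral>x. (f x)\<^sup>2 \<partial>M)"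
    using f weight_integrable_mult[OF w, of "\<lambda>x. (f x)\<^sup>2"] w
    by (intro integral_mono) (auto simp: square_integrable_def weight_def intro: mult_left_le_one_le)
  then show ?thesis
    unfolding L2_norm_def using f weight_integral[OF w, of "\<lambda>x. (f x)\<^sup>2"]
    by (auto simp: square_integrable_def)
qed

lemma weight_square_integrable:
  "weight M w \<Longrightarrow> square_integrable M f \<Longrightarrow> square_integrable (reweight M w) f"
  by (auto simp: square_integrable_def intro: weight_integrable_imp)

text \<open>Since w^2 \<le> w for values in [0, 1], multiplication by w is a contraction from L2 of
  the reweighted measure into L2 of the original one.\<close>

lemma weight_mult_square_integrable:
  assumes w: "weight M w" and f: "square_integrable (reweight M w) f"
  shows "square_integrable M (\<lambda>x. w x * f x)"
    and "L2_norm M (\<lambda>x. w x * f x) \<le> L2_norm (reweight M w) f"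
proof -
  have [measurable]: "w \<in> borel_measurable M" "f \<in> borel_measurable M"
    using w f by (auto simp: weight_def square_integrable_def)
  have i: "integrable M (\<lambda>x. w x * (f x)\<^sup>2)"
    using weight_integrable[OF w, of "\<lambda>x. (f x)\<^sup>2"] f by (simp add: square_integrable_def)
  have le: "(w x * f x)\<^sup>2 \<le> w x * (f x)\<^sup>2" if "x \<in> space M" for x
  proof -
    have "w x * w x \<le> w x" using w that by (auto simp: weight_def mult_left_le)
    then show ?thesis
      using mult_right_mono[of "w x * w x" "w x" "(f x)\<^sup>2"] by (simp add: power_mult_distrib power2_eq_square mult_ac)
  qed
  have j: "integrable M (\<lambda>x. (w x * f x)\<^sup>2)"
  proof (rule Bochner_Integration.integrable_bound[OF i])
    show "AE x in M. norm ((w x * f x)\<^sup>2) \<le> norm (w x * (f x)\<^sup>2)"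
      using le w by (intro AE_I2) (simp add: weight_def abs_mult)
  qed simp
  then show "square_integrable M (\<lambda>x. w x * f x)" by (simp add: square_integrable_def)
  have "(\<integral>x. (w x * f x)\<^sup>2 \<partial>M) \<le> (\<integral>x. w x * (f x)\<^sup>2 \<partial>M)"
    by (intro integral_mono i j le)
  also have "\<dots> = (\<integral>x. (f x)\<^sup>2 \<partial>reweight M w)"
    using weight_integral[OF w, of "\<lambda>x. (f x)\<^sup>2"] by simp
  finally show "L2_norm M (\<lambda>x. w x * f x) \<le> L2_norm (reweight M w) f"
    unfolding L2_norm_def by (rule real_sqrt_le_mono)
qed

lemma weight_kernel_integral:
  assumes M: "sigma_finite_measure M" and w: "weight M w"
    and [measurable]: "(\<lambda>(x, y). U x y) \<in> borel_measurable (M \<Otimes>\<^sub>M M)"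
      "f \<in> borel_measurable M" "g \<in> borel_measurable M"
  shows "(\<integral>(x, y). f x * U x y * g y \<partial>(reweight M w \<Otimes>\<^sub>M reweight M w))
    = (\<integral>(x, y). (w x * f x) * U x y * (w y * g y) \<partial>(M \<Otimes>\<^sub>M M))"
  unfolding weight_pair_density[OF M w]
  by (subst weight_integral[OF weight_pair[OF w]]) (auto intro!: Bochner_Integration.integral_cong)

text \<open>The form over the reweighted measure at (f, g) is the form over \<open>M\<close> at (w
  f, w g), and multiplication by w does not increase norms.\<close>

lemma kernel_le_weight:
  assumes M: "sigma_finite_measure M" and w: "weight M w"
    and Um: "(\<lambda>(x, y). U x y) \<in> borel_measurable (M \<Otimes>\<^sub>M M)"
    and k: "kernel_le M U c" and "c \<ge> 0"
  shows "kernel_le (reweight M w) U c" (is "kernel_le ?D U c")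
  unfolding kernel_le_def
proof (intro allI impI)
  fix f g assume f: "square_integrable ?D f" and g: "square_integrable ?D g"
  have [measurable]: "f \<in> borel_measurable M" "g \<in> borel_measurable M"
    using f g by (auto simp: square_integrable_def)
  have "(\<integral>(x, y). f x * U x y * g y \<partial>(?D \<Otimes>\<^sub>M ?D)) \<le> c * L2_norm M (\<lambda>x. w x * f x) * L2_norm M (\<lambda>x. w x * g x)"
    by (subst weight_kernel_integral[OF M w Um]) (auto intro!: kernel_leD[OF k] weight_mult_square_integrable[OF w] f g)
  also have "\<dots> \<le> c * L2_norm ?D f * L2_norm ?D g"
    using \<open>c \<ge> 0\<close> by (intro mult_mono weight_mult_square_integrable[OF w] f g mult_nonneg_nonneg) auto
  finally show "(\<integral>(x, y). f x * U x y * g y \<partial>(?D \<Otimes>\<^sub>M ?D)) \<le> c * L2_norm ?D f * L2_norm ?D g" .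
qed

lemma weight_indicator: "E \<in> sets M \<Longrightarrow> weight M (indicator E)"
  by (auto simp: weight_def indicator_def)

text \<open>For a kernel that vanishes off E x E, restricting the measure to E leaves the form
  unchanged and can only lower the norms of the test functions.\<close>

lemma kernel_le_supported:
  assumes M: "sigma_finite_measure M" and E: "E \<in> sets M"
    and Um: "(\<lambda>(x, y). U x y) \<in> borel_measurable (M \<Otimes>\<^sub>M M)"
    and U0: "\<And>x y. x \<in> space M \<Longrightarrow> y \<in> space M \<Longrightarrow> x \<notin> E \<or> y \<notin> E \<Longrightarrow> U x y = 0"
    and k: "kernel_le (reweight M (indicator E)) U c" and "c \<ge> 0"
  shows "kernel_le M U c"
  unfolding kernel_le_def
proof (intro allI impI)
  let ?D = "reweight M (indicator E)"
  note w = weight_indicator[OF E]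
  fix f g assume f: "square_integrable M f" and g: "square_integrable M g"
  have [measurable]: "f \<in> borel_measurable M" "g \<in> borel_measurable M"
    using f g by (auto simp: square_integrable_def)
  have sq: "square_integrable ?D h" if "square_integrable M h" for h
    using that weight_integrable_imp[OF w, of "\<lambda>x. (h x)\<^sup>2"] by (auto simp: square_integrable_def)
  have n: "L2_norm ?D h \<le> L2_norm M h" if "square_integrable M h" for h
    unfolding L2_norm_def using that weight_integrable_mult[OF w, of "\<lambda>x. (h x)\<^sup>2"]
    by (subst weight_integral[OF w]) 
      (auto simp: square_integrable_def indicator_def intro!: integral_mono real_sqrt_le_mono)
  have "(\<integral>(x, y). f x * U x y * g y \<partial>(M \<Otimes>\<^sub>M M)) = (\<integral>(x, y). f x * U x y * g y \<partial>(?D \<Otimes>\<^sub>M ?D))"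
    using U0 by (subst weight_kernel_integral[OF M w Um])
      (auto intro!: Bochner_Integration.integral_cong simp: indicator_def space_pair_measure)
  also have "\<dots> \<le> c * L2_norm ?D f * L2_norm ?D g"
    by (intro kernel_leD[OF k] sq f g)
  also have "\<dots> \<le> c * L2_norm M f * L2_norm M g"
    using \<open>c \<ge> 0\<close> by (intro mult_mono n f g mult_nonneg_nonneg) auto
  finally show "(\<integral>(x, y). f x * U x y * g y \<partial>(M \<Otimes>\<^sub>M M)) \<le> c * L2_norm M f * L2_norm M g" .
qed

section \<open>Regular graphexes\<close>

definition abs_row :: "'a graphex \<Rightarrow> 'a \<Rightarrow> real" where
  "abs_row G x = (\<integral>y. \<bar>graphon G x y\<bar> \<partial>msp G)"

definition measurable_graphex :: "'a graphex \<Rightarrow> bool" where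
  "measurable_graphex G \<longleftrightarrow> sigma_finite_measure (msp G) \<and>
     (\<lambda>(x, y). graphon G x y) \<in> borel_measurable (msp G \<Otimes>\<^sub>M msp G) \<and>
     (\<forall>x\<in>space (msp G). \<forall>y\<in>space (msp G). graphon G x y = graphon G y x) \<and>
     star G \<in> borel_measurable (msp G)"

text \<open>The condition \<open>graphex_L1_L2\<close> taken apart: the absolute marginal is the sum
  of \<open>abs_row\<close> and the absolute star part, and differences and changes of measure act
  on the two separately. Integrability of \<open>abs_row\<close> is Fubini for the graphon.\<close>

definition regular_graphex :: "'a graphex \<Rightarrow> bool" where
  "regular_graphex G \<longleftrightarrow> measurable_graphex G \<and>
     L1_L2 (msp G \<Otimes>\<^sub>M msp G) (\<lambda>(x, y). graphon G x y) \<and>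
     L1_L2 (msp G) (star G) \<and> square_integrable (msp G) (abs_row G)"

lemma measurable_graphexD:
  assumes "measurable_graphex G"
  shows "sigma_finite_measure (msp G)"
    and "(\<lambda>(x, y). graphon G x y) \<in> borel_measurable (msp G \<Otimes>\<^sub>M msp G)"
    and "\<And>x y. x \<in> space (msp G) \<Longrightarrow> y \<in> space (msp G) \<Longrightarrow> graphon G x y = graphon G y x"
    and "star G \<in> borel_measurable (msp G)"
  using assms unfolding measurable_graphex_def by blast+

lemma abs_row_measurable:
  assumes "measurable_graphex G"
  shows "abs_row G \<in> borel_measurable (msp G)"
proof -
  interpret sigma_finite_measure "msp G" using measurable_graphexD(1)[OF assms] .
  note [measurable] = measurable_graphexD(2)[OF assms]
  show ?thesis unfolding abs_row_def by measurable
qed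

lemma marginal_measurable:
  assumes "measurable_graphex G"
  shows "marginal G \<in> borel_measurable (msp G)"
proof -
  interpret sigma_finite_measure "msp G" using measurable_graphexD(1)[OF assms] .
  note [measurable] = measurable_graphexD(2,4)[OF assms]
  show ?thesis unfolding marginal_def by measurable
qed

lemma marginal_abs_graphex: "marginal (abs_graphex G) x = abs_row G x + \<bar>star G x\<bar>"
  by (simp add: marginal_def abs_graphex_def abs_row_def)

lemma abs_row_nonneg[simp]: "0 \<le> abs_row G x"
  by (simp add: abs_row_def)

text \<open>Both summands of the absolute marginal are nonnegative, hence each is dominated by
  it.\<close>

lemma regular_graphexI:
  assumes m: "measurable_graphex G" and G: "graphex_L1_L2 G"
  shows "regular_graphex G"
proof -
  have D: "L1_L2 (msp G) (\<lambda>x. abs_row G x + \<bar>star G x\<bar>)"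
    using G unfolding graphex_L1_L2_def marginal_abs_graphex[abs_def] by simp
  have "L1_L2 (msp G) (star G)"
    by (rule L1_L2_bound[OF D measurable_graphexD(4)[OF m]]) simp
  moreover have "square_integrable (msp G) (abs_row G)"
    by (rule square_integrable_bound[OF L1_L2_square_integrable[OF D] abs_row_measurable[OF m]]) simp
  ultimately show ?thesis using m G by (simp add: regular_graphex_def graphex_L1_L2_def)
qed

lemma regular_graphexD:
  assumes "regular_graphex G"
  shows "measurable_graphex G"
    and "sigma_finite_measure (msp G)"
    and "integrable (msp G \<Otimes>\<^sub>M msp G) (\<lambda>(x, y). graphon G x y)"
    and "square_integrable (msp G \<Otimes>\<^sub>M msp G) (\<lambda>(x, y). graphon G x y)"
    and "integrable (msp G) (star G)"
    and "square_integrable (msp G) (star G)"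
    and "square_integrable (msp G) (abs_row G)"
    and "integrable (msp G) (abs_row G)"
    and "AE x in msp G. integrable (msp G) (\<lambda>y. graphon G x y)"
proof -
  show m: "measurable_graphex G" "square_integrable (msp G) (abs_row G)"
    using assms by (auto simp: regular_graphex_def)
  show s: "sigma_finite_measure (msp G)" using measurable_graphexD(1)[OF m(1)] .
  then interpret sigma_finite_measure "msp G" .
  interpret pair_sigma_finite "msp G" "msp G" by unfold_locales
  show i: "integrable (msp G \<Otimes>\<^sub>M msp G) (\<lambda>(x, y). graphon G x y)"
    "square_integrable (msp G \<Otimes>\<^sub>M msp G) (\<lambda>(x, y). graphon G x y)"
    "integrable (msp G) (star G)" "square_integrable (msp G) (star G)"
    using assms L1_L2_square_integrable by (auto simp: regular_graphex_def L1_L2_def)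
  have "integrable (msp G \<Otimes>\<^sub>M msp G) (\<lambda>(x, y). \<bar>graphon G x y\<bar>)"
    using integrable_abs[OF i(1)] by (simp add: split_beta')
  from integrable_fst'[OF this] show "integrable (msp G) (abs_row G)"
    unfolding abs_row_def by simp
  show "AE x in msp G. integrable (msp G) (\<lambda>y. graphon G x y)"
    using AE_integrable_fst'[OF i(1)] by simp
qed

lemma regular_graphex_L1_L2:
  assumes "regular_graphex G"
  shows "graphex_L1_L2 G"
proof -
  note D = regular_graphexD[OF assms]
  have "square_integrable (msp G) (\<lambda>x. \<bar>star G x\<bar>)"
    using D(6) by (auto simp: square_integrable_def)
  then have "L1_L2 (msp G) (\<lambda>x. abs_row G x + \<bar>star G x\<bar>)"
    using square_integrable_add[OF D(7)] D(5,8) by (auto simp: L1_L2_def square_integrable_def)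
  then show ?thesis
    using assms unfolding graphex_L1_L2_def marginal_abs_graphex[abs_def] regular_graphex_def by simp
qed

lemma regular_graphex_marginal:
  assumes "regular_graphex G"
  shows "square_integrable (msp G) (marginal G)" "integrable (msp G) (marginal G)"
proof -
  note D = regular_graphexD[OF assms]
  have "L1_L2 (msp G) (\<lambda>x. abs_row G x + \<bar>star G x\<bar>)"
    using regular_graphex_L1_L2[OF assms] unfolding graphex_L1_L2_def marginal_abs_graphex[abs_def] by simp
  moreover have "\<bar>marginal G x\<bar> \<le> \<bar>abs_row G x + \<bar>star G x\<bar>\<bar>" for x
    using integral_abs_bound[of "msp G" "graphon G x"] abs_row_nonneg[of G x]
    unfolding marginal_def abs_row_def by linarith
  ultimately have "L1_L2 (msp G) (marginal G)"
    using L1_L2_bound[OF _ marginal_measurable[OF D(1)]] by blast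
  then show "square_integrable (msp G) (marginal G)" "integrable (msp G) (marginal G)"
    using L1_L2_square_integrable by (auto simp: L1_L2_def)
qed

text \<open>The three quantities of \<open>d22\<close> before taking roots, each with a bound of its
  own, because reweighting and the triangle inequality treat them differently. It is stated for a
  single graphex, to be applied to a difference.\<close>

definition graphex_bound :: "'a graphex \<Rightarrow> real \<Rightarrow> real \<Rightarrow> real \<Rightarrow> bool" where
  "graphex_bound G a b r \<longleftrightarrow> kernel_le (msp G) (graphon G) a \<and>
     L2_norm (msp G) (marginal G) \<le> b \<and> \<bar>rho G\<bar> \<le> r"

subsection \<open>Pullbacks\<close>

lemma pullback_simps[simp]:
  "msp (pullback p K G) = K"
  "graphon (pullback p K G) x y = graphon G (p x) (p y)"
  "star (pullback p K G) x = star G (p x)"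
  "iso (pullback p K G) = iso G"
  by (simp_all add: pullback_def)

lemma measurable_graphex_pullback:
  assumes G: "measurable_graphex G" and [measurable]: "p \<in> measurable K (msp G)"
    and K: "sigma_finite_measure K"
  shows "measurable_graphex (pullback p K G)"
proof -
  note [measurable] = measurable_graphexD(2,4)[OF G]
  have "(\<lambda>(x, y). graphon G (p x) (p y)) \<in> borel_measurable (K \<Otimes>\<^sub>M K)"
    "(\<lambda>x. star G (p x)) \<in> borel_measurable K" by measurable
  moreover have "graphon G (p x) (p y) = graphon G (p y) (p x)" if "x \<in> space K" "y \<in> space K" for x y
    using that measurable_space[OF assms(2)] by (intro measurable_graphexD(3)[OF G]) auto
  ultimately show ?thesis using K
    by (auto simp: measurable_graphex_def pullback_def)
qed

lemma abs_row_pullback: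
  assumes G: "measurable_graphex G" and p: "measure_preserving p K (msp G)" and x: "x \<in> space K"
  shows "abs_row (pullback p K G) x = abs_row G (p x)"
proof -
  note [measurable] = measurable_graphexD(2,4)[OF G]
  have "p x \<in> space (msp G)" using p x by (auto simp: measure_preserving_def dest: measurable_space)
  then have "(\<lambda>y. \<bar>graphon G (p x) y\<bar>) \<in> borel_measurable (msp G)" by measurable
  from measure_preserving_integral[OF p this] show ?thesis
    by (simp add: abs_row_def)
qed

lemma marginal_pullback:
  assumes G: "measurable_graphex G" and p: "measure_preserving p K (msp G)" and x: "x \<in> space K"
  shows "marginal (pullback p K G) x = marginal G (p x)"
proof -
  note [measurable] = measurable_graphexD(2,4)[OF G]
  have "p x \<in> space (msp G)" using p x by (auto simp: measure_preserving_def dest: measurable_space)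
  then have "(\<lambda>y. graphon G (p x) y) \<in> borel_measurable (msp G)" by measurable
  from measure_preserving_integral[OF p this] show ?thesis
    by (simp add: marginal_def)
qed

lemma regular_graphex_pullback_iff:
  assumes G: "measurable_graphex G" and p: "measure_preserving p K (msp G)"
  shows "regular_graphex (pullback p K G) \<longleftrightarrow> regular_graphex G"
proof -
  note D = measurable_graphexD[OF G]
  have K: "measurable_graphex (pullback p K G)"
    using G p measure_preserving_sigma_finite[OF p D(1)]
    by (intro measurable_graphex_pullback) (auto simp: measure_preserving_def)
  have "L1_L2 (K \<Otimes>\<^sub>M K) (\<lambda>(x, y). graphon G (p x) (p y)) \<longleftrightarrow> L1_L2 (msp G \<Otimes>\<^sub>M msp G) (\<lambda>(x, y). graphon G x y)"
    using measure_preserving_L1_L2[OF measure_preserving_map_prod[OF p p D(1)] D(2)]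
    by (simp add: split_beta' map_prod_def)
  moreover have "L1_L2 K (\<lambda>x. star G (p x)) \<longleftrightarrow> L1_L2 (msp G) (star G)"
    by (rule measure_preserving_L1_L2[OF p D(4)])
  moreover have "square_integrable K (abs_row (pullback p K G)) \<longleftrightarrow> square_integrable (msp G) (abs_row G)"
    using square_integrable_cong[of K, OF abs_row_pullback[OF G p]]
      measure_preserving_square_integrable[OF p abs_row_measurable[OF G]] by simp
  ultimately show ?thesis
    using K G by (simp add: regular_graphex_def pullback_def)
qed

lemma rho_pullback:
  assumes G: "measurable_graphex G" and p: "measure_preserving p K (msp G)"
  shows "rho (pullback p K G) = rho G"
proof -
  note D = measurable_graphexD[OF G]
  show ?thesis
    using measure_preserving_integral[OF measure_preserving_map_prod[OF p p D(1)] D(2)]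
      measure_preserving_integral[OF p D(4)]
    by (simp add: rho_def split_beta' map_prod_def)
qed

text \<open>The direction upwards needs the argument of \<open>kernel_le_pullback\<close>, the
  direction downwards only composition of test functions. Together they allow a difference to be
  moved freely between a glued space and its image in the outer coordinates.\<close>

lemma graphex_bound_pullback_iff:
  assumes G: "regular_graphex G" and p: "measure_preserving p K (msp G)" and "a \<ge> 0"
  shows "graphex_bound (pullback p K G) a b r \<longleftrightarrow> graphex_bound G a b r"
proof -
  note R = regular_graphexD[OF G] and D = measurable_graphexD[OF regular_graphexD(1)[OF G]]
  have "L2_norm K (marginal (pullback p K G)) = L2_norm (msp G) (marginal G)"
    using L2_norm_cong[of K, OF marginal_pullback[OF R(1) p]]
      measure_preserving_L2_norm[OF p marginal_measurable[OF R(1)]] by simp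
  moreover have "kernel_le K (graphon (pullback p K G)) a \<longleftrightarrow> kernel_le (msp G) (graphon G) a"
    using kernel_le_pullback[OF p D(1) R(4)] kernel_le_pullbackD[OF p D(1,2)] \<open>a \<ge> 0\<close>
    by (auto simp: pullback_def)
  ultimately show ?thesis
    by (simp add: graphex_bound_def rho_pullback[OF R(1) p])
qed

subsection \<open>Differences\<close>

definition graphex_diff :: "'a graphex \<Rightarrow> 'a graphex \<Rightarrow> 'a graphex" where
  "graphex_diff G H = \<lparr>msp = msp G, graphon = (\<lambda>x y. graphon G x y - graphon H x y),
     star = (\<lambda>x. star G x - star H x), iso = iso G - iso H\<rparr>"

lemma graphex_diff_simps[simp]:
  "msp (graphex_diff G H) = msp G"
  "graphon (graphex_diff G H) x y = graphon G x y - graphon H x y"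
  "star (graphex_diff G H) x = star G x - star H x"
  "iso (graphex_diff G H) = iso G - iso H"
  by (simp_all add: graphex_diff_def)

lemma pullback_graphex_diff:
  "pullback p K (graphex_diff G H) = graphex_diff (pullback p K G) (pullback p K H)"
  by (simp add: pullback_def graphex_diff_def)

lemma pullback_pullback: "pullback p K (pullback q L G) = pullback (\<lambda>x. q (p x)) K G"
  by (simp add: pullback_def)

lemma measurable_graphex_diff:
  assumes "measurable_graphex G" "measurable_graphex H" "msp H = msp G"
  shows "measurable_graphex (graphex_diff G H)"
proof -
  note [measurable] = measurable_graphexD(2,4)[OF assms(1)] measurable_graphexD(2,4)[OF assms(2), unfolded assms(3)]
  have "(\<lambda>(x, y). graphon G x y - graphon H x y) \<in> borel_measurable (msp G \<Otimes>\<^sub>M msp G)"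
    "(\<lambda>x. star G x - star H x) \<in> borel_measurable (msp G)"
    by measurable
  then show ?thesis
    using measurable_graphexD(1,3)[OF assms(1)] measurable_graphexD(3)[OF assms(2)]
    by (auto simp: measurable_graphex_def graphex_diff_def assms(3))
qed

text \<open>Equality holds only almost everywhere: on a section that is not integrable the integral
  defaults to 0 and additivity may fail.\<close>

lemma marginal_graphex_diff:
  assumes G: "regular_graphex G" and H: "regular_graphex H" and s: "msp H = msp G"
  shows "AE x in msp G. marginal (graphex_diff G H) x = marginal G x - marginal H x"
  using regular_graphexD(9)[OF G] regular_graphexD(9)[OF H, unfolded s]
  by eventually_elim (simp add: marginal_def s)

lemma rho_graphex_diff:
  assumes G: "regular_graphex G" and H: "regular_graphex H" and s: "msp H = msp G"
  shows "rho (graphex_diff G H) = rho G - rho H"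
  using regular_graphexD(3,5)[OF G] regular_graphexD(3,5)[OF H, unfolded s]
  by (simp add: rho_def s split_beta')

lemma square_integrable_graphex_diff:
  assumes G: "regular_graphex G" and H: "regular_graphex H" and s: "msp H = msp G"
  shows "square_integrable (msp G \<Otimes>\<^sub>M msp G) (\<lambda>(x, y). graphon G x y - graphon H x y)"
  using square_integrable_diff[OF regular_graphexD(4)[OF G] regular_graphexD(4)[OF H, unfolded s]]
  by (simp add: split_beta')

lemma regular_graphex_diff:
  assumes G: "regular_graphex G" and H: "regular_graphex H" and s: "msp H = msp G"
  shows "regular_graphex (graphex_diff G H)"
proof -
  have m: "measurable_graphex (graphex_diff G H)"
    by (rule measurable_graphex_diff[OF regular_graphexD(1)[OF G] regular_graphexD(1)[OF H] s])
  note RG = regular_graphexD[OF G] and RH = regular_graphexD[OF H, unfolded s]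
  have ae: "AE x in msp G. \<bar>abs_row (graphex_diff G H) x\<bar> \<le> \<bar>abs_row G x + abs_row H x\<bar>"
    using RG(9) RH(9)
  proof eventually_elim
    case (elim x)
    have "(\<integral>y. \<bar>graphon G x y - graphon H x y\<bar> \<partial>msp G) \<le> (\<integral>y. \<bar>graphon G x y\<bar> + \<bar>graphon H x y\<bar> \<partial>msp G)"
      using elim by (intro integral_mono) auto
    also have "\<dots> = abs_row G x + abs_row H x"
      using elim by (simp add: abs_row_def s)
    finally show ?case by (simp add: abs_row_def)
  qed
  have rm: "abs_row (graphex_diff G H) \<in> borel_measurable (msp G)"
    using abs_row_measurable[OF m] by simp
  have "square_integrable (msp G) (abs_row (graphex_diff G H))"
    by (rule square_integrable_bound[OF square_integrable_add[OF RG(7) RH(7)] rm ae])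
  moreover have "L1_L2 (msp G) (\<lambda>x. star G x - star H x)"
    using square_integrable_diff[OF RG(6) RH(6)] Bochner_Integration.integrable_diff[OF RG(5) RH(5)]
    by (simp add: L1_L2_def square_integrable_def)
  moreover have "L1_L2 (msp G \<Otimes>\<^sub>M msp G) (\<lambda>(x, y). graphon G x y - graphon H x y)"
    using square_integrable_graphex_diff[OF G H s] Bochner_Integration.integrable_diff[OF RG(3) RH(3)]
    by (simp add: L1_L2_def square_integrable_def split_beta')
  ultimately show ?thesis
    using m by (simp add: regular_graphex_def graphex_diff_def)
qed

lemma L2_norm_marginal_graphex_diff:
  assumes G: "regular_graphex G" and H: "regular_graphex H" and s: "msp H = msp G"
  shows "L2_norm (msp G) (marginal (graphex_diff G H)) = L2_norm (msp G) (\<lambda>x. marginal G x - marginal H x)"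
proof (rule L2_norm_cong_AE[OF _ _ marginal_graphex_diff[OF assms]])
  show "marginal (graphex_diff G H) \<in> borel_measurable (msp G)"
    using marginal_measurable[OF regular_graphexD(1)[OF regular_graphex_diff[OF assms]]] by simp
  show "(\<lambda>x. marginal G x - marginal H x) \<in> borel_measurable (msp G)"
    using marginal_measurable[OF regular_graphexD(1)[OF G]] marginal_measurable[OF regular_graphexD(1)[OF H], unfolded s]
    by simp
qed

lemma graphex_bound_diff_iff:
  assumes G: "regular_graphex G" and H: "regular_graphex H" and s: "msp H = msp G"
  shows "graphex_bound (graphex_diff G H) a b r \<longleftrightarrow>
    kernel_le (msp G) (\<lambda>x y. graphon G x y - graphon H x y) a \<and>
    L2_norm (msp G) (\<lambda>x. marginal G x - marginal H x) \<le> b \<and> \<bar>rho G - rho H\<bar> \<le> r"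
  by (simp add: graphex_bound_def L2_norm_marginal_graphex_diff[OF assms] rho_graphex_diff[OF assms])
     (simp add: graphex_diff_def)

lemma d22_le_iff:
  assumes G: "regular_graphex G" and H: "regular_graphex H" and s: "msp H = msp G" and c: "c \<ge> 0"
  shows "d22 G H \<le> ereal c \<longleftrightarrow> graphex_bound (graphex_diff G H) c (c\<^sup>2) (c^3)"
proof -
  have "sqrt x \<le> c \<longleftrightarrow> x \<le> c\<^sup>2" for x
    using c real_sqrt_le_iff[of x "c\<^sup>2"] by simp
  moreover have "root 3 x \<le> c \<longleftrightarrow> x \<le> c^3" for x
    using c real_root_le_iff[of 3 x "c^3"] by (simp add: real_root_power_cancel)
  ultimately show ?thesis
    unfolding graphex_bound_diff_iff[OF G H s] d22_def
    using kernel_norm_le_iff[OF regular_graphexD(2)[OF G] square_integrable_graphex_diff[OF G H s]]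
    by simp
qed

lemma d22_le:
  assumes G: "regular_graphex G" and H: "regular_graphex H" and s: "msp H = msp G"
    and "graphex_bound (graphex_diff G H) a b r"
  shows "d22 G H \<le> ereal (max a (max (sqrt b) (root 3 r)))"
proof -
  note 1 = assms(4)[unfolded graphex_bound_diff_iff[OF G H s]]
  have "kernel_norm (msp G) (\<lambda>x y. graphon G x y - graphon H x y) \<le> ereal a"
    using 1 kernel_norm_le_iff[OF regular_graphexD(2)[OF G] square_integrable_graphex_diff[OF G H s]] by blast
  moreover have "sqrt (L2_norm (msp G) (\<lambda>x. marginal G x - marginal H x)) \<le> sqrt b"
    using 1 by (intro real_sqrt_le_mono) blast
  moreover have "root 3 \<bar>rho G - rho H\<bar> \<le> root 3 r"
    using 1 by (intro real_root_le_mono) auto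
  ultimately show ?thesis
    unfolding d22_def ereal_max by (intro max.mono) (simp_all only: ereal_less_eq)
qed

lemma graphex_bound_diff_trans:
  assumes G: "regular_graphex G" and H: "regular_graphex H" and L: "regular_graphex L"
    and s: "msp H = msp G" "msp L = msp G"
    and 1: "graphex_bound (graphex_diff G H) a b r" and 2: "graphex_bound (graphex_diff H L) a' b' r'"
  shows "graphex_bound (graphex_diff G L) (a + a') (b + b') (r + r')"
proof -
  note HL = H L s(2)[folded s(1)]
  note 1 = 1[unfolded graphex_bound_diff_iff[OF G H s(1)]]
  note 2 = 2[unfolded graphex_bound_diff_iff[OF HL] s]
  have k: "kernel_le (msp G) (\<lambda>x y. (graphon G x y - graphon H x y) + (graphon H x y - graphon L x y)) (a + a')"
    by (rule kernel_le_add[OF regular_graphexD(2)[OF G] square_integrable_graphex_diff[OF G H s(1)]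
        square_integrable_graphex_diff[OF HL, unfolded s]]) (use 1 2 in blast)+
  note m = regular_graphex_marginal(1)[OF G] regular_graphex_marginal(1)[OF H, unfolded s] regular_graphex_marginal(1)[OF L, unfolded s]
  have "L2_norm (msp G) (\<lambda>x. (marginal G x - marginal H x) + (marginal H x - marginal L x)) \<le> b + b'"
    using 1 2 L2_norm_triangle[OF square_integrable_diff[OF m(1,2)] square_integrable_diff[OF m(2,3)]]
    by linarith
  moreover have "\<bar>rho G - rho L\<bar> \<le> r + r'" using 1 2 by linarith
  ultimately show ?thesis
    unfolding graphex_bound_diff_iff[OF G L s(2)] using k by simp
qed

lemma graphex_bound_diff_commute:
  assumes G: "regular_graphex G" and H: "regular_graphex H" and s: "msp H = msp G"
    and 1: "graphex_bound (graphex_diff G H) a b r"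
  shows "graphex_bound (graphex_diff H G) a b r"
  using 1 kernel_le_uminus[of "msp G" "\<lambda>x y. graphon G x y - graphon H x y" a]
    L2_norm_uminus[of "msp G" "\<lambda>x. marginal G x - marginal H x"]
  unfolding graphex_bound_diff_iff[OF G H s] graphex_bound_diff_iff[OF H G s[symmetric]]
  by (simp add: s abs_minus_commute)

subsection \<open>Change of measure\<close>

lemma measurable_graphex_weight:
  assumes "measurable_graphex G" "weight (msp G) w"
  shows "measurable_graphex (G\<lparr>msp := reweight (msp G) w\<rparr>)"
proof -
  have "sets (reweight (msp G) w \<Otimes>\<^sub>M reweight (msp G) w) = sets (msp G \<Otimes>\<^sub>M msp G)"
    by (intro sets_pair_measure_cong) auto
  then show ?thesis
    using measurable_graphexD[OF assms(1)] weight_sigma_finite[OF _ assms(2)] measurable_cong_sets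
    by (auto simp: measurable_graphex_def)
qed

lemma regular_graphex_weight:
  assumes G: "regular_graphex G" and w: "weight (msp G) w"
  shows "regular_graphex (G\<lparr>msp := reweight (msp G) w\<rparr>)" (is "regular_graphex ?H")
proof -
  note R = regular_graphexD[OF G] and D = measurable_graphexD[OF regular_graphexD(1)[OF G]]
  have m: "measurable_graphex ?H" by (rule measurable_graphex_weight[OF R(1) w])
  have "L1_L2 (msp G \<Otimes>\<^sub>M msp G) (\<lambda>(x, y). graphon G x y)" "L1_L2 (msp G) (star G)"
    using G by (auto simp: regular_graphex_def)
  from weight_L1_L2[OF weight_pair[OF w] this(1)] weight_L1_L2[OF w this(2)]
  have "L1_L2 (msp ?H \<Otimes>\<^sub>M msp ?H) (\<lambda>(x, y). graphon G x y)" "L1_L2 (msp ?H) (star G)"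
    by (simp_all add: weight_pair_density[OF D(1) w])
  moreover have "square_integrable (msp ?H) (abs_row ?H)"
  proof (rule square_integrable_bound)
    show "square_integrable (msp ?H) (abs_row G)"
      using weight_square_integrable[OF w R(7)] by simp
    show "abs_row ?H \<in> borel_measurable (msp ?H)" by (rule abs_row_measurable[OF m])
    have "AE x in msp G. \<bar>abs_row ?H x\<bar> \<le> \<bar>abs_row G x\<bar>"
      using R(9) AE_space
    proof eventually_elim
      case (elim x)
      note [measurable] = D(2)
      have "(\<lambda>y. \<bar>graphon G x y\<bar>) \<in> borel_measurable (msp G)" using elim by measurable
      then have "abs_row ?H x = (\<integral>y. w y * \<bar>graphon G x y\<bar> \<partial>msp G)"
        unfolding abs_row_def by (simp add: weight_integral[OF w])
      also have "\<dots> \<le> abs_row G x"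
        unfolding abs_row_def using elim w weight_integrable_mult[OF w, of "\<lambda>y. \<bar>graphon G x y\<bar>"]
        by (intro integral_mono) (auto simp: weight_def intro: mult_left_le_one_le)
      finally show ?case by simp
    qed
    moreover have "msp ?H = reweight (msp G) w" by simp
    ultimately show "AE x in msp ?H. \<bar>abs_row ?H x\<bar> \<le> \<bar>abs_row G x\<bar>"
      using weight_AE_density[OF w] by metis
  qed
  ultimately show ?thesis using m by (simp add: regular_graphex_def)
qed

text \<open>With \<open>v = 1 - w\<close>, changing the measure subtracts \<open>\<integral> U(\<cdot>, y) v(y)\<close> from the marginal and
  \<open>2 \<integral> D v - \<integral>\<integral> v U v\<close> from \<open>\<rho>\<close>, and \<open>\<parallel>v\<parallel>\<^sub>2\<^sup>2 \<le> \<integral> v \<le> e\<^sup>2\<close>.\<close>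

lemma graphex_bound_weight:
  assumes G: "regular_graphex G" and w: "weight (msp G) w" and c: "c \<ge> 0" and e: "e \<ge> 0"
    and defect: "(\<integral>\<^sup>+x. ennreal (1 - w x) \<partial>msp G) \<le> ennreal (e\<^sup>2)"
    and bound: "graphex_bound G c (c\<^sup>2) (c^3)"
  shows "graphex_bound (G\<lparr>msp := reweight (msp G) w\<rparr>) c (c * (c + e)) (c * (c + e)\<^sup>2)"
    (is "graphex_bound ?H _ _ _")
proof -
  define M where "M = msp G"
  define W where "W = graphon G"
  define S where "S = star G"
  define v where "v x = 1 - w x" for x
  define D where "D = marginal G"
  note R = regular_graphexD[OF G, folded M_def W_def S_def]
  note Mm = measurable_graphexD[OF R(1), folded M_def W_def S_def]
  note w = w[folded M_def]
  interpret sigma_finite_measure M using R(2) .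
  interpret pair_sigma_finite M M by unfold_locales
  have [measurable]: "w \<in> borel_measurable M" using w by (simp add: weight_def)
  have [measurable]: "v \<in> borel_measurable M" by (simp add: v_def[abs_def])
  note [measurable] = Mm(2,4)
  have v01: "0 \<le> v x" "v x \<le> 1" if "x \<in> space M" for x
    using w that by (auto simp: weight_def v_def)
  have vi: "integrable M v"
  proof (rule integrableI_bounded)
    have "(\<integral>\<^sup>+x. ennreal (norm (v x)) \<partial>M) = (\<integral>\<^sup>+x. ennreal (1 - w x) \<partial>M)"
      using v01 by (intro nn_integral_cong) (simp add: v_def)
    also have "\<dots> \<le> ennreal (e\<^sup>2)" using defect by (simp add: M_def)
    finally show "(\<integral>\<^sup>+x. ennreal (norm (v x)) \<partial>M) < \<infinity>"
      using ennreal_less_top le_less_trans by (metis infinity_ennreal_def)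
  qed simp
  have v_le: "(\<integral>x. v x \<partial>M) \<le> e\<^sup>2"
  proof -
    have "ennreal (\<integral>x. v x \<partial>M) = (\<integral>\<^sup>+x. ennreal (v x) \<partial>M)"
      by (rule nn_integral_eq_integral[symmetric, OF vi]) (use v01 in auto)
    then have "ennreal (\<integral>x. v x \<partial>M) \<le> ennreal (e\<^sup>2)" using defect by (simp add: M_def v_def)
    then show ?thesis by (simp add: ennreal_le_iff)
  qed
  have sq_le: "(v x)\<^sup>2 \<le> v x" if "x \<in> space M" for x
    using v01[OF that] by (simp add: power2_eq_square mult_left_le)
  have v2: "integrable M (\<lambda>x. (v x)\<^sup>2)"
    using sq_le v01 by (intro Bochner_Integration.integrable_bound[OF vi] AE_I2) auto
  have vs: "square_integrable M v" using v2 by (simp add: square_integrable_def)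
  have vn: "L2_norm M v \<le> e"
  proof (rule power2_le_imp_le[OF _ e])
    have "(L2_norm M v)\<^sup>2 \<le> (\<integral>x. v x \<partial>M)"
      unfolding L2_norm_power2 by (intro integral_mono v2 vi sq_le)
    with v_le show "(L2_norm M v)\<^sup>2 \<le> e\<^sup>2" by linarith
  qed
  have k: "kernel_le M W c" and Dn: "L2_norm M D \<le> c\<^sup>2" and rn: "\<bar>rho G\<bar> \<le> c^3"
    using bound by (auto simp: graphex_bound_def M_def W_def D_def)
  have Ds: "square_integrable M D" "integrable M D"
    using regular_graphex_marginal[OF G] by (auto simp: M_def D_def)
  let ?B = "\<lambda>x. \<integral>y. W x y * v y \<partial>M"
  have Bs: "square_integrable M ?B" by (rule kernel_apply_square_integrable'[OF R(2,2) vs R(4)])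
  have Bn: "L2_norm M ?B \<le> c * e"
    using kernel_apply_L2_norm_le[OF R(2,4) k vs c] mult_left_mono[OF vn c] by linarith
  have H: "regular_graphex ?H" using regular_graphex_weight[OF G w[unfolded M_def]] .
  have mH: "msp ?H = reweight M w" by (simp add: M_def)
  have mul: "integrable M (\<lambda>y. W x y * v y)" if "integrable M (\<lambda>y. W x y)" for x
  proof (rule Bochner_Integration.integrable_bound[OF that])
    show "(\<lambda>y. W x y * v y) \<in> borel_measurable M" using that by simp
    show "AE y in M. norm (W x y * v y) \<le> norm (W x y)"
      using v01 by (intro AE_I2) (simp add: abs_mult mult_left_le)
  qed
  have AE9: "AE x in M. integrable M (\<lambda>y. W x y)" using R(9) by (simp add: M_def)
  have marg: "AE x in M. marginal ?H x = D x + - ?B x"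
    using AE9
  proof eventually_elim
    case (elim x)
    have "(\<integral>y. graphon G x y \<partial>reweight M w) = (\<integral>y. w y * W x y \<partial>M)"
      using elim by (subst weight_integral[OF w]) (auto simp: W_def)
    also have "\<dots> = (\<integral>y. W x y - W x y * v y \<partial>M)"
      by (intro Bochner_Integration.integral_cong) (auto simp: v_def algebra_simps)
    also have "\<dots> = (\<integral>y. W x y \<partial>M) - ?B x"
      by (rule Bochner_Integration.integral_diff[OF elim mul[OF elim]])
    finally show ?case by (simp add: marginal_def D_def M_def W_def)
  qed
  have "L2_norm (msp ?H) (marginal ?H) = L2_norm (msp ?H) (\<lambda>x. D x + - ?B x)"
  proof (rule L2_norm_cong_AE)
    show "marginal ?H \<in> borel_measurable (msp ?H)" by (rule marginal_measurable[OF regular_graphexD(1)[OF H]])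
    show "(\<lambda>x. D x + - ?B x) \<in> borel_measurable (msp ?H)"
      using square_integrable_measurable[OF square_integrable_add[OF Ds(1) square_integrable_uminus[OF Bs]]]
      by (simp add: mH)
    show "AE x in msp ?H. marginal ?H x = D x + - ?B x"
      unfolding mH by (rule weight_AE_density[OF w marg])
  qed
  also have "\<dots> \<le> L2_norm M (\<lambda>x. D x + - ?B x)"
    unfolding mH by (intro weight_L2_norm_le[OF w] square_integrable_add Ds square_integrable_uminus Bs)
  also have "\<dots> \<le> L2_norm M D + L2_norm M ?B"
    using L2_norm_triangle[OF Ds(1) square_integrable_uminus[OF Bs]] by (simp add: L2_norm_uminus)
  also have "\<dots> \<le> c\<^sup>2 + c * e" using Dn Bn by linarith
  also have "\<dots> = c * (c + e)" by (simp add: power2_eq_square algebra_simps)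
  finally have 2: "L2_norm (msp ?H) (marginal ?H) \<le> c * (c + e)" .
  let ?P = "M \<Otimes>\<^sub>M M"
  have i1: "integrable ?P (\<lambda>(x, y). W x y)" by (rule R(3))
  have i4: "integrable ?P (\<lambda>(x, y). v x * W x y * v y)" by (rule kernel_integrable[OF R(2,2) vs vs R(4)])
  have ivW: "integrable ?P (\<lambda>z. W (fst z) (snd z) * f z)"
    if f: "f \<in> borel_measurable ?P" "\<And>z. z \<in> space ?P \<Longrightarrow> \<bar>f z\<bar> \<le> 1" for f
  proof (rule Bochner_Integration.integrable_bound[OF i1])
    show "(\<lambda>z. W (fst z) (snd z) * f z) \<in> borel_measurable ?P"
      using f(1) Mm(2) by (simp add: split_beta')
    show "AE z in ?P. norm (W (fst z) (snd z) * f z) \<le> norm (case z of (x, y) \<Rightarrow> W x y)"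
      using f(2) by (intro AE_I2) (auto simp: abs_mult split_beta' intro: mult_left_le)
  qed
  have i2: "integrable ?P (\<lambda>(x, y). W x y * v x)"
    using ivW[of "\<lambda>z. v (fst z)"] v01 by (auto simp: split_beta' space_pair_measure)
  have i3: "integrable ?P (\<lambda>(x, y). W x y * v y)"
    using ivW[of "\<lambda>z. v (snd z)"] v01 by (auto simp: split_beta' space_pair_measure)
  let ?R = "\<lambda>x. \<integral>y. W x y \<partial>M"
  have e2: "(\<integral>(x, y). W x y * v x \<partial>?P) = (\<integral>x. ?R x * v x \<partial>M)"
    using integral_fst'[OF i2] by simp
  have e3: "(\<integral>(x, y). W x y * v y \<partial>?P) = (\<integral>x. ?R x * v x \<partial>M)"
  proof -
    have "(\<integral>(x, y). W x y * v y \<partial>?P) = (\<integral>y. (\<integral>x. W x y * v y \<partial>M) \<partial>M)"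
      using integral_snd[of "\<lambda>x y. W x y * v y"] i3 by simp
    also have "\<dots> = (\<integral>y. ?R y * v y \<partial>M)"
    proof (rule Bochner_Integration.integral_cong[OF refl])
      fix y assume "y \<in> space M"
      then have "(\<integral>x. W x y \<partial>M) = ?R y"
        using Mm(3) by (intro Bochner_Integration.integral_cong) auto
      then show "(\<integral>x. W x y * v y \<partial>M) = ?R y * v y" by simp
    qed
    finally show ?thesis .
  qed
  have iS: "integrable M S" and iSv: "integrable M (\<lambda>x. S x * v x)"
    using R(5) square_integrable_mult[OF R(6) vs] by auto
  have iDv: "integrable M (\<lambda>x. D x * v x)" by (rule square_integrable_mult[OF Ds(1) vs])
  have Deq: "D x * v x = ?R x * v x + S x * v x" for x
    by (simp add: D_def marginal_def W_def S_def M_def algebra_simps)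
  have iRv: "integrable M (\<lambda>x. ?R x * v x)"
    using Bochner_Integration.integrable_diff[OF iDv iSv] unfolding Deq by simp
  have eD: "(\<integral>x. D x * v x \<partial>M) = (\<integral>x. ?R x * v x \<partial>M) + (\<integral>x. S x * v x \<partial>M)"
    unfolding Deq by (rule Bochner_Integration.integral_add[OF iRv iSv])
  have "(\<integral>(x, y). graphon G x y \<partial>(msp ?H \<Otimes>\<^sub>M msp ?H)) = (\<integral>z. w (fst z) * w (snd z) * (case z of (x, y) \<Rightarrow> W x y) \<partial>?P)"
    unfolding mH weight_pair_density[OF R(2) w] W_def[symmetric]
    by (rule weight_integral[OF weight_pair[OF w] Mm(2)])
  \<comment> \<open>Expansion of w(x) w(y) = (1 - v(x)) (1 - v(y)). The two mixed terms have the
    same integral because W is symmetric, which is \<open>e2\<close> and \<open>e3\<close>.\<close>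
  also have "\<dots> = (\<integral>z. (case z of (x, y) \<Rightarrow> W x y) - (case z of (x, y) \<Rightarrow> W x y * v x)
      - (case z of (x, y) \<Rightarrow> W x y * v y) + (case z of (x, y) \<Rightarrow> v x * W x y * v y) \<partial>?P)"
    by (intro Bochner_Integration.integral_cong) (auto simp: v_def algebra_simps)
  also have "\<dots> = (\<integral>(x, y). W x y \<partial>?P) - (\<integral>x. ?R x * v x \<partial>M) - (\<integral>x. ?R x * v x \<partial>M)
      + (\<integral>(x, y). v x * W x y * v y \<partial>?P)"
    by (simp only: Bochner_Integration.integral_add Bochner_Integration.integral_diff
        Bochner_Integration.integrable_diff i1 i2 i3 i4 e2 e3)
  finally have r1: "(\<integral>(x, y). graphon G x y \<partial>(msp ?H \<Otimes>\<^sub>M msp ?H)) = (\<integral>(x, y). W x y \<partial>?P)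
      - 2 * (\<integral>x. ?R x * v x \<partial>M) + (\<integral>(x, y). v x * W x y * v y \<partial>?P)" by simp
  have "(\<integral>x. star G x \<partial>msp ?H) = (\<integral>x. w x * S x \<partial>M)"
    unfolding mH S_def[symmetric] using Mm(4) by (intro weight_integral[OF w])
  also have "\<dots> = (\<integral>x. S x - S x * v x \<partial>M)"
    by (intro Bochner_Integration.integral_cong) (auto simp: v_def algebra_simps)
  also have "\<dots> = (\<integral>x. S x \<partial>M) - (\<integral>x. S x * v x \<partial>M)" using iS iSv by simp
  finally have r2: "(\<integral>x. star G x \<partial>msp ?H) = (\<integral>x. S x \<partial>M) - (\<integral>x. S x * v x \<partial>M)" .
  \<comment> \<open>The two mixed terms and twice the loss in the star part combine into twice the
    integral of D v, so that the bound on the full marginal can be used.\<close>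
  have "rho ?H = rho G - 2 * (\<integral>x. D x * v x \<partial>M) + (\<integral>(x, y). v x * W x y * v y \<partial>?P)"
    using r1 r2 unfolding eD by (simp add: rho_def M_def W_def S_def)
  moreover have "\<bar>\<integral>x. D x * v x \<partial>M\<bar> \<le> c\<^sup>2 * e"
    using L2_Cauchy_Schwarz[OF Ds(1) vs] mult_mono[OF Dn vn] by simp
  moreover have "\<bar>\<integral>(x, y). v x * W x y * v y \<partial>?P\<bar> \<le> c * e\<^sup>2"
  proof -
    have "c * L2_norm M v * L2_norm M v \<le> c * e * e"
      using vn c e by (intro mult_mono) auto
    moreover have "(\<integral>(x, y). v x * W x y * v y \<partial>?P) \<le> c * L2_norm M v * L2_norm M v"
      by (rule kernel_leD[OF k vs vs])
    \<comment> \<open>\<open>kernel_le\<close> bounds the form from above only; the lower bound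
      comes from the test function -v.\<close>
    moreover have "- (\<integral>(x, y). v x * W x y * v y \<partial>?P) \<le> c * L2_norm M v * L2_norm M v"
      using kernel_leD[OF k square_integrable_uminus[OF vs] vs]
      by (simp add: L2_norm_uminus split_beta')
    ultimately show ?thesis by (simp add: power2_eq_square mult_ac)
  qed
  ultimately have "\<bar>rho ?H\<bar> \<le> c^3 + 2 * (c\<^sup>2 * e) + c * e\<^sup>2"
    using rn by linarith
  also have "\<dots> = c * (c + e)\<^sup>2" by (simp add: power2_eq_square power3_eq_cube algebra_simps)
  finally have 3: "\<bar>rho ?H\<bar> \<le> c * (c + e)\<^sup>2" .
  have "kernel_le (msp ?H) (graphon ?H) c"
    using kernel_le_weight[OF R(2) w Mm(2) k c] by (simp add: mH W_def M_def)
  with 2 3 show ?thesis by (simp only: graphex_bound_def)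
qed

section \<open>Graphexes that vanish outside a subset\<close>

definition supported_on :: "'a set \<Rightarrow> 'a graphex \<Rightarrow> bool" where
  "supported_on E G \<longleftrightarrow> (\<forall>x\<in>space (msp G). \<forall>y\<in>space (msp G). x \<notin> E \<or> y \<notin> E \<longrightarrow> graphon G x y = 0) \<and>
     (\<forall>x\<in>space (msp G). x \<notin> E \<longrightarrow> star G x = 0)"

lemma supported_integral:
  fixes f :: "'a \<Rightarrow> real"
  assumes "E \<in> sets M" "f \<in> borel_measurable M" "\<And>x. x \<in> space M \<Longrightarrow> x \<notin> E \<Longrightarrow> f x = 0"
  shows "integral\<^sup>L (reweight M (indicator E)) f = integral\<^sup>L M f"
    and "integrable (reweight M (indicator E)) f \<longleftrightarrow> integrable M f"
proof -
  have eq: "indicator E x * f x = f x" if "x \<in> space M" for x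
    using assms(3)[OF that] by (auto simp: indicator_def)
  note w = weight_indicator[OF assms(1)]
  show "integral\<^sup>L (reweight M (indicator E)) f = integral\<^sup>L M f"
    unfolding weight_integral[OF w assms(2)] by (rule Bochner_Integration.integral_cong[OF refl eq])
  show "integrable (reweight M (indicator E)) f \<longleftrightarrow> integrable M f"
    unfolding weight_integrable[OF w assms(2)] by (rule Bochner_Integration.integrable_cong[OF refl eq])
qed

lemma supported_square:
  fixes f :: "'a \<Rightarrow> real"
  assumes "E \<in> sets M" "f \<in> borel_measurable M" "\<And>x. x \<in> space M \<Longrightarrow> x \<notin> E \<Longrightarrow> f x = 0"
  shows "L2_norm (reweight M (indicator E)) f = L2_norm M f"
    and "square_integrable (reweight M (indicator E)) f \<longleftrightarrow> square_integrable M f"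
    and "L1_L2 (reweight M (indicator E)) f \<longleftrightarrow> L1_L2 M f"
  using supported_integral[OF assms] supported_integral[OF assms(1), of "\<lambda>x. (f x)\<^sup>2"] assms(2,3)
  by (auto simp: L2_norm_def square_integrable_def L1_L2_def)

lemma density_indicator_pair:
  assumes "sigma_finite_measure M" "E \<in> sets M"
  shows "reweight M (indicator E) \<Otimes>\<^sub>M reweight M (indicator E)
    = reweight (M \<Otimes>\<^sub>M M) (indicator (E \<times> E))"
proof -
  have "(\<lambda>z. ennreal (indicator E (fst z) * indicator E (snd z))) = (\<lambda>z. ennreal (indicator (E \<times> E) z))"
    by (auto simp: fun_eq_iff indicator_def)
  then show ?thesis
    using weight_pair_density[OF assms(1) weight_indicator[OF assms(2)]] by simp
qed

context
  fixes G :: "'a graphex" and E :: "'a set"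
  assumes G: "measurable_graphex G" and E: "E \<in> sets (msp G)" and s: "supported_on E G"
begin

abbreviation "restricted \<equiv> G\<lparr>msp := reweight (msp G) (indicator E)\<rparr>"

lemma supported_measurable_section:
  "x \<in> space (msp G) \<Longrightarrow> (\<lambda>y. graphon G x y) \<in> borel_measurable (msp G)"
  using measurable_graphexD(2)[OF G] by measurable

lemma supported_marginal: "x \<in> space (msp G) \<Longrightarrow> marginal restricted x = marginal G x"
  using supported_integral(1)[OF E supported_measurable_section, of x] s
  by (auto simp: marginal_def supported_on_def)

lemma supported_abs_row: "x \<in> space (msp G) \<Longrightarrow> abs_row restricted x = abs_row G x"
  using supported_integral(1)[OF E borel_measurable_abs[OF supported_measurable_section], of x] s
  by (auto simp: abs_row_def supported_on_def)

lemma supported_pair_zero: "z \<in> space (msp G \<Otimes>\<^sub>M msp G) \<Longrightarrow> z \<notin> E \<times> E \<Longrightarrow> (case z of (x, y) \<Rightarrow> graphon G x y) = 0"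
  using s by (cases z) (auto simp: supported_on_def space_pair_measure)

lemma supported_pair_sets: "E \<times> E \<in> sets (msp G \<Otimes>\<^sub>M msp G)"
  using E by simp

text \<open>All integrands vanish off the support, so cutting the measure down to it changes none of
  them. With the companion lemma on bounds, the mass of a coupling outside the support of the
  difference may be altered at will.\<close>

lemma regular_graphex_supported_iff: "regular_graphex restricted \<longleftrightarrow> regular_graphex G"
proof -
  note D = measurable_graphexD[OF G]
  have "measurable_graphex restricted"
    by (rule measurable_graphex_weight[OF G weight_indicator[OF E]])
  moreover have "L1_L2 (msp restricted \<Otimes>\<^sub>M msp restricted) (\<lambda>(x, y). graphon G x y)
      \<longleftrightarrow> L1_L2 (msp G \<Otimes>\<^sub>M msp G) (\<lambda>(x, y). graphon G x y)"
    using supported_square(3)[OF supported_pair_sets D(2) supported_pair_zero]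
    by (simp add: density_indicator_pair[OF D(1) E])
  moreover have "L1_L2 (msp restricted) (star G) \<longleftrightarrow> L1_L2 (msp G) (star G)"
    using supported_square(3)[OF E D(4)] s by (simp add: supported_on_def)
  moreover have "square_integrable (msp restricted) (abs_row restricted) \<longleftrightarrow> square_integrable (msp G) (abs_row G)"
  proof -
    have "square_integrable (msp restricted) (abs_row restricted) \<longleftrightarrow> square_integrable (msp restricted) (abs_row G)"
      by (rule square_integrable_cong) (simp add: supported_abs_row)
    also have "\<dots> \<longleftrightarrow> square_integrable (msp G) (abs_row G)"
      using supported_square(2)[OF E abs_row_measurable[OF G]] s
      by (simp add: supported_on_def abs_row_def cong: Bochner_Integration.integral_cong)
    finally show ?thesis .
  qed
  ultimately show ?thesis using G by (simp add: regular_graphex_def)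
qed

lemma graphex_bound_supported_iff:
  assumes "a \<ge> 0"
  shows "graphex_bound restricted a b r \<longleftrightarrow> graphex_bound G a b r"
proof -
  note D = measurable_graphexD[OF G]
  have "rho restricted = rho G"
    using supported_integral(1)[OF supported_pair_sets D(2) supported_pair_zero] supported_integral(1)[OF E D(4)] s
    by (simp add: rho_def density_indicator_pair[OF D(1) E] supported_on_def)
  moreover have "L2_norm (msp restricted) (marginal restricted) = L2_norm (msp G) (marginal G)"
  proof -
    have "L2_norm (msp restricted) (marginal restricted) = L2_norm (msp restricted) (marginal G)"
      by (rule L2_norm_cong) (simp add: supported_marginal)
    also have "\<dots> = L2_norm (msp G) (marginal G)"
      using supported_square(1)[OF E marginal_measurable[OF G]] s
      by (simp add: supported_on_def marginal_def cong: Bochner_Integration.integral_cong)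
    finally show ?thesis .
  qed
  moreover have "kernel_le (msp restricted) (graphon restricted) a \<longleftrightarrow> kernel_le (msp G) (graphon G) a"
    using kernel_le_supported[OF D(1) E D(2), of a] kernel_le_weight[OF D(1) weight_indicator[OF E] D(2), of a]
      assms s by (auto simp: supported_on_def)
  ultimately show ?thesis by (simp add: graphex_bound_def)
qed

end

section \<open>Sums of measures and couplings with the half-line\<close>

lemma sigma_finite_le:
  assumes "sigma_finite_measure M" "sets N = sets M" "\<And>A. A \<in> sets M \<Longrightarrow> emeasure N A \<le> emeasure M A"
  shows "sigma_finite_measure N"
proof -
  obtain A where A: "countable A" "A \<subseteq> sets M" "\<Union>A = space M" "\<forall>a\<in>A. emeasure M a \<noteq> \<infinity>"
    using sigma_finite_measure.sigma_finite_countable[OF assms(1)] by blast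
  have "emeasure N a \<noteq> \<infinity>" if "a \<in> A" for a
    using assms(3)[of a] A that by (auto simp: top_unique)
  then show ?thesis
    unfolding sigma_finite_measure_def using A assms(2) sets_eq_imp_space_eq[OF assms(2)]
    by (intro exI[of _ A]) simp
qed

definition add_measure :: "'a measure \<Rightarrow> 'a measure \<Rightarrow> 'a measure" where
  "add_measure M N = measure_of (space M) (sets M) (\<lambda>A. emeasure M A + emeasure N A)"

lemma sets_add_measure[simp]: "sets (add_measure M N) = sets M"
  and space_add_measure[simp]: "space (add_measure M N) = space M"
  by (simp_all add: add_measure_def)

lemma emeasure_add_measure:
  assumes "sets N = sets M" "A \<in> sets M"
  shows "emeasure (add_measure M N) A = emeasure M A + emeasure N A"
proof (rule emeasure_measure_of[OF add_measure_def])
  show "countably_additive (sets (add_measure M N)) (\<lambda>A. emeasure M A + emeasure N A)"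
  proof (rule countably_additiveI)
    fix F :: "nat \<Rightarrow> _" assume F: "range F \<subseteq> sets (add_measure M N)" and d: "disjoint_family F"
    then show "(\<Sum>i. emeasure M (F i) + emeasure N (F i)) = emeasure M (\<Union>i. F i) + emeasure N (\<Union>i. F i)"
      using suminf_emeasure[of F M] suminf_emeasure[of F N] assms(1)
      by (simp add: suminf_add[symmetric])
  qed
qed (use assms sets.sets_into_space in \<open>auto simp: positive_def\<close>)

text \<open>The case a = 0 is included: then 1 / a = 0, but x = 0 as well. This lets pieces of
  measure 0 pass through \<open>couple_half_line\<close> without a case distinction.\<close>

lemma ennreal_mult_inverse_of_real:
  "a \<ge> 0 \<Longrightarrow> x \<le> ennreal a \<Longrightarrow> x * (ennreal a * ennreal (1 / a)) = x"
  by (cases "a = 0") (auto simp: ennreal_mult[symmetric])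

text \<open>The masses of a partition into finite pieces cut \<open>[0, \<infinity>)\<close> into consecutive intervals of
  these lengths; each piece is coupled with its interval by the normalised product measure.\<close>

lemma couple_half_line:
  assumes N: "sigma_finite_measure N" and inf: "emeasure N (space N) = \<infinity>"
  obtains C where "sets C = sets (N \<Otimes>\<^sub>M (lborel :: real measure))"
    "\<And>B. B \<in> sets N \<Longrightarrow> emeasure C (B \<times> UNIV) = emeasure N B"
    "\<And>B. B \<in> sets borel \<Longrightarrow> emeasure C (space N \<times> B) = emeasure lborel (B \<inter> {0..})"
proof -
  interpret sigma_finite_measure N by fact
  obtain A :: "nat \<Rightarrow> 'a set" where A: "range A \<subseteq> sets N" "(\<Union>i. A i) = space N"
    "\<And>i. emeasure N (A i) \<noteq> \<infinity>" "disjoint_family A"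
    using sigma_finite_disjoint by blast
  have As[measurable]: "A i \<in> sets N" for i using A(1) by auto
  define a where "a i = measure N (A i)" for i
  have a: "emeasure N (A i) = ennreal (a i)" "a i \<ge> 0" for i
    using A(3) by (auto simp: a_def emeasure_eq_ennreal_measure top.not_eq_extremum)
  define s where "s n = (\<Sum>i<n. a i)" for n
  define I where "I i = {s i..<s (Suc i)}" for i
  have s_Suc: "s (Suc i) = s i + a i" for i by (simp add: s_def)
  have s_mono: "i \<le> j \<Longrightarrow> s i \<le> s j" for i j
    unfolding s_def using a(2) by (intro sum_mono2) auto
  have Is[measurable]: "I i \<in> sets borel" for i by (simp add: I_def)
  have dI: "disjoint_family I"
  proof -
    have "I i \<inter> I j = {}" if "i < j" for i j
      using s_mono[of "Suc i" j] that by (auto simp: I_def)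
    then show ?thesis
      unfolding disjoint_family_on_def by (metis inf_commute linorder_neqE_nat)
  qed
  have UI: "(\<Union>i. I i) = {0..}"
  proof
    show "(\<Union>i. I i) \<subseteq> {0..}" using s_mono[OF le0] by (fastforce simp: I_def s_def intro: order_trans)
    show "{0..} \<subseteq> (\<Union>i. I i)"
    proof
      fix t :: real assume t: "t \<in> {0..}"
      \<comment> \<open>The interval lengths add up to the total mass of \<open>N\<close>, which is
        infinite, so the intervals reach beyond every t.\<close>
      have "\<exists>n. t < s n"
      proof (rule ccontr)
        assume "\<not> (\<exists>n. t < s n)"
        then have "(\<Sum>i<n. ennreal (a i)) \<le> ennreal t" for n
          using a(2) by (simp add: sum_ennreal s_def not_less ennreal_leI)
        then have "(\<Sum>i. ennreal (a i)) \<le> ennreal t" by (intro suminf_le_const) auto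
        moreover have "(\<Sum>i. ennreal (a i)) = \<infinity>"
          using suminf_emeasure[OF A(1,4)] A(2) inf by (simp add: a(1))
        ultimately show False by (simp add: top_unique)
      qed
      then obtain n where n: "t < s n" "\<And>m. m < n \<Longrightarrow> \<not> t < s m"
        using exists_least_iff[of "\<lambda>n. t < s n"] by blast
      have "n \<noteq> 0" using n(1) t by (cases n) (auto simp: s_def)
      then obtain m where "n = Suc m" by (cases n) auto
      then show "t \<in> (\<Union>i. I i)" using n by (force simp: I_def)
    qed
  qed
  have lI: "emeasure lborel (I i) = ennreal (a i)" for i
    using a(2) by (simp add: I_def s_Suc)
  \<comment> \<open>For a piece of measure 0 the factor 1 / a i is 0 by convention; the piece is
    null and its interval is empty, so nothing is lost.\<close>
  define h where "h z = (\<Sum>i. ennreal (1 / a i) * indicator (A i \<times> I i) z)" for z :: "'a \<times> real"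
  have hm[measurable]: "h \<in> borel_measurable (N \<Otimes>\<^sub>M lborel)"
    unfolding h_def by measurable
  define C where "C = density (N \<Otimes>\<^sub>M (lborel :: real measure)) h"
  have C: "emeasure C (B \<times> B') = (\<Sum>i. ennreal (1 / a i) * (emeasure N (A i \<inter> B) * emeasure lborel (I i \<inter> B')))"
    if [measurable]: "B \<in> sets N" "B' \<in> sets borel" for B B'
  proof -
    have "emeasure C (B \<times> B') = (\<integral>\<^sup>+z. h z * indicator (B \<times> B') z \<partial>(N \<Otimes>\<^sub>M lborel))"
      unfolding C_def by (rule emeasure_density) auto
    also have "\<dots> = (\<integral>\<^sup>+z. (\<Sum>i. ennreal (1 / a i) * indicator ((A i \<inter> B) \<times> (I i \<inter> B')) z) \<partial>(N \<Otimes>\<^sub>M lborel))"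
      unfolding h_def ennreal_suminf_multc[symmetric]
      by (intro nn_integral_cong arg_cong[where f=suminf] ext) (auto simp: indicator_def)
    also have "\<dots> = (\<Sum>i. \<integral>\<^sup>+z. ennreal (1 / a i) * indicator ((A i \<inter> B) \<times> (I i \<inter> B')) z \<partial>(N \<Otimes>\<^sub>M lborel))"
      by (rule nn_integral_suminf) measurable
    also have "\<dots> = (\<Sum>i. ennreal (1 / a i) * (emeasure N (A i \<inter> B) * emeasure lborel (I i \<inter> B')))"
    proof (intro arg_cong[where f=suminf] ext)
      fix i
      have "(A i \<inter> B) \<times> (I i \<inter> B') \<in> sets (N \<Otimes>\<^sub>M lborel)" by measurable
      then show "(\<integral>\<^sup>+z. ennreal (1 / a i) * indicator ((A i \<inter> B) \<times> (I i \<inter> B')) z \<partial>(N \<Otimes>\<^sub>M lborel))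
        = ennreal (1 / a i) * (emeasure N (A i \<inter> B) * emeasure lborel (I i \<inter> B'))"
        by (subst nn_integral_cmult_indicator) (auto simp: lborel.emeasure_pair_measure_Times)
    qed
    finally show ?thesis .
  qed
  show ?thesis
  proof
    show "sets C = sets (N \<Otimes>\<^sub>M (lborel :: real measure))" by (simp add: C_def)
    show "emeasure C (B \<times> UNIV) = emeasure N B" if B[measurable]: "B \<in> sets N" for B
    proof -
      have "emeasure C (B \<times> UNIV) = (\<Sum>i. emeasure N (A i \<inter> B) * (ennreal (a i) * ennreal (1 / a i)))"
        by (subst C) (auto simp: lI mult_ac)
      also have "\<dots> = (\<Sum>i. emeasure N (A i \<inter> B))"
      proof (intro arg_cong[where f=suminf] ext ennreal_mult_inverse_of_real a)
        show "emeasure N (A i \<inter> B) \<le> ennreal (a i)" for i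
          unfolding a(1)[symmetric] by (intro emeasure_mono) auto
      qed
      also have "\<dots> = emeasure N (\<Union>i. A i \<inter> B)"
        using A(4) by (intro suminf_emeasure) (auto simp: disjoint_family_on_def)
      also have "(\<Union>i. A i \<inter> B) = B" using A(2) sets.sets_into_space[OF B] by auto
      finally show ?thesis .
    qed
    show "emeasure C (space N \<times> B) = emeasure lborel (B \<inter> {0..})" if [measurable]: "B \<in> sets borel" for B
    proof -
      have [simp]: "A i \<inter> space N = A i" for i using sets.sets_into_space[OF As[of i]] by auto
      have "emeasure C (space N \<times> B) = (\<Sum>i. emeasure lborel (I i \<inter> B) * (ennreal (a i) * ennreal (1 / a i)))"
        by (subst C) (auto simp: a mult_ac)
      also have "\<dots> = (\<Sum>i. emeasure lborel (I i \<inter> B))"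
      proof (intro arg_cong[where f=suminf] ext ennreal_mult_inverse_of_real a)
        show "emeasure lborel (I i \<inter> B) \<le> ennreal (a i)" for i
          unfolding lI[symmetric] by (intro emeasure_mono) auto
      qed
      also have "\<dots> = emeasure lborel (\<Union>i. I i \<inter> B)"
        using dI by (intro suminf_emeasure) (auto simp: disjoint_family_on_def)
      also have "(\<Union>i. I i \<inter> B) = B \<inter> {0..}" using UI by auto
      finally show ?thesis .
    qed
  qed
qed

section \<open>Trivial extensions\<close>

lemma measurable_Inl_ext[measurable]: "Inl \<in> measurable M (ext_measure M)"
proof (rule measurableI)
  fix A assume "A \<in> sets (ext_measure M)"
  then have "Inl -` A \<in> sets M" "Inl -` A \<subseteq> space M" by (auto simp: sets_ext_measure)
  moreover from this(2) have "Inl -` A \<inter> space M = Inl -` A" by auto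
  ultimately show "Inl -` A \<inter> space M \<in> sets M" by simp
qed auto

lemma measurable_Inr_ext[measurable]: "Inr \<in> measurable borel (ext_measure M)"
  by (rule measurableI) (auto simp: sets_ext_measure)

lemma Inl_sets_ext[measurable]: "A \<in> sets M \<Longrightarrow> Inl ` A \<in> sets (ext_measure M)"
proof -
  assume A: "A \<in> sets M"
  have "Inl -` (Inl ` A :: ('a + real) set) = A" "Inr -` (Inl ` A :: ('a + real) set) = {}" by auto
  then show ?thesis using A sets.sets_into_space[OF A] by (auto simp: sets_ext_measure)
qed

lemma Inr_sets_ext[measurable]: "B \<in> sets borel \<Longrightarrow> Inr ` B \<in> sets (ext_measure M)"
proof -
  assume B: "B \<in> sets borel"
  have "Inr -` (Inr ` B :: ('a + real) set) = B" "Inl -` (Inr ` B :: ('a + real) set) = {}" by auto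
  then show ?thesis using B by (auto simp: sets_ext_measure)
qed

lemma emeasure_ext_Inl: "A \<in> sets M \<Longrightarrow> emeasure (ext_measure M) (Inl ` A) = emeasure M A"
proof -
  assume A: "A \<in> sets M"
  have "Inl -` (Inl ` A :: ('a + real) set) = A" "Inr -` (Inl ` A :: ('a + real) set) = {}" by auto
  then show ?thesis using emeasure_ext_measure[OF Inl_sets_ext[OF A]] by simp
qed

lemma vimage_Inl_ext: "B \<in> sets (ext_measure M) \<Longrightarrow> Inl -` B \<in> sets M"
  and vimage_Inr_ext: "B \<in> sets (ext_measure M) \<Longrightarrow> Inr -` B \<in> sets borel"
  by (auto simp: sets_ext_measure)

lemma ext_Int_Inl: "B \<in> sets (ext_measure M) \<Longrightarrow> B \<inter> Inl ` space M = Inl ` (Inl -` B)"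
  using sets.sets_into_space[of "Inl -` B" M] vimage_Inl_ext[of B M] by auto

lemma sets_ext_measure_cong: "sets M = sets N \<Longrightarrow> sets (ext_measure M) = sets (ext_measure N)"
  by (simp add: sets_ext_measure sets_eq_imp_space_eq[of M N])

lemma measurable_case_ext:
  assumes f: "f \<in> measurable M L" and g: "g \<in> measurable borel L"
  shows "case_sum f g \<in> measurable (ext_measure M) L"
proof (rule measurableI)
  fix x assume "x \<in> space (ext_measure M)"
  then show "case_sum f g x \<in> space L"
    using measurable_space[OF f] measurable_space[OF g] by auto
next
  fix A assume A: "A \<in> sets L"
  have "Inl -` (case_sum f g -` A \<inter> space (ext_measure M)) = f -` A \<inter> space M"
    "Inr -` (case_sum f g -` A \<inter> space (ext_measure M)) = g -` A" by auto
  then show "case_sum f g -` A \<inter> space (ext_measure M) \<in> sets (ext_measure M)"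
    using measurable_sets[OF f A] measurable_sets[OF g A] by (auto simp: sets_ext_measure)
qed

lemma trivial_ext_simps[simp]:
  "msp (trivial_ext G) = ext_measure (msp G)"
  "graphon (trivial_ext G) (Inl x) (Inl y) = graphon G x y"
  "graphon (trivial_ext G) (Inr t) v = 0"
  "graphon (trivial_ext G) u (Inr t) = 0"
  "star (trivial_ext G) (Inl x) = star G x"
  "star (trivial_ext G) (Inr t) = 0"
  "iso (trivial_ext G) = iso G"
  by (simp_all add: trivial_ext_def split: sum.split)

lemma measurable_graphex_trivial_ext:
  assumes G: "measurable_graphex G"
  shows "measurable_graphex (trivial_ext G)"
proof -
  note D = measurable_graphexD[OF G]
  let ?M = "msp G" and ?X = "ext_measure (msp G)"
  have star: "star (trivial_ext G) \<in> borel_measurable ?X"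
  proof -
    have "star (trivial_ext G) = case_sum (star G) (\<lambda>_. 0)"
      by (auto simp: fun_eq_iff split: sum.split)
    then show ?thesis using measurable_case_ext[OF D(4), of "\<lambda>_. 0"] by simp
  qed
  have "(\<lambda>(u, v). graphon (trivial_ext G) u v) \<in> borel_measurable (?X \<Otimes>\<^sub>M ?X)"
  proof (cases "space ?M = {}")
    case True
    have "(\<lambda>(u, v). graphon (trivial_ext G) u v) \<in> borel_measurable (?X \<Otimes>\<^sub>M ?X)
      \<longleftrightarrow> (\<lambda>_. 0 :: real) \<in> borel_measurable (?X \<Otimes>\<^sub>M ?X)"
      by (rule measurable_cong) (auto simp: space_pair_measure True)
    then show ?thesis by simp
  next
    case False
    then obtain x0 where x0: "x0 \<in> space ?M" by auto
    \<comment> \<open>A retraction of the extension onto the original space. The arbitrary point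
      \<open>x0\<close> that it assigns to the line does no harm, because the indicator masks those
      values.\<close>
    define q where "q = case_sum (\<lambda>x. x) (\<lambda>_ :: real. x0)"
    have [measurable]: "q \<in> measurable ?X ?M"
      unfolding q_def using x0 by (intro measurable_case_ext) auto
    note [measurable] = D(2)
    have "(\<lambda>(u, v). indicator (Inl ` space ?M \<times> Inl ` space ?M) (u, v) * graphon G (q u) (q v))
      \<in> borel_measurable (?X \<Otimes>\<^sub>M ?X)" by measurable
    moreover have "(\<lambda>(u, v). graphon (trivial_ext G) u v) \<in> borel_measurable (?X \<Otimes>\<^sub>M ?X) \<longleftrightarrow>
      (\<lambda>(u, v). indicator (Inl ` space ?M \<times> Inl ` space ?M) (u, v) * graphon G (q u) (q v))
      \<in> borel_measurable (?X \<Otimes>\<^sub>M ?X)"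
      by (rule measurable_cong) (auto simp: space_pair_measure q_def indicator_def)
    ultimately show ?thesis by simp
  qed
  with star D show ?thesis
    by (auto simp: measurable_graphex_def sigma_finite_ext_measure)
qed

lemma pullback_Inl_trivial_ext: "pullback Inl (msp G) (trivial_ext G) = G"
  by (simp add: pullback_def)

text \<open>The extended measure restricted to the copy of the original space. "Finite" refers to
  the position away from the added line: the total mass is that of \<open>M\<close> and may be
  infinite.\<close>

abbreviation finite_part :: "'a measure \<Rightarrow> ('a + real) measure" where
  "finite_part M \<equiv> reweight (ext_measure M) (indicator (Inl ` space M))"

lemma emeasure_density_indicator:
  assumes "E \<in> sets M" "A \<in> sets M"
  shows "emeasure (reweight M (indicator E)) A = emeasure M (E \<inter> A)"
proof -
  have "emeasure (reweight M (indicator E)) A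
      = (\<integral>\<^sup>+x. ennreal (indicator E x) * indicator A x \<partial>M)"
    using assms by (intro emeasure_density) auto
  also have "\<dots> = (\<integral>\<^sup>+x. indicator (E \<inter> A) x \<partial>M)"
    by (intro nn_integral_cong) (simp split: split_indicator)
  also have "\<dots> = emeasure M (E \<inter> A)" using assms by (intro nn_integral_indicator) auto
  finally show ?thesis .
qed

lemma emeasure_finite_part:
  "B \<in> sets (ext_measure M) \<Longrightarrow> emeasure (finite_part M) B = emeasure M (Inl -` B)"
  using emeasure_density_indicator[of "Inl ` space M" "ext_measure M" B]
    emeasure_ext_Inl[OF vimage_Inl_ext, of B M] ext_Int_Inl[of B M]
  by (simp add: Int_commute Inl_sets_ext)

lemma measure_preserving_Inl: "measure_preserving Inl M (finite_part M)"
proof -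
  have "distr M (finite_part M) Inl = finite_part M"
  proof (rule measure_eqI)
    fix B assume "B \<in> sets (distr M (finite_part M) Inl)"
    then have B: "B \<in> sets (ext_measure M)" by simp
    have "Inl -` B \<inter> space M = Inl -` B" using sets.sets_into_space[OF vimage_Inl_ext[OF B]] by auto
    with B show "emeasure (distr M (finite_part M) Inl) B = emeasure (finite_part M) B"
      by (simp add: emeasure_distr emeasure_finite_part)
  qed simp
  then show ?thesis by (simp add: measure_preserving_def)
qed

lemma trivial_ext_supported: "supported_on (Inl ` space (msp G)) (trivial_ext G)"
  by (auto simp: supported_on_def)

abbreviation trivial_ext_finite :: "'a graphex \<Rightarrow> ('a + real) graphex" where
  "trivial_ext_finite G \<equiv> (trivial_ext G)\<lparr>msp := finite_part (msp G)\<rparr>"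

text \<open>Pulled back along \<open>Inl\<close> this is \<open>G\<close> itself, and regularity
  descends along a measure-preserving map.\<close>

lemma regular_graphex_trivial_ext_finite:
  assumes "regular_graphex G"
  shows "regular_graphex (trivial_ext_finite G)"
proof -
  have m: "measurable_graphex (trivial_ext_finite G)"
    using measurable_graphex_weight[OF measurable_graphex_trivial_ext[OF regular_graphexD(1)[OF assms]]
      weight_indicator, of "Inl ` space (msp G)"] by (simp add: Inl_sets_ext)
  have "pullback Inl (msp G) (trivial_ext_finite G) = G"
    using pullback_Inl_trivial_ext[of G] by (simp add: pullback_def)
  moreover have msp: "msp (trivial_ext_finite G) = finite_part (msp G)" by simp
  moreover have "regular_graphex (pullback Inl (msp G) (trivial_ext_finite G)) \<longleftrightarrow> regular_graphex (trivial_ext_finite G)"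
    by (rule regular_graphex_pullback_iff[OF m])
      (unfold msp, rule measure_preserving_Inl)
  ultimately show ?thesis using assms by simp
qed

lemma regular_graphex_trivial_ext:
  assumes "regular_graphex G"
  shows "regular_graphex (trivial_ext G)"
  using regular_graphex_supported_iff[OF measurable_graphex_trivial_ext[OF regular_graphexD(1)[OF assms]] _
      trivial_ext_supported] regular_graphex_trivial_ext_finite[OF assms]
  by (simp add: Inl_sets_ext)

text \<open>Where \<open>p\<close> takes values in the added Lebesgue line, its distribution is irrelevant.\<close>

definition ext_preserving :: "('z \<Rightarrow> 'a + real) \<Rightarrow> 'z measure \<Rightarrow> 'a measure \<Rightarrow> bool" where
  "ext_preserving p Z M \<longleftrightarrow> p \<in> measurable Z (ext_measure M) \<and>
     (\<forall>A\<in>sets M. emeasure Z (p -` (Inl ` A) \<inter> space Z) = emeasure M A)"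

lemma measure_preserving_ext_preserving:
  assumes p: "measure_preserving p Z (ext_measure M)"
  shows "ext_preserving p Z M"
  unfolding ext_preserving_def
proof (intro conjI ballI)
  show m: "p \<in> measurable Z (ext_measure M)" using p by (simp add: measure_preserving_def)
  fix A assume A: "A \<in> sets M"
  have "emeasure Z (p -` (Inl ` A) \<inter> space Z) = emeasure (distr Z (ext_measure M) p) (Inl ` A)"
    using m Inl_sets_ext[OF A] by (simp add: emeasure_distr)
  also have "distr Z (ext_measure M) p = ext_measure M" using p by (simp add: measure_preserving_def)
  finally show "emeasure Z (p -` (Inl ` A) \<inter> space Z) = emeasure M A" by (simp add: emeasure_ext_Inl A)
qed

text \<open>The pullback is supported on the preimage \<open>E\<close> of the original space, and on
  \<open>E\<close> the map p preserves measure onto \<open>finite_part\<close>. So support and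
  pullback together reduce the claim to the extension restricted to the original space.\<close>

lemma regular_graphex_pullback_ext:
  assumes p: "ext_preserving p Z (msp G)" and Z: "sigma_finite_measure Z" and G: "regular_graphex G"
  shows "regular_graphex (pullback p Z (trivial_ext G))"
proof -
  let ?X = "ext_measure (msp G)"
  have [measurable]: "p \<in> measurable Z ?X" using p by (simp add: ext_preserving_def)
  define E where "E = p -` (Inl ` space (msp G)) \<inter> space Z"
  have E: "E \<in> sets Z" unfolding E_def by (rule measurable_sets[of p Z ?X]) (auto simp: Inl_sets_ext)
  note T = measurable_graphex_trivial_ext[OF regular_graphexD(1)[OF G]]
  have m: "measurable_graphex (pullback p Z (trivial_ext G))"
    by (rule measurable_graphex_pullback[OF T _ Z]) simp
  have "p x \<in> Inr ` UNIV" if "x \<in> space Z" "x \<notin> E" for x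
    using measurable_space[of p Z ?X x] that by (auto simp: E_def)
  then have s: "supported_on E (pullback p Z (trivial_ext G))"
    by (fastforce simp: supported_on_def)
  have "measure_preserving p (reweight Z (indicator E)) (finite_part (msp G))"
  proof -
    have "distr (reweight Z (indicator E)) (finite_part (msp G)) p = finite_part (msp G)"
    proof (rule measure_eqI)
      fix B assume "B \<in> sets (distr (reweight Z (indicator E)) (finite_part (msp G)) p)"
      then have B: "B \<in> sets ?X" by simp
      have "E \<inter> (p -` B \<inter> space Z) = p -` (B \<inter> Inl ` space (msp G)) \<inter> space Z" by (auto simp: E_def)
      then have "emeasure Z (E \<inter> (p -` B \<inter> space Z)) = emeasure (msp G) (Inl -` B)"
        using p vimage_Inl_ext[OF B] unfolding ext_Int_Inl[OF B] ext_preserving_def by (simp del: image_vimage_eq)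
      then show "emeasure (distr (reweight Z (indicator E)) (finite_part (msp G)) p) B
        = emeasure (finite_part (msp G)) B"
        unfolding emeasure_finite_part[OF B] using B E by (simp add: emeasure_distr emeasure_density_indicator)
    qed simp
    then show ?thesis by (simp add: measure_preserving_def)
  qed
  then have "regular_graphex (pullback p (reweight Z (indicator E)) (trivial_ext_finite G))"
    using regular_graphex_trivial_ext_finite[OF G] regular_graphexD(1)[OF regular_graphex_trivial_ext_finite[OF G]]
    by (subst regular_graphex_pullback_iff) auto
  moreover have "pullback p (reweight Z (indicator E)) (trivial_ext_finite G)
    = (pullback p Z (trivial_ext G))\<lparr>msp := reweight Z (indicator E)\<rparr>"
    by (simp add: pullback_def)
  ultimately show ?thesis
    using regular_graphex_supported_iff[OF m _ s] E by simp
qed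

section \<open>Completing a partial coupling\<close>

lemma Inr_range_sets[measurable]: "range Inr \<in> sets (ext_measure M)"
  by (rule Inr_sets_ext) simp

lemma Plus_UNIV_sets_ext[simp]: "space M <+> UNIV \<in> sets (ext_measure M)"
  using sets.top[of "ext_measure M"] by simp

lemma emeasure_lborel_lessThan_0: "emeasure lborel {..<0 :: real} = \<infinity>"
proof -
  have "ennreal (real n) \<le> emeasure lborel {..<0 :: real}" for n
  proof -
    have "ennreal (real n) = emeasure lborel {- real n..<0}" by simp
    also have "\<dots> \<le> emeasure lborel {..<0 :: real}" by (intro emeasure_mono) auto
    finally show ?thesis .
  qed
  then have "(SUP n. of_nat n) \<le> emeasure lborel {..<0 :: real}"
    by (intro SUP_least) (simp add: ennreal_of_nat_eq_real_of_nat)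
  then show ?thesis by (simp add: ennreal_SUP_of_nat_eq_top top_unique)
qed

text \<open>The negative half-line is added to \<open>N\<close> to reach infinite mass, as
  \<open>couple_half_line\<close> demands. The sum stays below \<open>ext_measure M\<close>, because
  \<open>N\<close> puts no mass on the line, and is therefore sigma-finite.\<close>

lemma couple_finite_part:
  fixes M :: "'a measure"
  assumes M: "sigma_finite_measure M" and s: "sets N = sets (ext_measure M)"
    and le: "\<And>B. B \<in> sets (ext_measure M) \<Longrightarrow> emeasure N B \<le> emeasure M (Inl -` B)"
  obtains C where "sets C = sets (ext_measure M \<Otimes>\<^sub>M (lborel :: real measure))"
    "\<And>B. B \<in> sets (ext_measure M) \<Longrightarrow>
      emeasure C (B \<times> UNIV) = emeasure N B + emeasure lborel (Inr -` B \<inter> {..<0})"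
    "\<And>B. B \<in> sets borel \<Longrightarrow> emeasure C (space (ext_measure M) \<times> B) = emeasure lborel (B \<inter> {0..})"
proof -
  let ?X = "ext_measure M"
  define L where "L = distr (reweight lborel (indicator {..<0 :: real})) ?X Inr"
  define N' where "N' = add_measure N L"
  have L: "emeasure L B = emeasure lborel (Inr -` B \<inter> {..<0})" if B: "B \<in> sets ?X" for B
    unfolding L_def using vimage_Inr_ext[OF B] B
    by (subst emeasure_distr) (simp_all add: emeasure_density_indicator Int_commute)
  have sN: "sets N' = sets ?X" and spN: "space N' = space ?X"
    using s sets_eq_imp_space_eq[OF s] by (simp_all add: N'_def)
  have N': "emeasure N' B = emeasure N B + emeasure lborel (Inr -` B \<inter> {..<0})" if B: "B \<in> sets ?X" for B
    unfolding N'_def using B s L[OF B] by (subst emeasure_add_measure) (auto simp: L_def)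
  have "sigma_finite_measure N'"
  proof (rule sigma_finite_le[OF sigma_finite_ext_measure[OF M] sN])
    fix B assume B: "B \<in> sets ?X"
    have "emeasure lborel (Inr -` B \<inter> {..<0}) \<le> emeasure lborel (Inr -` B)"
      using vimage_Inr_ext[OF B] by (intro emeasure_mono) auto
    then show "emeasure N' B \<le> emeasure ?X B"
      unfolding N'[OF B] emeasure_ext_measure[OF B] using le[OF B] by (intro add_mono)
  qed
  moreover have "emeasure N' (space N') = \<infinity>"
  proof -
    have "Inr -` space ?X \<inter> {..<0} = {..<0 :: real}" by auto
    then show ?thesis
      unfolding spN N'[OF sets.top] by (simp only: emeasure_lborel_lessThan_0) simp
  qed
  ultimately obtain C where C: "sets C = sets (N' \<Otimes>\<^sub>M (lborel :: real measure))"
    "\<And>B. B \<in> sets N' \<Longrightarrow> emeasure C (B \<times> UNIV) = emeasure N' B"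
    "\<And>B. B \<in> sets borel \<Longrightarrow> emeasure C (space N' \<times> B) = emeasure lborel (B \<inter> {0..})"
    using couple_half_line by blast
  show ?thesis
  proof
    show "sets C = sets (?X \<Otimes>\<^sub>M (lborel :: real measure))"
      unfolding C(1) by (intro sets_pair_measure_cong sN refl)
  qed (use C(2,3) N' sN spN in auto)
qed

section \<open>The part of a coupling that the distance can see\<close>

definition collapse :: "'a + real \<Rightarrow> 'a + real" where
  "collapse = case_sum Inl (\<lambda>_. Inr 0)"

lemma collapse_simps[simp]: "collapse (Inl x) = Inl x" "collapse (Inr t) = Inr 0"
  by (simp_all add: collapse_def)

lemma collapse_measurable[measurable]: "collapse \<in> measurable (ext_measure M) (ext_measure M)"
  unfolding collapse_def by (rule measurable_case_ext) auto

lemma trivial_ext_collapse[simp]: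
  "graphon (trivial_ext G) (collapse u) (collapse v) = graphon (trivial_ext G) u v"
  "star (trivial_ext G) (collapse u) = star (trivial_ext G) u"
  by (cases u; cases v; simp)+

definition off_Inr :: "'a measure \<Rightarrow> 'b measure \<Rightarrow> (('a + real) \<times> ('b + real)) set" where
  "off_Inr M N = space (ext_measure M \<Otimes>\<^sub>M ext_measure N) - range Inr \<times> range Inr"

lemma off_Inr_sets[measurable]: "off_Inr M N \<in> sets (ext_measure M \<Otimes>\<^sub>M ext_measure N)"
  unfolding off_Inr_def by measurable

text \<open>Mass over (line, line) is dropped and each added line is shrunk to the point
  \<open>Inr 0\<close>. A difference of pulled-back trivial extensions notices neither, so measures
  with the same collapsed measure give the same bounds; see
  \<open>graphex_bound_collapsed_iff\<close>.\<close>

abbreviation collapsed :: "'a measure \<Rightarrow> 'b measure \<Rightarrow> (('a + real) \<times> ('b + real)) measure \<Rightarrow> (('a + real) \<times> ('b + real)) measure" where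
  "collapsed M N K \<equiv> distr (reweight K (indicator (off_Inr M N)))
     (ext_measure M \<Otimes>\<^sub>M ext_measure N) (map_prod collapse collapse)"

lemma measurable_map_prod_collapse[measurable]:
  "map_prod collapse collapse \<in> measurable (ext_measure M \<Otimes>\<^sub>M ext_measure N) (ext_measure M \<Otimes>\<^sub>M ext_measure N)"
  unfolding map_prod_def by measurable

lemma emeasure_collapsed:
  assumes K: "sets K = sets (ext_measure M \<Otimes>\<^sub>M ext_measure N)" and S: "S \<in> sets (ext_measure M \<Otimes>\<^sub>M ext_measure N)"
  shows "emeasure (collapsed M N K) S = emeasure K (off_Inr M N \<inter> map_prod collapse collapse -` S)"
proof -
  let ?XX = "ext_measure M \<Otimes>\<^sub>M ext_measure N"
  note [simp] = K sets_eq_imp_space_eq[OF K]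
  have m: "map_prod collapse collapse \<in> measurable (reweight K (indicator (off_Inr M N))) ?XX"
    using measurable_map_prod_collapse[of M N] by (simp cong: measurable_cong_sets)
  have "map_prod collapse collapse -` S \<inter> space ?XX \<in> sets ?XX"
    using S by measurable
  moreover have "off_Inr M N \<inter> (map_prod collapse collapse -` S \<inter> space ?XX)
      = off_Inr M N \<inter> map_prod collapse collapse -` S"
    by (auto simp: off_Inr_def)
  ultimately show ?thesis
    using emeasure_distr[OF m S] emeasure_density_indicator[of "off_Inr M N" K "map_prod collapse collapse -` S \<inter> space ?XX"]
    by simp
qed

text \<open>Mass over (finite part, line) is re-coupled, together with the negative half-line, to the
  positive half-line, and symmetrically; the mass over (line, line) is discarded.\<close>

lemma complete_coupling:
  fixes M :: "'a measure" and N :: "'b measure"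
  assumes M: "sigma_finite_measure M" and N: "sigma_finite_measure N"
    and Z: "sets Z = sets (ext_measure M \<Otimes>\<^sub>M ext_measure N)"
    and p: "ext_preserving fst Z M" and q: "ext_preserving snd Z N"
  obtains K where "coupling (ext_measure M) (ext_measure N) K" "collapsed M N K = collapsed M N Z"
proof -
  let ?X = "ext_measure M" and ?Y = "ext_measure N"
  let ?XY = "?X \<Otimes>\<^sub>M ?Y"
  let ?L = "Inl ` space M :: ('a + real) set" and ?R = "range Inr :: ('a + real) set"
  let ?L' = "Inl ` space N :: ('b + real) set" and ?R' = "range Inr :: ('b + real) set"
  have spX: "space ?X = ?L \<union> ?R" "space ?Y = ?L' \<union> ?R'" by auto
  have spZ: "space Z = space ?X \<times> space ?Y" using sets_eq_imp_space_eq[OF Z] by (simp add: space_pair_measure)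
  have [measurable]: "?L \<in> sets ?X" "?L' \<in> sets ?Y" "?R \<in> sets ?X" "?R' \<in> sets ?Y"
    by (auto intro: Inl_sets_ext Inr_range_sets)
  have Zsets: "A \<times> B \<in> sets Z" if "A \<in> sets ?X" "B \<in> sets ?Y" for A B
    unfolding Z using that by simp
  have Z1: "emeasure Z ((B \<inter> ?L) \<times> space ?Y) = emeasure M (Inl -` B)" if B: "B \<in> sets ?X" for B
  proof -
    have "(B \<inter> ?L) \<times> space ?Y = fst -` (Inl ` (Inl -` B)) \<inter> space Z"
      unfolding ext_Int_Inl[OF B] spZ using sets.sets_into_space[OF B] by auto
    then show ?thesis using p vimage_Inl_ext[OF B] by (simp add: ext_preserving_def del: image_vimage_eq)
  qed
  have Z2: "emeasure Z (space ?X \<times> (B \<inter> ?L')) = emeasure N (Inl -` B)" if B: "B \<in> sets ?Y" for B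
  proof -
    have "space ?X \<times> (B \<inter> ?L') = snd -` (Inl ` (Inl -` B)) \<inter> space Z"
      unfolding ext_Int_Inl[OF B] spZ using sets.sets_into_space[OF B] by auto
    then show ?thesis using q vimage_Inl_ext[OF B] by (simp add: ext_preserving_def del: image_vimage_eq)
  qed
  \<comment> \<open>The mass that couples the first original space with the second line, projected
    to the first space; \<open>n'\<close> is its mirror image.\<close>
  define n where "n = distr (reweight Z (indicator (?L \<times> ?R'))) ?X fst"
  define n' where "n' = distr (reweight Z (indicator (?R \<times> ?L'))) ?Y snd"
  have fm: "fst \<in> measurable Z ?X" "snd \<in> measurable Z ?Y"
    using Z by (auto cong: measurable_cong_sets)
  have n: "emeasure n B = emeasure Z ((B \<inter> ?L) \<times> ?R')" if B: "B \<in> sets ?X" for B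
  proof -
    have "(?L \<times> ?R') \<inter> (fst -` B \<inter> space Z) = (B \<inter> ?L) \<times> ?R'" using spZ by auto
    moreover have "?L \<times> ?R' \<in> sets Z" by (rule Zsets) auto
    ultimately show ?thesis
      unfolding n_def using B fm measurable_sets[OF fm(1) B]
      by (subst emeasure_distr) (auto simp: emeasure_density_indicator simp del: image_vimage_eq)
  qed
  have n': "emeasure n' B = emeasure Z (?R \<times> (B \<inter> ?L'))" if B: "B \<in> sets ?Y" for B
  proof -
    have "(?R \<times> ?L') \<inter> (snd -` B \<inter> space Z) = ?R \<times> (B \<inter> ?L')" using spZ by auto
    moreover have "?R \<times> ?L' \<in> sets Z" by (rule Zsets) auto
    ultimately show ?thesis
      unfolding n'_def using B fm measurable_sets[OF fm(2) B]
      by (subst emeasure_distr) (auto simp: emeasure_density_indicator simp del: image_vimage_eq)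
  qed
  have "emeasure n B \<le> emeasure M (Inl -` B)" if B: "B \<in> sets ?X" for B
    unfolding n[OF B] Z1[OF B, symmetric] using B by (intro emeasure_mono Zsets) auto
  then obtain C where C: "sets C = sets (?X \<Otimes>\<^sub>M (lborel :: real measure))"
    "\<And>B. B \<in> sets ?X \<Longrightarrow> emeasure C (B \<times> UNIV) = emeasure n B + emeasure lborel (Inr -` B \<inter> {..<0})"
    "\<And>B. B \<in> sets borel \<Longrightarrow> emeasure C (space ?X \<times> B) = emeasure lborel (B \<inter> {0..})"
    using couple_finite_part[OF M, of n] by (auto simp: n_def)
  have "emeasure n' B \<le> emeasure N (Inl -` B)" if B: "B \<in> sets ?Y" for B
    unfolding n'[OF B] Z2[OF B, symmetric] using B by (intro emeasure_mono Zsets) auto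
  then obtain C' where C': "sets C' = sets (?Y \<Otimes>\<^sub>M (lborel :: real measure))"
    "\<And>B. B \<in> sets ?Y \<Longrightarrow> emeasure C' (B \<times> UNIV) = emeasure n' B + emeasure lborel (Inr -` B \<inter> {..<0})"
    "\<And>B. B \<in> sets borel \<Longrightarrow> emeasure C' (space ?Y \<times> B) = emeasure lborel (B \<inter> {0..})"
    using couple_finite_part[OF N, of n'] by (auto simp: n'_def)
  have spC: "space C = space ?X \<times> UNIV" "space C' = space ?Y \<times> UNIV"
    using sets_eq_imp_space_eq[OF C(1)] sets_eq_imp_space_eq[OF C'(1)] by (simp_all add: space_pair_measure)
  define f where "f = (\<lambda>z. (fst z, Inr (snd z) :: 'b + real) :: ('a + real) \<times> ('b + real))"
  define f' where "f' = (\<lambda>z. (Inr (snd z) :: 'a + real, fst z) :: ('a + real) \<times> ('b + real))"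
  have "f \<in> measurable (?X \<Otimes>\<^sub>M (lborel :: real measure)) ?XY" unfolding f_def by measurable
  then have fC: "f \<in> measurable C ?XY" using C(1) by (simp cong: measurable_cong_sets)
  have "f' \<in> measurable (?Y \<Otimes>\<^sub>M (lborel :: real measure)) ?XY" unfolding f'_def by measurable
  then have fC': "f' \<in> measurable C' ?XY" using C'(1) by (simp cong: measurable_cong_sets)
  have LL: "?L \<times> ?L' \<in> sets Z" by (rule Zsets) auto
  define K0 where "K0 = reweight Z (indicator (?L \<times> ?L'))"
  define K where "K = add_measure (add_measure K0 (distr C ?XY f)) (distr C' ?XY f')"
  have sK: "sets K = sets ?XY" by (simp add: K_def K0_def Z)
  have spK: "space K = space ?X \<times> space ?Y" using sets_eq_imp_space_eq[OF sK] by (simp add: space_pair_measure)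
  have K: "emeasure K S = emeasure Z ((?L \<times> ?L') \<inter> S) + emeasure C (f -` S \<inter> space C) + emeasure C' (f' -` S \<inter> space C')"
    if S: "S \<in> sets ?XY" for S
    unfolding K_def using S LL Z fC fC'
    by (simp add: emeasure_add_measure emeasure_distr K0_def emeasure_density_indicator)
  have Zadd1: "emeasure Z (A \<times> ?L') + emeasure Z (A \<times> ?R') = emeasure Z (A \<times> space ?Y)" if A: "A \<in> sets ?X" for A
  proof -
    have "emeasure Z (A \<times> ?L') + emeasure Z (A \<times> ?R') = emeasure Z (A \<times> ?L' \<union> A \<times> ?R')"
      using A by (intro plus_emeasure Zsets) auto
    also have "A \<times> ?L' \<union> A \<times> ?R' = A \<times> space ?Y" using spX(2) by blast
    finally show ?thesis .
  qed
  have Zadd2: "emeasure Z (?L \<times> A) + emeasure Z (?R \<times> A) = emeasure Z (space ?X \<times> A)" if A: "A \<in> sets ?Y" for A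
  proof -
    have "emeasure Z (?L \<times> A) + emeasure Z (?R \<times> A) = emeasure Z (?L \<times> A \<union> ?R \<times> A)"
      using A by (intro plus_emeasure Zsets) auto
    also have "?L \<times> A \<union> ?R \<times> A = space ?X \<times> A" using spX(1) by blast
    finally show ?thesis .
  qed
  have ladd: "emeasure lborel (B \<inter> {..<0}) + emeasure lborel (B \<inter> {0..}) = emeasure lborel B"
    if B: "B \<in> sets borel" for B :: "real set"
  proof -
    have "emeasure lborel (B \<inter> {..<0}) + emeasure lborel (B \<inter> {0..}) = emeasure lborel (B \<inter> {..<0} \<union> B \<inter> {0..})"
      using B by (intro plus_emeasure) auto
    also have "B \<inter> {..<0} \<union> B \<inter> {0..} = B" by auto
    finally show ?thesis .
  qed
  \<comment> \<open>For the first marginal: over the original space, \<open>K0\<close> and the part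
    \<open>n\<close> of \<open>C\<close> add up to \<open>M\<close>; on the line, \<open>C\<close>
    supplies the negative half of Lebesgue measure and \<open>C'\<close> the nonnegative half. The
    second marginal has the roles of \<open>C\<close> and \<open>C'\<close> exchanged.\<close>
  have cpl: "coupling ?X ?Y K"
    unfolding coupling_def
  proof (intro conjI sK measure_eqI)
    fix B assume "B \<in> sets (distr K ?X fst)"
    then have B: "B \<in> sets ?X" by simp
    have BY: "B \<times> space ?Y \<in> sets ?XY" using B by simp
    have "fst \<in> measurable K ?X" using sK by (simp cong: measurable_cong_sets)
    moreover have "fst -` B \<inter> space K = B \<times> space ?Y"
      using sets.sets_into_space[OF B] spK by auto
    ultimately have "emeasure (distr K ?X fst) B = emeasure K (B \<times> space ?Y)"
      using B by (simp add: emeasure_distr)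
    also have "\<dots> = emeasure Z ((B \<inter> ?L) \<times> ?L') + emeasure C (B \<times> UNIV) + emeasure C' (space ?Y \<times> Inr -` B)"
    proof -
      have "(?L \<times> ?L') \<inter> (B \<times> space ?Y) = (B \<inter> ?L) \<times> ?L'" using spX by blast
      moreover have "f -` (B \<times> space ?Y) \<inter> space C = B \<times> UNIV"
        using sets.sets_into_space[OF B] spC by (auto simp: f_def)
      moreover have "f' -` (B \<times> space ?Y) \<inter> space C' = space ?Y \<times> Inr -` B"
        using spC by (auto simp: f'_def)
      ultimately show ?thesis by (simp only: K[OF BY])
    qed
    also have "\<dots> = emeasure Z ((B \<inter> ?L) \<times> ?L') + (emeasure Z ((B \<inter> ?L) \<times> ?R') + emeasure lborel (Inr -` B \<inter> {..<0}))
        + emeasure lborel (Inr -` B \<inter> {0..})"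
      by (simp only: C(2)[OF B] C'(3)[OF vimage_Inr_ext[OF B]] n[OF B])
    also have "\<dots> = (emeasure Z ((B \<inter> ?L) \<times> ?L') + emeasure Z ((B \<inter> ?L) \<times> ?R'))
       + (emeasure lborel (Inr -` B \<inter> {..<0}) + emeasure lborel (Inr -` B \<inter> {0..}))"
      by (simp only: ac_simps)
    also have "\<dots> = emeasure M (Inl -` B) + emeasure lborel (Inr -` B)"
      using B by (simp only: Zadd1 Z1 ladd vimage_Inr_ext sets.Int \<open>?L \<in> sets ?X\<close>)
    also have "\<dots> = emeasure ?X B" by (rule emeasure_ext_measure[OF B, symmetric])
    finally show "emeasure (distr K ?X fst) B = emeasure ?X B" .
  next
    fix B assume "B \<in> sets (distr K ?Y snd)"
    then have B: "B \<in> sets ?Y" by simp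
    have BX: "space ?X \<times> B \<in> sets ?XY" using B by simp
    have "snd \<in> measurable K ?Y" using sK by (simp cong: measurable_cong_sets)
    moreover have "snd -` B \<inter> space K = space ?X \<times> B"
      using sets.sets_into_space[OF B] spK by auto
    ultimately have "emeasure (distr K ?Y snd) B = emeasure K (space ?X \<times> B)"
      using B by (simp add: emeasure_distr)
    also have "\<dots> = emeasure Z (?L \<times> (B \<inter> ?L')) + emeasure C (space ?X \<times> Inr -` B) + emeasure C' (B \<times> UNIV)"
    proof -
      have "(?L \<times> ?L') \<inter> (space ?X \<times> B) = ?L \<times> (B \<inter> ?L')" using spX by blast
      moreover have "f -` (space ?X \<times> B) \<inter> space C = space ?X \<times> Inr -` B"
        using spC by (auto simp: f_def)
      moreover have "f' -` (space ?X \<times> B) \<inter> space C' = B \<times> UNIV"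
        using sets.sets_into_space[OF B] spC by (auto simp: f'_def)
      ultimately show ?thesis by (simp only: K[OF BX])
    qed
    also have "\<dots> = emeasure Z (?L \<times> (B \<inter> ?L')) + emeasure lborel (Inr -` B \<inter> {0..})
        + (emeasure Z (?R \<times> (B \<inter> ?L')) + emeasure lborel (Inr -` B \<inter> {..<0}))"
      by (simp only: C'(2)[OF B] C(3)[OF vimage_Inr_ext[OF B]] n'[OF B])
    also have "\<dots> = (emeasure Z (?L \<times> (B \<inter> ?L')) + emeasure Z (?R \<times> (B \<inter> ?L')))
       + (emeasure lborel (Inr -` B \<inter> {..<0}) + emeasure lborel (Inr -` B \<inter> {0..}))"
      by (simp only: ac_simps)
    also have "\<dots> = emeasure N (Inl -` B) + emeasure lborel (Inr -` B)"
      using B by (simp only: Zadd2 Z2 ladd vimage_Inr_ext sets.Int \<open>?L' \<in> sets ?Y\<close>)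
    also have "\<dots> = emeasure ?Y B" by (rule emeasure_ext_measure[OF B, symmetric])
    finally show "emeasure (distr K ?Y snd) B = emeasure ?Y B" .
  qed simp_all
  moreover have "collapsed M N K = collapsed M N Z"
  proof (rule measure_eqI)
    fix S assume "S \<in> sets (collapsed M N K)"
    then have S: "S \<in> sets ?XY" by simp
    let ?S = "off_Inr M N \<inter> map_prod collapse collapse -` S"
    have "map_prod collapse collapse -` S \<inter> space ?XY \<in> sets ?XY" using S by measurable
    moreover have "off_Inr M N \<inter> (map_prod collapse collapse -` S \<inter> space ?XY) = ?S" by (auto simp: off_Inr_def)
    ultimately have S': "?S \<in> sets ?XY" by (metis sets.Int off_Inr_sets)
    \<comment> \<open>After collapsing, whether a point over (original space, line) belongs to S
      depends on its first coordinate alone. \<open>B\<close> collects these coordinates,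
      \<open>B'\<close> those of the mirror image.\<close>
    define B where "B = {x \<in> ?L. (x, Inr 0) \<in> S}"
    define B' where "B' = {y \<in> ?L'. (Inr 0, y) \<in> S}"
    have "(\<lambda>x. (x, Inr 0)) -` S \<inter> space ?X \<in> sets ?X" using S by measurable
    then have "(\<lambda>x. (x, Inr 0)) -` S \<inter> space ?X \<inter> ?L \<in> sets ?X" by simp
    moreover have "(\<lambda>x. (x, Inr 0)) -` S \<inter> space ?X \<inter> ?L = B" by (auto simp: B_def)
    ultimately have B: "B \<in> sets ?X" by simp
    have "(\<lambda>y. (Inr 0, y)) -` S \<inter> space ?Y \<in> sets ?Y" using S by measurable
    then have "(\<lambda>y. (Inr 0, y)) -` S \<inter> space ?Y \<inter> ?L' \<in> sets ?Y" by simp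
    moreover have "(\<lambda>y. (Inr 0, y)) -` S \<inter> space ?Y \<inter> ?L' = B'" by (auto simp: B'_def)
    ultimately have B': "B' \<in> sets ?Y" by simp
    have BL: "B \<inter> ?L = B" "B' \<inter> ?L' = B'" by (auto simp: B_def B'_def)
    have BR: "Inr -` B = {}" "Inr -` B' = {}" by (auto simp: B_def B'_def)
    have "f -` ?S \<inter> space C = B \<times> UNIV"
      using spC by (auto simp: f_def B_def off_Inr_def space_pair_measure)
    then have 1: "emeasure C (f -` ?S \<inter> space C) = emeasure Z (B \<times> ?R')"
      using C(2)[OF B] n[OF B] by (simp add: BL BR)
    have "f' -` ?S \<inter> space C' = B' \<times> UNIV"
      using spC by (auto simp: f'_def B'_def off_Inr_def space_pair_measure)
    then have 2: "emeasure C' (f' -` ?S \<inter> space C') = emeasure Z (?R \<times> B')"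
      using C'(2)[OF B'] n'[OF B'] by (simp add: BL BR)
    have "emeasure (collapsed M N K) S = emeasure Z ((?L \<times> ?L') \<inter> ?S) + emeasure Z (B \<times> ?R') + emeasure Z (?R \<times> B')"
      unfolding emeasure_collapsed[OF sK S] K[OF S'] 1 2 ..
    also have "\<dots> = emeasure Z ((?L \<times> ?L') \<inter> ?S \<union> B \<times> ?R') + emeasure Z (?R \<times> B')"
      using LL S' Z Zsets[OF B \<open>?R' \<in> sets ?Y\<close>]
      by (subst plus_emeasure) auto
    also have "\<dots> = emeasure Z ((?L \<times> ?L') \<inter> ?S \<union> B \<times> ?R' \<union> ?R \<times> B')"
      using LL S' Z Zsets[OF B \<open>?R' \<in> sets ?Y\<close>] Zsets[OF \<open>?R \<in> sets ?X\<close> B']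
      by (intro plus_emeasure) (auto simp: B_def)
    also have "(?L \<times> ?L') \<inter> ?S \<union> B \<times> ?R' \<union> ?R \<times> B' = ?S"
      by (auto simp: B_def B'_def off_Inr_def space_pair_measure)
    also have "emeasure Z ?S = emeasure (collapsed M N Z) S"
      by (rule emeasure_collapsed[OF Z S, symmetric])
    finally show "emeasure (collapsed M N K) S = emeasure (collapsed M N Z) S" .
  qed simp
  ultimately show ?thesis using that by blast
qed

text \<open>Strips over pieces of finite measure of either original space cover everything except
  (line, line), and that carries no mass once the measure is restricted to
  \<open>off_Inr\<close>.\<close>

lemma sigma_finite_collapsed:
  fixes M :: "'a measure" and N :: "'b measure"
  assumes M: "sigma_finite_measure M" and N: "sigma_finite_measure N"
    and Z: "sets Z = sets (ext_measure M \<Otimes>\<^sub>M ext_measure N)"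
    and p: "ext_preserving fst Z M" and q: "ext_preserving snd Z N"
  shows "sigma_finite_measure (collapsed M N Z)"
proof -
  let ?X = "ext_measure M" and ?Y = "ext_measure N"
  obtain A where A: "countable A" "A \<subseteq> sets M" "\<Union>A = space M" "\<forall>a\<in>A. emeasure M a \<noteq> \<infinity>"
    using sigma_finite_measure.sigma_finite_countable[OF M] by blast
  obtain B where B: "countable B" "B \<subseteq> sets N" "\<Union>B = space N" "\<forall>b\<in>B. emeasure N b \<noteq> \<infinity>"
    using sigma_finite_measure.sigma_finite_countable[OF N] by blast
  have spZ: "space Z = space ?X \<times> space ?Y" using sets_eq_imp_space_eq[OF Z] by (simp add: space_pair_measure)
  let ?C = "(\<lambda>a. (Inl ` a :: ('a + real) set) \<times> space ?Y) ` A \<union> (\<lambda>b. space ?X \<times> (Inl ` b :: ('b + real) set)) ` B \<union> {range Inr \<times> range Inr}"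
  have fin: "emeasure (collapsed M N Z) c \<noteq> \<infinity> \<and> c \<in> sets (?X \<Otimes>\<^sub>M ?Y)" if c: "c \<in> ?C" for c
  proof -
    consider a where "a \<in> A" "c = Inl ` a \<times> space ?Y" | b where "b \<in> B" "c = space ?X \<times> Inl ` b"
      | "c = range Inr \<times> range Inr" using c by (elim UnE imageE singletonE) simp_all
    then show ?thesis
    proof cases
      case 1
      then have a: "Inl ` a \<in> sets ?X" "a \<in> sets M" using A by (auto intro: Inl_sets_ext)
      then have cs: "c \<in> sets (?X \<Otimes>\<^sub>M ?Y)" using 1 a by simp
      have ac: "fst -` Inl ` a \<inter> space Z = c" using 1 spZ sets.sets_into_space[OF a(1)] by auto
      have "u \<in> Inl ` a" if "collapse u \<in> Inl ` a" for u :: "'a + real" using that by (cases u) auto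
      then have "off_Inr M N \<inter> map_prod collapse collapse -` c \<subseteq> c"
        using 1 by (auto simp: off_Inr_def space_pair_measure)
      then have "emeasure (collapsed M N Z) c \<le> emeasure Z c"
        unfolding emeasure_collapsed[OF Z cs] using cs by (intro emeasure_mono) (auto simp: Z)
      also have "\<dots> = emeasure M a" using p a ac by (auto simp: ext_preserving_def)
      finally show ?thesis using A 1 cs by (auto simp: top_unique)
    next
      case 2
      then have b: "Inl ` b \<in> sets ?Y" "b \<in> sets N" using B by (auto intro: Inl_sets_ext)
      then have cs: "c \<in> sets (?X \<Otimes>\<^sub>M ?Y)" using 2 b by simp
      have bc: "snd -` Inl ` b \<inter> space Z = c" using 2 spZ sets.sets_into_space[OF b(1)] by auto
      have "u \<in> Inl ` b" if "collapse u \<in> Inl ` b" for u :: "'b + real" using that by (cases u) auto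
      then have "off_Inr M N \<inter> map_prod collapse collapse -` c \<subseteq> c"
        using 2 by (auto simp: off_Inr_def space_pair_measure)
      then have "emeasure (collapsed M N Z) c \<le> emeasure Z c"
        unfolding emeasure_collapsed[OF Z cs] using cs by (intro emeasure_mono) (auto simp: Z)
      also have "\<dots> = emeasure N b" using q b bc by (auto simp: ext_preserving_def)
      finally show ?thesis using B 2 cs by (auto simp: top_unique)
    next
      case 3
      then have cs: "c \<in> sets (?X \<Otimes>\<^sub>M ?Y)" by (simp add: Inr_range_sets)
      have u: "u \<in> range Inr" if "collapse u \<in> range Inr" for u :: "'a + real" using that by (cases u) auto
      have v: "v \<in> range Inr" if "collapse v \<in> range Inr" for v :: "'b + real" using that by (cases v) auto
      have "off_Inr M N \<inter> map_prod collapse collapse -` c = {}"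
      proof (rule equals0I)
        fix z assume z: "z \<in> off_Inr M N \<inter> map_prod collapse collapse -` c"
        obtain x y where xy: "z = (x, y)" by (cases z)
        have "collapse x \<in> range Inr" "collapse y \<in> range Inr" using z unfolding 3 xy by simp_all
        then have "z \<in> range Inr \<times> range Inr" unfolding xy using u[of x] v[of y] by simp
        then show False using z unfolding off_Inr_def by blast
      qed
      then show ?thesis using cs by (simp add: emeasure_collapsed[OF Z cs])
    qed
  qed
  have 1: "(\<Union>a\<in>A. (Inl ` a :: ('a + real) set) \<times> space ?Y) = Inl ` \<Union>A \<times> space ?Y" by auto
  have 2: "(\<Union>b\<in>B. space ?X \<times> (Inl ` b :: ('b + real) set)) = space ?X \<times> Inl ` \<Union>B" by auto
  have "\<Union>?C = Inl ` \<Union>A \<times> space ?Y \<union> space ?X \<times> Inl ` \<Union>B \<union> range Inr \<times> range Inr"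
    unfolding Union_Un_distrib 1 2 by (simp only: Union_insert Union_empty Un_empty_right)
  also have "\<dots> = space (?X \<Otimes>\<^sub>M ?Y)" unfolding A(3) B(3) by (auto simp: space_pair_measure)
  finally have U: "\<Union>?C = space (collapsed M N Z)" by simp
  show ?thesis
    unfolding sigma_finite_measure_def
  proof (intro exI[of _ ?C] conjI)
    show "countable ?C" using A(1) B(1) by simp
    show "?C \<subseteq> sets (collapsed M N Z)" unfolding sets_distr using fin by (intro subsetI) (rule conjunct2)
    show "\<forall>c\<in>?C. emeasure (collapsed M N Z) c \<noteq> \<infinity>" using fin by (intro ballI) (rule conjunct1)
  qed (rule U)
qed

abbreviation coupling_diff :: "'a graphex \<Rightarrow> 'b graphex \<Rightarrow> (('a + real) \<times> ('b + real)) measure \<Rightarrow> (('a + real) \<times> ('b + real)) graphex" where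
  "coupling_diff G H Z \<equiv> graphex_diff (pullback fst Z (trivial_ext G)) (pullback snd Z (trivial_ext H))"

text \<open>The difference is supported on \<open>off_Inr\<close>, so the measure may be restricted
  to this set; on it the collapsing map preserves measure and the difference factors through
  it.\<close>

lemma graphex_bound_collapsed_iff:
  fixes G :: "'a graphex" and H :: "'b graphex"
  assumes G: "regular_graphex G" and H: "regular_graphex H" and Zf: "sigma_finite_measure Z"
    and Z: "sets Z = sets (ext_measure (msp G) \<Otimes>\<^sub>M ext_measure (msp H))"
    and p: "ext_preserving fst Z (msp G)" and q: "ext_preserving snd Z (msp H)" and a: "a \<ge> 0"
  shows "graphex_bound (coupling_diff G H (collapsed (msp G) (msp H) Z)) a b r \<longleftrightarrow>
    graphex_bound (coupling_diff G H Z) a b r"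
proof -
  let ?XY = "ext_measure (msp G) \<Otimes>\<^sub>M ext_measure (msp H)"
  let ?E = "off_Inr (msp G) (msp H)"
  let ?D = "reweight Z (indicator ?E)"
  let ?Y = "collapsed (msp G) (msp H) Z"
  note spZ = sets_eq_imp_space_eq[OF Z]
  have E: "?E \<in> sets Z" unfolding Z by (rule off_Inr_sets)
  have reg: "regular_graphex (coupling_diff G H Z)"
    by (rule regular_graphex_diff[OF regular_graphex_pullback_ext[OF p Zf G] regular_graphex_pullback_ext[OF q Zf H]]) simp
  have supp: "supported_on ?E (coupling_diff G H Z)"
    by (auto simp: supported_on_def off_Inr_def spZ)
  have eq: "(coupling_diff G H Z)\<lparr>msp := ?D\<rparr> = pullback (map_prod collapse collapse) ?D (coupling_diff G H ?Y)"
    by (simp add: graphex_diff_def pullback_def)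
  have mp: "measure_preserving (map_prod collapse collapse) ?D ?Y"
  proof -
    have "map_prod collapse collapse \<in> measurable ?D ?Y"
      using measurable_map_prod_collapse[of "msp G" "msp H"] Z by (simp cong: measurable_cong_sets)
    moreover have "distr ?D ?Y (map_prod collapse collapse) = ?Y" by (rule distr_cong) auto
    ultimately show ?thesis by (simp add: measure_preserving_def)
  qed
  have sY: "sigma_finite_measure ?Y"
    by (rule sigma_finite_collapsed[OF regular_graphexD(2)[OF G] regular_graphexD(2)[OF H] Z p q])
  have mY: "measurable_graphex (coupling_diff G H ?Y)"
    by (intro measurable_graphex_diff measurable_graphex_pullback measurable_graphex_trivial_ext
        regular_graphexD(1) G H sY) auto
  have R: "regular_graphex (coupling_diff G H ?Y)"
  proof -
    have "regular_graphex ((coupling_diff G H Z)\<lparr>msp := ?D\<rparr>)"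
      using regular_graphex_supported_iff[OF regular_graphexD(1)[OF reg] _ supp] reg E by simp
    then show ?thesis
      unfolding eq using regular_graphex_pullback_iff[OF mY, of "map_prod collapse collapse" ?D] mp by simp
  qed
  have "graphex_bound ((coupling_diff G H Z)\<lparr>msp := ?D\<rparr>) a b r \<longleftrightarrow> graphex_bound (coupling_diff G H ?Y) a b r"
    unfolding eq using graphex_bound_pullback_iff[OF R _ a, of "map_prod collapse collapse" ?D] mp by simp
  moreover have "graphex_bound ((coupling_diff G H Z)\<lparr>msp := ?D\<rparr>) a b r \<longleftrightarrow> graphex_bound (coupling_diff G H Z) a b r"
    using graphex_bound_supported_iff[OF regular_graphexD(1)[OF reg] _ supp a] E by simp
  ultimately show ?thesis by simp
qed

lemma coupling_measure_preserving:
  assumes "coupling M N K"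
  shows "measure_preserving fst K M" "measure_preserving snd K N"
proof -
  have "sets K = sets (M \<Otimes>\<^sub>M N)" using assms by (simp add: coupling_def)
  then have "fst \<in> measurable K M" "snd \<in> measurable K N" by (auto cong: measurable_cong_sets)
  then show "measure_preserving fst K M" "measure_preserving snd K N"
    using assms by (auto simp: measure_preserving_def coupling_def)
qed

text \<open>Upper bounds for \<open>delta22\<close> can thus be read off from measures that are not
  couplings. \<open>complete_coupling\<close> supplies a true coupling with the same collapsed
  measure, and the bound is carried over through that common measure.\<close>

lemma delta22_le:
  fixes G :: "'a graphex" and H :: "'b graphex"
  assumes G: "regular_graphex G" and H: "regular_graphex H" and Zf: "sigma_finite_measure Z"
    and Z: "sets Z = sets (ext_measure (msp G) \<Otimes>\<^sub>M ext_measure (msp H))"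
    and p: "ext_preserving fst Z (msp G)" and q: "ext_preserving snd Z (msp H)" and a: "a \<ge> 0"
    and b: "graphex_bound (coupling_diff G H Z) a b r"
  shows "delta22 G H \<le> ereal (max a (max (sqrt b) (root 3 r)))"
proof -
  let ?X = "ext_measure (msp G)" and ?Y = "ext_measure (msp H)"
  obtain K where K: "coupling ?X ?Y K" "collapsed (msp G) (msp H) K = collapsed (msp G) (msp H) Z"
    using complete_coupling[OF regular_graphexD(2)[OF G] regular_graphexD(2)[OF H] Z p q] .
  note mp = coupling_measure_preserving[OF K(1)]
  note ep = measure_preserving_ext_preserving[OF mp(1)] measure_preserving_ext_preserving[OF mp(2)]
  have sK: "sets K = sets (?X \<Otimes>\<^sub>M ?Y)" using K(1) by (simp add: coupling_def)
  have Kf: "sigma_finite_measure K"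
    by (rule measure_preserving_sigma_finite[OF mp(1) sigma_finite_ext_measure[OF regular_graphexD(2)[OF G]]])
  have "graphex_bound (coupling_diff G H K) a b r"
    using b graphex_bound_collapsed_iff[OF G H Zf Z p q a] graphex_bound_collapsed_iff[OF G H Kf sK ep a] K(2)
    by simp
  then have "d22 (pullback fst K (trivial_ext G)) (pullback snd K (trivial_ext H)) \<le> ereal (max a (max (sqrt b) (root 3 r)))"
    by (intro d22_le regular_graphex_pullback_ext ep Kf G H) simp_all
  then show ?thesis
    unfolding delta22_def coupling_dist22_def using K(1) by (intro INF_lower2[of K]) simp_all
qed

section \<open>Approximation by step functions\<close>

lemma pred_eq_nat:
  fixes f g :: "'a \<Rightarrow> nat"
  assumes [measurable]: "f \<in> measurable M (count_space UNIV)" "g \<in> measurable M (count_space UNIV)"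
  shows "Measurable.pred M (\<lambda>x. f x = g x)"
proof -
  have eq: "(\<lambda>x. f x = g x) = (\<lambda>x. \<exists>j. f x = j \<and> g x = j)" by auto
  show ?thesis unfolding eq by measurable
qed

definition step_fun :: "('a \<Rightarrow> nat) \<Rightarrow> (nat \<Rightarrow> nat \<Rightarrow> 'c) \<Rightarrow> 'a \<times> 'a \<Rightarrow> 'c" where
  "step_fun c V z = V (c (fst z)) (c (snd z))"

lemma step_fun_measurable[measurable]:
  assumes [measurable]: "c \<in> measurable M (count_space UNIV)"
  shows "step_fun c V \<in> measurable (M \<Otimes>\<^sub>M M) (count_space UNIV)"
proof -
  have "(\<lambda>z. V (c (fst z)) (c (snd z))) \<in> measurable (M \<Otimes>\<^sub>M M) (count_space UNIV)" by measurable
  then show ?thesis by (simp add: step_fun_def[abs_def])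
qed

text \<open>The label of a point in the common refinement of two partitions.\<close>

definition pair_cells :: "('a \<Rightarrow> nat) \<Rightarrow> ('a \<Rightarrow> nat) \<Rightarrow> 'a \<Rightarrow> nat" where
  "pair_cells c c' x = prod_encode (c x, c' x)"

lemma pair_cells_measurable[measurable]:
  assumes [measurable]: "c \<in> measurable M (count_space UNIV)" "c' \<in> measurable M (count_space UNIV)"
  shows "pair_cells c c' \<in> measurable M (count_space UNIV)"
  unfolding pair_cells_def[abs_def] by measurable

definition merge_steps :: "(nat \<Rightarrow> nat \<Rightarrow> 'c) \<Rightarrow> (nat \<Rightarrow> nat \<Rightarrow> 'd) \<Rightarrow> ('c \<Rightarrow> 'd \<Rightarrow> 'e) \<Rightarrow> nat \<Rightarrow> nat \<Rightarrow> 'e" where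
  "merge_steps V V' f i j = f (V (fst (prod_decode i)) (fst (prod_decode j)))
     (V' (snd (prod_decode i)) (snd (prod_decode j)))"

lemma step_fun_merge:
  "step_fun (pair_cells c c') (merge_steps V V' f) z = f (step_fun c V z) (step_fun c' V' z)"
  by (simp add: step_fun_def pair_cells_def merge_steps_def)

text \<open>Both coordinates use the same cells: the later gluing runs along a single partition of
  the middle space.\<close>

definition step_approximable :: "'a measure \<Rightarrow> ('a \<times> 'a) set \<Rightarrow> bool" where
  "step_approximable M E \<longleftrightarrow> (\<forall>e>0. \<exists>c V. c \<in> measurable M (count_space UNIV) \<and>
     measure (M \<Otimes>\<^sub>M M) {z \<in> space (M \<Otimes>\<^sub>M M). (z \<in> E) \<noteq> step_fun c V z} \<le> e)"

lemma step_approximable_Un: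
  assumes M: "finite_measure M" and A: "step_approximable M A" "A \<in> sets (M \<Otimes>\<^sub>M M)"
    and B: "step_approximable M B" "B \<in> sets (M \<Otimes>\<^sub>M M)"
  shows "step_approximable M (A \<union> B)"
  unfolding step_approximable_def
proof (intro allI impI)
  interpret M: finite_measure M by fact
  interpret pair_sigma_finite M M by unfold_locales
  interpret P: finite_measure "M \<Otimes>\<^sub>M M" by (rule finite_measure_pair_measure) fact+
  fix e :: real assume "e > 0"
  then have e: "e / 2 > 0" by simp
  note [measurable] = A(2) B(2)
  obtain c V where c[measurable]: "c \<in> measurable M (count_space UNIV)"
    and c': "measure (M \<Otimes>\<^sub>M M) {z \<in> space (M \<Otimes>\<^sub>M M). (z \<in> A) \<noteq> step_fun c V z} \<le> e / 2"
    using A(1) e unfolding step_approximable_def by blast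
  obtain d W where d[measurable]: "d \<in> measurable M (count_space UNIV)"
    and d': "measure (M \<Otimes>\<^sub>M M) {z \<in> space (M \<Otimes>\<^sub>M M). (z \<in> B) \<noteq> step_fun d W z} \<le> e / 2"
    using B(1) e unfolding step_approximable_def by blast
  have "measure (M \<Otimes>\<^sub>M M) {z \<in> space (M \<Otimes>\<^sub>M M). (z \<in> A \<union> B) \<noteq> step_fun (pair_cells c d) (merge_steps V W (\<or>)) z}
    \<le> measure (M \<Otimes>\<^sub>M M) ({z \<in> space (M \<Otimes>\<^sub>M M). (z \<in> A) \<noteq> step_fun c V z} \<union> {z \<in> space (M \<Otimes>\<^sub>M M). (z \<in> B) \<noteq> step_fun d W z})"
    by (intro P.finite_measure_mono) (auto simp: step_fun_merge)
  also have "\<dots> \<le> measure (M \<Otimes>\<^sub>M M) {z \<in> space (M \<Otimes>\<^sub>M M). (z \<in> A) \<noteq> step_fun c V z} + measure (M \<Otimes>\<^sub>M M) {z \<in> space (M \<Otimes>\<^sub>M M). (z \<in> B) \<noteq> step_fun d W z}"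
    by (intro measure_Un_le) measurable
  also have "\<dots> \<le> e" using c' d' by linarith
  finally show "\<exists>c V. c \<in> measurable M (count_space UNIV) \<and>
     measure (M \<Otimes>\<^sub>M M) {z \<in> space (M \<Otimes>\<^sub>M M). (z \<in> A \<union> B) \<noteq> step_fun c V z} \<le> e"
    using pair_cells_measurable[OF c d] by blast
qed

text \<open>Continuity from below of the finite product measure leaves all but e/2 of the union in a
  finite union, which is approximable by induction.\<close>

lemma step_approximable_Union:
  fixes A :: "nat \<Rightarrow> ('a \<times> 'a) set"
  assumes M: "finite_measure M" and A: "\<And>i. step_approximable M (A i)" "\<And>i. A i \<in> sets (M \<Otimes>\<^sub>M M)"
  shows "step_approximable M (\<Union>i. A i)"
  unfolding step_approximable_def
proof (intro allI impI)
  interpret M: finite_measure M by fact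
  interpret pair_sigma_finite M M by unfold_locales
  interpret P: finite_measure "M \<Otimes>\<^sub>M M" by (rule finite_measure_pair_measure) fact+
  fix e :: real assume "e > 0"
  then have e: "e / 2 > 0" by simp
  define U where "U n = (\<Union>i<n. A i)" for n :: nat
  define W where "W = (\<Union>i. A i)"
  have [measurable]: "U n \<in> sets (M \<Otimes>\<^sub>M M)" for n unfolding U_def using A(2) by auto
  have [measurable]: "W \<in> sets (M \<Otimes>\<^sub>M M)" unfolding W_def using A(2) by auto
  have approx: "step_approximable M (U n)" for n
  proof (induction n)
    case 0
    have "step_fun (\<lambda>_. 0) (\<lambda>_ _. False) z = False" for z :: "'a \<times> 'a" by (simp add: step_fun_def)
    then show ?case
      unfolding step_approximable_def U_def by (intro allI impI exI[of _ "\<lambda>_. 0"] exI[of _ "\<lambda>_ _. False"]) simp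
  next
    case (Suc n)
    have "U (Suc n) = U n \<union> A n" by (auto simp: U_def less_Suc_eq)
    then show ?case using step_approximable_Un[OF M Suc _ A(1) A(2)] by simp
  qed
  have "incseq U" unfolding incseq_def U_def by (intro allI impI UN_mono) auto
  then have "(\<lambda>n. measure (M \<Otimes>\<^sub>M M) (U n)) \<longlonglongrightarrow> measure (M \<Otimes>\<^sub>M M) (\<Union>n. U n)"
    by (intro P.finite_Lim_measure_incseq) auto
  also have "(\<Union>n. U n) = W" by (auto simp: U_def W_def)
  finally obtain n where n: "dist (measure (M \<Otimes>\<^sub>M M) (U n)) (measure (M \<Otimes>\<^sub>M M) W) < e / 2"
    using e by (metis LIMSEQ_iff_nz lim_sequentially order_refl)
  have "U n \<subseteq> W" by (auto simp: U_def W_def)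
  then have "measure (M \<Otimes>\<^sub>M M) (W - U n) = measure (M \<Otimes>\<^sub>M M) W - measure (M \<Otimes>\<^sub>M M) (U n)"
    by (intro P.finite_measure_Diff) auto
  with n have n': "measure (M \<Otimes>\<^sub>M M) (W - U n) \<le> e / 2" unfolding dist_real_def by linarith
  obtain c V where c[measurable]: "c \<in> measurable M (count_space UNIV)"
    and c': "measure (M \<Otimes>\<^sub>M M) {z \<in> space (M \<Otimes>\<^sub>M M). (z \<in> U n) \<noteq> step_fun c V z} \<le> e / 2"
    using approx[of n] e unfolding step_approximable_def by blast
  have "measure (M \<Otimes>\<^sub>M M) {z \<in> space (M \<Otimes>\<^sub>M M). (z \<in> W) \<noteq> step_fun c V z}
    \<le> measure (M \<Otimes>\<^sub>M M) ((W - U n) \<union> {z \<in> space (M \<Otimes>\<^sub>M M). (z \<in> U n) \<noteq> step_fun c V z})"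
    using \<open>U n \<subseteq> W\<close> by (intro P.finite_measure_mono) auto
  also have "\<dots> \<le> measure (M \<Otimes>\<^sub>M M) (W - U n) + measure (M \<Otimes>\<^sub>M M) {z \<in> space (M \<Otimes>\<^sub>M M). (z \<in> U n) \<noteq> step_fun c V z}"
    by (intro measure_Un_le) measurable
  also have "\<dots> \<le> e" using n' c' by linarith
  finally show "\<exists>c V. c \<in> measurable M (count_space UNIV) \<and>
     measure (M \<Otimes>\<^sub>M M) {z \<in> space (M \<Otimes>\<^sub>M M). (z \<in> (\<Union>i. A i)) \<noteq> step_fun c V z} \<le> e"
    using c unfolding W_def by blast
qed

text \<open>Rectangles are exact step sets, and approximable sets are closed under complements and
  countable unions, so induction over the generated sigma-algebra applies.\<close>

lemma step_approximable:
  assumes M: "finite_measure M" and E: "E \<in> sets (M \<Otimes>\<^sub>M M)"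
  shows "step_approximable M E"
proof -
  have eq: "sets (M \<Otimes>\<^sub>M M) = sigma_sets (space M \<times> space M) {a \<times> b | a b. a \<in> sets M \<and> b \<in> sets M}"
    by (rule sets_pair_measure)
  have "E \<in> sigma_sets (space M \<times> space M) {a \<times> b | a b. a \<in> sets M \<and> b \<in> sets M}" using E eq by simp
  then have "E \<in> sets (M \<Otimes>\<^sub>M M) \<and> step_approximable M E"
  proof (induction rule: sigma_sets.induct)
    case (Basic a)
    then obtain A B where a: "a = A \<times> B" and [measurable]: "A \<in> sets M" "B \<in> sets M" by auto
    \<comment> \<open>Labels refined by both sides of the rectangle, so that one partition decides
      membership in \<open>A\<close> and in \<open>B\<close>.\<close>
    define c where "c = pair_cells (\<lambda>x. if x \<in> A then 1 else 0) (\<lambda>x. if x \<in> B then 1 else 0)"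
    have c: "c \<in> measurable M (count_space UNIV)" unfolding c_def by measurable
    have "(z \<in> a) = step_fun c (\<lambda>i j. fst (prod_decode i) = 1 \<and> snd (prod_decode j) = 1) z" for z
      by (cases z) (simp add: a step_fun_def c_def pair_cells_def)
    then have eq: "{z \<in> space (M \<Otimes>\<^sub>M M). (z \<in> a) \<noteq> step_fun c (\<lambda>i j. fst (prod_decode i) = 1 \<and> snd (prod_decode j) = 1) z} = {}"
      by blast
    have "step_approximable M a"
      unfolding step_approximable_def
    proof (intro allI impI exI conjI)
      show "measure (M \<Otimes>\<^sub>M M) {z \<in> space (M \<Otimes>\<^sub>M M). (z \<in> a) \<noteq> step_fun c (\<lambda>i j. fst (prod_decode i) = 1 \<and> snd (prod_decode j) = 1) z} \<le> e"
        if "e > 0" for e :: real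
        unfolding eq using that by simp
    qed (rule c)
    then show ?case by (simp add: a)
  next
    case Empty
    have "step_fun (\<lambda>_. 0) (\<lambda>_ _. False) z = False" for z :: "'a \<times> 'a" by (simp add: step_fun_def)
    then show ?case
      unfolding step_approximable_def by (intro conjI allI impI exI[of _ "\<lambda>_. 0"] exI[of _ "\<lambda>_ _. False"]) simp_all
  next
    case (Compl a)
    have eq: "{z \<in> space (M \<Otimes>\<^sub>M M). (z \<in> space M \<times> space M - a) \<noteq> step_fun c (\<lambda>i j. \<not> V i j) z}
      = {z \<in> space (M \<Otimes>\<^sub>M M). (z \<in> a) \<noteq> step_fun c V z}" for c :: "'a \<Rightarrow> nat" and V
      by (auto simp: step_fun_def space_pair_measure)
    have "step_approximable M (space M \<times> space M - a)"
      unfolding step_approximable_def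
    proof (intro allI impI)
      fix e :: real assume "e > 0"
      then obtain c V where "c \<in> measurable M (count_space UNIV)"
        "measure (M \<Otimes>\<^sub>M M) {z \<in> space (M \<Otimes>\<^sub>M M). (z \<in> a) \<noteq> step_fun c V z} \<le> e"
        using Compl.IH unfolding step_approximable_def by blast
      then show "\<exists>c V. c \<in> measurable M (count_space UNIV) \<and>
        measure (M \<Otimes>\<^sub>M M) {z \<in> space (M \<Otimes>\<^sub>M M). (z \<in> space M \<times> space M - a) \<noteq> step_fun c V z} \<le> e"
        unfolding eq[symmetric] by blast
    qed
    moreover have "space M \<times> space M - a \<in> sets (M \<Otimes>\<^sub>M M)"
      using Compl.IH sets.compl_sets[of a "M \<Otimes>\<^sub>M M"] by (simp add: space_pair_measure)
    ultimately show ?case by blast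
  next
    case (Union A)
    then show ?case using step_approximable_Union[OF M, of A] by auto
  qed
  then show ?thesis by blast
qed

section \<open>From sets to square-integrable functions\<close>

definition L2_step_approximable :: "'a measure \<Rightarrow> ('a \<times> 'a \<Rightarrow> real) \<Rightarrow> bool" where
  "L2_step_approximable M u \<longleftrightarrow> (\<forall>e>0. \<exists>c V. c \<in> measurable M (count_space UNIV) \<and>
     square_integrable (M \<Otimes>\<^sub>M M) (step_fun c V) \<and> L2_norm (M \<Otimes>\<^sub>M M) (\<lambda>z. u z - step_fun c V z) \<le> e)"

lemma L2_step_approximable_add:
  assumes u: "L2_step_approximable M u" "square_integrable (M \<Otimes>\<^sub>M M) u"
    and v: "L2_step_approximable M v" "square_integrable (M \<Otimes>\<^sub>M M) v"
  shows "L2_step_approximable M (\<lambda>z. u z + v z)"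
  unfolding L2_step_approximable_def
proof (intro allI impI)
  fix e :: real assume "e > 0"
  then have e: "e / 2 > 0" by simp
  obtain c V where c: "c \<in> measurable M (count_space UNIV)" "square_integrable (M \<Otimes>\<^sub>M M) (step_fun c V)"
    and c': "L2_norm (M \<Otimes>\<^sub>M M) (\<lambda>z. u z - step_fun c V z) \<le> e / 2"
    using u(1) e unfolding L2_step_approximable_def by blast
  obtain d W where d: "d \<in> measurable M (count_space UNIV)" "square_integrable (M \<Otimes>\<^sub>M M) (step_fun d W)"
    and d': "L2_norm (M \<Otimes>\<^sub>M M) (\<lambda>z. v z - step_fun d W z) \<le> e / 2"
    using v(1) e unfolding L2_step_approximable_def by blast
  have eq: "step_fun (pair_cells c d) (merge_steps V W (+)) = (\<lambda>z. step_fun c V z + step_fun d W z)"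
    by (rule ext) (rule step_fun_merge)
  have "L2_norm (M \<Otimes>\<^sub>M M) (\<lambda>z. (u z - step_fun c V z) + (v z - step_fun d W z)) \<le> e"
    using L2_norm_triangle[OF square_integrable_diff[OF u(2) c(2)] square_integrable_diff[OF v(2) d(2)]] c' d'
    by linarith
  then have "L2_norm (M \<Otimes>\<^sub>M M) (\<lambda>z. u z + v z - step_fun (pair_cells c d) (merge_steps V W (+)) z) \<le> e"
    unfolding eq by (simp add: algebra_simps)
  moreover have "square_integrable (M \<Otimes>\<^sub>M M) (step_fun (pair_cells c d) (merge_steps V W (+)))"
    unfolding eq by (rule square_integrable_add[OF c(2) d(2)])
  ultimately show "\<exists>c V. c \<in> measurable M (count_space UNIV) \<and>
     square_integrable (M \<Otimes>\<^sub>M M) (step_fun c V) \<and> L2_norm (M \<Otimes>\<^sub>M M) (\<lambda>z. u z + v z - step_fun c V z) \<le> e"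
    using pair_cells_measurable[OF c(1) d(1)] by blast
qed

lemma L2_step_approximable_cmult:
  assumes u: "L2_step_approximable M u"
  shows "L2_step_approximable M (\<lambda>z. k * u z)"
  unfolding L2_step_approximable_def
proof (intro allI impI)
  fix e :: real assume "e > 0"
  then have e: "e / (\<bar>k\<bar> + 1) > 0" by simp
  obtain c V where c: "c \<in> measurable M (count_space UNIV)" "square_integrable (M \<Otimes>\<^sub>M M) (step_fun c V)"
    and c': "L2_norm (M \<Otimes>\<^sub>M M) (\<lambda>z. u z - step_fun c V z) \<le> e / (\<bar>k\<bar> + 1)"
    using u(1) e unfolding L2_step_approximable_def by blast
  have eq: "step_fun c (\<lambda>i j. k * V i j) = (\<lambda>z. k * step_fun c V z)" by (simp add: step_fun_def fun_eq_iff)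
  have "L2_norm (M \<Otimes>\<^sub>M M) (\<lambda>z. k * u z - k * step_fun c V z) = \<bar>k\<bar> * L2_norm (M \<Otimes>\<^sub>M M) (\<lambda>z. u z - step_fun c V z)"
    unfolding L2_norm_cmult[symmetric] by (simp add: algebra_simps)
  also have "\<dots> \<le> (\<bar>k\<bar> + 1) * (e / (\<bar>k\<bar> + 1))" using c' by (intro mult_mono) auto
  also have "\<dots> = e" by (simp add: add_nonneg_eq_0_iff)
  finally show "\<exists>c V. c \<in> measurable M (count_space UNIV) \<and>
     square_integrable (M \<Otimes>\<^sub>M M) (step_fun c V) \<and> L2_norm (M \<Otimes>\<^sub>M M) (\<lambda>z. k * u z - step_fun c V z) \<le> e"
    using c(1) square_integrable_cmult[OF c(2), of k] eq by (intro exI[of _ c] exI[of _ "\<lambda>i j. k * V i j"]) simp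
qed

lemma L2_step_approximable_limit:
  assumes u: "square_integrable (M \<Otimes>\<^sub>M M) u"
    and "\<And>e. e > 0 \<Longrightarrow> \<exists>v. square_integrable (M \<Otimes>\<^sub>M M) v \<and> L2_step_approximable M v \<and> L2_norm (M \<Otimes>\<^sub>M M) (\<lambda>z. u z - v z) \<le> e"
  shows "L2_step_approximable M u"
  unfolding L2_step_approximable_def
proof (intro allI impI)
  fix e :: real assume "e > 0"
  then have e: "e / 2 > 0" by simp
  obtain v where v: "square_integrable (M \<Otimes>\<^sub>M M) v" "L2_step_approximable M v" "L2_norm (M \<Otimes>\<^sub>M M) (\<lambda>z. u z - v z) \<le> e / 2"
    using assms(2)[OF e] by blast
  obtain c V where c: "c \<in> measurable M (count_space UNIV)" "square_integrable (M \<Otimes>\<^sub>M M) (step_fun c V)"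
    and c': "L2_norm (M \<Otimes>\<^sub>M M) (\<lambda>z. v z - step_fun c V z) \<le> e / 2"
    using v(2) e unfolding L2_step_approximable_def by blast
  have "L2_norm (M \<Otimes>\<^sub>M M) (\<lambda>z. (u z - v z) + (v z - step_fun c V z)) \<le> e"
    using L2_norm_triangle[OF square_integrable_diff[OF u v(1)] square_integrable_diff[OF v(1) c(2)]] c' v(3)
    by linarith
  then show "\<exists>c V. c \<in> measurable M (count_space UNIV) \<and>
     square_integrable (M \<Otimes>\<^sub>M M) (step_fun c V) \<and> L2_norm (M \<Otimes>\<^sub>M M) (\<lambda>z. u z - step_fun c V z) \<le> e"
    using c by auto
qed

lemma square_integrable_indicator:
  assumes "E \<in> sets M" "emeasure M E < \<infinity>"
  shows "square_integrable M (indicator E)" "L2_norm M (indicator E) = sqrt (measure M E)"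
proof -
  have "(\<lambda>x. (indicator E x)\<^sup>2 :: real) = indicator E" by (auto simp: indicator_def)
  then show "square_integrable M (indicator E)" "L2_norm M (indicator E) = sqrt (measure M E)"
    using assms by (simp_all add: square_integrable_def L2_norm_def)
qed

text \<open>Cutting \<open>M\<close> down to \<open>D\<close> gives a finite measure, where
  \<open>step_approximable\<close> applies. The L2 distance of two indicators is the square root of
  the measure of the symmetric difference, whence the tolerance e^2.\<close>

lemma L2_step_approximable_indicator_box:
  assumes M: "sigma_finite_measure M" and D: "D \<in> sets M" "emeasure M D < \<infinity>"
    and E: "E \<in> sets (M \<Otimes>\<^sub>M M)" "E \<subseteq> D \<times> D"
  shows "L2_step_approximable M (indicator E)"
  unfolding L2_step_approximable_def
proof (intro allI impI)
  interpret sigma_finite_measure M by fact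
  let ?P = "M \<Otimes>\<^sub>M M"
  let ?D = "reweight M (indicator D)"
  note [measurable] = D(1) E(1)
  fix e :: real assume e: "e > 0"
  have "finite_measure ?D"
    using D by (intro finite_measureI) (simp add: emeasure_density_indicator)
  moreover have sD: "sets (?D \<Otimes>\<^sub>M ?D) = sets ?P" by (intro sets_pair_measure_cong) auto
  ultimately have "step_approximable ?D E" using E(1) by (intro step_approximable) simp_all
  moreover have "e\<^sup>2 > 0" using e by simp
  ultimately obtain c V where c0: "c \<in> measurable ?D (count_space UNIV)"
    and c': "measure (?D \<Otimes>\<^sub>M ?D) {z \<in> space (?D \<Otimes>\<^sub>M ?D). (z \<in> E) \<noteq> step_fun c V z} \<le> e\<^sup>2"
    unfolding step_approximable_def by blast
  have c[measurable]: "c \<in> measurable M (count_space UNIV)" using c0 by simp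
  \<comment> \<open>Adding membership in \<open>D\<close> to the label lets the step function vanish
    off D x D; without this cut it need not be square integrable.\<close>
  define d where "d = (\<lambda>x. if x \<in> D then 1 else 0 :: nat)"
  have d[measurable]: "d \<in> measurable M (count_space UNIV)" unfolding d_def by measurable
  define V' :: "nat \<Rightarrow> nat \<Rightarrow> real" where
    "V' = merge_steps V (\<lambda>i j. i = 1 \<and> j = 1) (\<lambda>a b. if a \<and> b then 1 else 0)"
  let ?S = "{z \<in> space ?P. z \<in> D \<times> D \<and> step_fun c V z}"
  have S[measurable]: "?S \<in> sets ?P" by measurable
  have fin: "emeasure ?P (D \<times> D) < \<infinity>"
    using D by (simp add: emeasure_pair_measure_Times ennreal_mult_less_top)
  have sv: "step_fun (pair_cells c d) V' z = indicator ?S z" if "z \<in> space ?P" for z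
    unfolding V'_def step_fun_merge
    using that by (cases z) (simp add: step_fun_def d_def indicator_def)
  have "emeasure ?P ?S \<le> emeasure ?P (D \<times> D)" by (intro emeasure_mono) auto
  then have Sf: "emeasure ?P ?S < \<infinity>" using fin by (rule le_less_trans)
  have 1: "square_integrable ?P (step_fun (pair_cells c d) V')"
    using square_integrable_cong[of ?P "step_fun (pair_cells c d) V'" "indicator ?S"] sv
      square_integrable_indicator(1)[OF S Sf] by blast
  let ?T = "{z \<in> space ?P. z \<in> D \<times> D \<and> (z \<in> E) \<noteq> step_fun c V z}"
  have T[measurable]: "?T \<in> sets ?P" by measurable
  have "emeasure ?P ?T \<le> emeasure ?P (D \<times> D)" by (intro emeasure_mono) auto
  then have Tf: "emeasure ?P ?T < \<infinity>" using fin by (rule le_less_trans)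
  have "L2_norm ?P (\<lambda>z. indicator E z - step_fun (pair_cells c d) V' z) = L2_norm ?P (indicator ?T)"
    unfolding L2_norm_def
  proof (intro arg_cong[where f=sqrt] Bochner_Integration.integral_cong refl)
    fix z assume "z \<in> space ?P"
    then show "(indicator E z - step_fun (pair_cells c d) V' z)\<^sup>2 = (indicator ?T z)\<^sup>2"
      using E(2) by (auto simp: sv indicator_def)
  qed
  also have "\<dots> = sqrt (measure ?P ?T)" by (rule square_integrable_indicator(2)[OF T Tf])
  also have "measure ?P ?T = measure (?D \<Otimes>\<^sub>M ?D) {z \<in> space (?D \<Otimes>\<^sub>M ?D). (z \<in> E) \<noteq> step_fun c V z}"
  proof -
    have s: "{z \<in> space ?P. (z \<in> E) \<noteq> step_fun c V z} \<in> sets ?P" by measurable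
    have DD: "D \<times> D \<in> sets ?P" using D by simp
    have "(D \<times> D) \<inter> {z \<in> space ?P. (z \<in> E) \<noteq> step_fun c V z} = ?T" by blast
    then show ?thesis
      unfolding measure_def sets_eq_imp_space_eq[OF sD]
      unfolding density_indicator_pair[OF M D(1)] emeasure_density_indicator[OF DD s] by simp
  qed
  also have "sqrt \<dots> \<le> e" using c' e by (intro real_le_lsqrt) auto
  finally show "\<exists>c V. c \<in> measurable M (count_space UNIV) \<and>
     square_integrable ?P (step_fun c V) \<and> L2_norm ?P (\<lambda>z. indicator E z - step_fun c V z) \<le> e"
    using 1 pair_cells_measurable[OF c d] by blast
qed

text \<open>Boxes over an increasing exhaustion by sets of finite measure capture all of E but a
  remainder decreasing to the empty set; as E has finite measure, the measure of the remainder tends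
  to 0.\<close>

lemma L2_step_approximable_indicator:
  assumes M: "sigma_finite_measure M" and E: "E \<in> sets (M \<Otimes>\<^sub>M M)" "emeasure (M \<Otimes>\<^sub>M M) E < \<infinity>"
  shows "L2_step_approximable M (indicator E)"
proof (rule L2_step_approximable_limit[OF square_integrable_indicator(1)[OF E]])
  interpret sigma_finite_measure M by fact
  let ?P = "M \<Otimes>\<^sub>M M"
  fix e :: real assume e: "e > 0"
  obtain D :: "nat \<Rightarrow> 'a set" where D: "range D \<subseteq> sets M" "(\<Union>i. D i) = space M" "\<And>i. emeasure M (D i) \<noteq> \<infinity>" "incseq D"
    using sigma_finite_incseq by blast
  have [measurable]: "D n \<in> sets M" for n using D(1) by auto
  note [measurable] = E(1)
  let ?E = "\<lambda>n. E \<inter> D n \<times> D n"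
  have m: "?E n \<in> sets ?P" for n by measurable
  have "(\<lambda>n. emeasure ?P (E - ?E n)) \<longlonglongrightarrow> emeasure ?P (\<Inter>n. E - ?E n)"
  proof (rule Lim_emeasure_decseq)
    show "decseq (\<lambda>n. E - ?E n)" using incseqD[OF D(4)] by (fastforce simp: decseq_def)
    show "emeasure ?P (E - ?E n) \<noteq> \<infinity>" for n
      using emeasure_mono[of "E - ?E n" E ?P] E by (auto simp: top_unique)
  qed (use m E in auto)
  moreover have "(\<Inter>n. E - ?E n) = {}"
  proof -
    have "\<exists>n. z \<in> D n \<times> D n" if "z \<in> E" for z
    proof -
      have "z \<in> space M \<times> space M" using sets.sets_into_space[OF E(1)] that by (auto simp: space_pair_measure)
      then have "fst z \<in> (\<Union>i. D i)" "snd z \<in> (\<Union>i. D i)" unfolding D(2) by (simp_all add: mem_Times_iff)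
      then obtain i j where "fst z \<in> D i" "snd z \<in> D j" by blast
      then have "z \<in> D (max i j) \<times> D (max i j)"
        using incseqD[OF D(4), of i "max i j"] incseqD[OF D(4), of j "max i j"] by (auto simp: mem_Times_iff)
      then show ?thesis ..
    qed
    then show ?thesis by blast
  qed
  ultimately have "(\<lambda>n. emeasure ?P (E - ?E n)) \<longlonglongrightarrow> 0" by (simp only: emeasure_empty)
  then have "eventually (\<lambda>n. emeasure ?P (E - ?E n) < ennreal (e\<^sup>2)) sequentially"
    using e by (intro order_tendstoD) auto
  then obtain n where n: "emeasure ?P (E - ?E n) < ennreal (e\<^sup>2)" by (auto simp: eventually_sequentially)
  have f: "emeasure ?P (?E n) < \<infinity>"
    using emeasure_mono[of "?E n" E ?P] E by (auto simp: le_less_trans)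
  have eq: "(\<lambda>z. indicator E z - indicator (?E n) z :: real) = indicator (E - ?E n)"
    by (auto simp: indicator_def fun_eq_iff)
  have "L2_norm ?P (\<lambda>z. indicator E z - indicator (?E n) z) = sqrt (measure ?P (E - ?E n))"
    unfolding eq using n m E by (intro square_integrable_indicator(2)) (auto intro: less_trans)
  also have "\<dots> \<le> e"
  proof -
    have "measure ?P (E - ?E n) \<le> e\<^sup>2" using n unfolding measure_def by (intro enn2real_leI) auto
    then show ?thesis using e by (intro real_le_lsqrt) auto
  qed
  finally have "L2_norm ?P (\<lambda>z. indicator E z - indicator (?E n) z) \<le> e" .
  moreover have "L2_step_approximable M (indicator (?E n))"
    using D(3)[of n] m by (intro L2_step_approximable_indicator_box[OF M, of "D n"]) (auto simp: top.not_eq_extremum)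
  ultimately show "\<exists>v. square_integrable ?P v \<and> L2_step_approximable M v \<and> L2_norm ?P (\<lambda>z. indicator E z - v z) \<le> e"
    using square_integrable_indicator(1)[OF m f] by blast
qed

lemma square_integrable_simple_approx:
  assumes u: "square_integrable M u" and e: "e > 0"
  obtains F where "simple_function M F" "square_integrable M F" "L2_norm M (\<lambda>x. u x - F x) \<le> e"
proof -
  have [measurable]: "u \<in> borel_measurable M" using u by (simp add: square_integrable_def)
  obtain F where F: "\<And>i. simple_function M (F i)" "\<And>x. x \<in> space M \<Longrightarrow> (\<lambda>i. F i x) \<longlonglongrightarrow> u x"
    "\<And>i x. x \<in> space M \<Longrightarrow> dist (F i x) 0 \<le> 2 * dist (u x) 0"
    using borel_measurable_implies_sequence_metric[OF \<open>u \<in> borel_measurable M\<close>, of 0] by blast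
  have [measurable]: "F i \<in> borel_measurable M" for i using F(1) by (rule borel_measurable_simple_function)
  have Fs: "square_integrable M (F i)" for i
    by (rule square_integrable_bound[OF square_integrable_cmult[OF u, of 2]]) (use F(3) in \<open>auto simp: dist_real_def abs_mult\<close>)
  have "(\<lambda>i. \<integral>x. (u x - F i x)\<^sup>2 \<partial>M) \<longlonglongrightarrow> (\<integral>x. 0 \<partial>M)"
  proof (rule integral_dominated_convergence)
    \<comment> \<open>The dominating function: |F i| \<le> 2 |u| gives |u - F i| \<le> 3
      |u|.\<close>
    show "integrable M (\<lambda>x. 9 * (u x)\<^sup>2)" using u by (simp add: square_integrable_def)
    show "AE x in M. (\<lambda>i. (u x - F i x)\<^sup>2) \<longlonglongrightarrow> 0"
    proof (rule AE_I2)
      fix x assume "x \<in> space M"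
      then have "(\<lambda>i. (u x - F i x)\<^sup>2) \<longlonglongrightarrow> (u x - u x)\<^sup>2" by (intro tendsto_intros F(2))
      then show "(\<lambda>i. (u x - F i x)\<^sup>2) \<longlonglongrightarrow> 0" by simp
    qed
    show "AE x in M. norm ((u x - F i x)\<^sup>2) \<le> 9 * (u x)\<^sup>2" for i
    proof (rule AE_I2)
      fix x assume "x \<in> space M"
      then have "\<bar>u x - F i x\<bar> \<le> \<bar>3 * u x\<bar>" using F(3)[of x i] by (simp add: dist_real_def)
      then have "(u x - F i x)\<^sup>2 \<le> (3 * u x)\<^sup>2" by (simp only: abs_le_square_iff)
      then show "norm ((u x - F i x)\<^sup>2) \<le> 9 * (u x)\<^sup>2" by (simp add: power_mult_distrib)
    qed
  qed auto
  then have "(\<lambda>i. L2_norm M (\<lambda>x. u x - F i x)) \<longlonglongrightarrow> sqrt 0"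
    unfolding L2_norm_def by (intro tendsto_real_sqrt) simp
  then have "eventually (\<lambda>i. L2_norm M (\<lambda>x. u x - F i x) < e) sequentially"
    using e by (intro order_tendstoD) auto
  then obtain i where "L2_norm M (\<lambda>x. u x - F i x) < e" by (auto simp: eventually_sequentially)
  then show ?thesis using that[of "F i"] F(1) Fs by auto
qed

lemma L2_step_approximable_square_integrable:
  assumes M: "sigma_finite_measure M" and u: "square_integrable (M \<Otimes>\<^sub>M M) u"
  shows "L2_step_approximable M u"
proof (rule L2_step_approximable_limit[OF u])
  let ?P = "M \<Otimes>\<^sub>M M"
  fix e :: real assume "e > 0"
  then obtain F where F: "simple_function ?P F" "square_integrable ?P F" "L2_norm ?P (\<lambda>x. u x - F x) \<le> e"
    using square_integrable_simple_approx[OF u] by blast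
  have fin: "finite (F ` space ?P)" using F(1) by (simp add: simple_function_def)
  let ?L = "\<lambda>y. F -` {y} \<inter> space ?P"
  have L: "?L y \<in> sets ?P" for y using F(1) by (rule simple_functionD)
  \<comment> \<open>Chebyshev: y^2 times the measure of the level set at y is at most the integral
    of F^2. The level 0 may have infinite measure, but contributes nothing to the sum.\<close>
  have Lf: "emeasure ?P (?L y) < \<infinity>" if "y \<noteq> 0" for y
  proof -
    have "integrable ?P (\<lambda>z. (F z)\<^sup>2)" using F(2) by (simp add: square_integrable_def)
    then have "(\<integral>\<^sup>+z. ennreal ((F z)\<^sup>2) \<partial>?P) < \<infinity>" by (simp add: integrable_iff_bounded)
    moreover have "ennreal (y\<^sup>2) * emeasure ?P (?L y) \<le> (\<integral>\<^sup>+z. ennreal ((F z)\<^sup>2) \<partial>?P)"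
      using L by (subst nn_integral_cmult_indicator[symmetric]) (auto intro!: nn_integral_mono simp: indicator_def)
    ultimately have "ennreal (y\<^sup>2) * emeasure ?P (?L y) < \<infinity>" by (rule le_less_trans[rotated])
    then show ?thesis using that by (auto simp: ennreal_mult_less_top)
  qed
  have part: "L2_step_approximable M (\<lambda>z. \<Sum>y\<in>Y. y * indicator (?L y) z) \<and>
      square_integrable ?P (\<lambda>z. \<Sum>y\<in>Y. y * indicator (?L y) z)" if "finite Y" for Y
    using that
  proof (induction Y rule: finite_induct)
    case empty
    have "L2_norm ?P (\<lambda>z. 0 - step_fun (\<lambda>_. 0) (\<lambda>_ _. 0) z) = 0" by (simp add: step_fun_def L2_norm_def)
    moreover have "square_integrable ?P (step_fun (\<lambda>_. 0) (\<lambda>_ _. 0))"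
      using square_integrable_zero by (simp add: step_fun_def[abs_def])
    ultimately have "L2_step_approximable M (\<lambda>z. 0)"
      unfolding L2_step_approximable_def
      by (intro allI impI exI[of _ "\<lambda>_. 0"] exI[of _ "\<lambda>_ _. 0"]) simp
    then show ?case using square_integrable_zero by simp
  next
    case (insert y Y)
    have "L2_step_approximable M (\<lambda>z. y * indicator (?L y) z) \<and> square_integrable ?P (\<lambda>z. y * indicator (?L y) z)"
    proof (cases "y = 0")
      case True
      then show ?thesis
        using square_integrable_zero[of ?P] L2_step_approximable_cmult[of M _ 0]
          L2_step_approximable_indicator[OF M sets.empty_sets] by simp
    next
      case False
      then show ?thesis
        by (intro conjI L2_step_approximable_cmult L2_step_approximable_indicator[OF M] L Lf
            square_integrable_cmult square_integrable_indicator)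
    qed
    then show ?case
      using insert L2_step_approximable_add[of M "\<lambda>z. y * indicator (?L y) z" "\<lambda>z. \<Sum>y\<in>Y. y * indicator (?L y) z"]
        square_integrable_add[of ?P "\<lambda>z. y * indicator (?L y) z" "\<lambda>z. \<Sum>y\<in>Y. y * indicator (?L y) z"]
      by (simp only: sum.insert[OF insert.hyps])
  qed
  let ?G = "\<lambda>z. \<Sum>y\<in>F ` space ?P. y * indicator (?L y) z"
  have G: "?G z = F z" if "z \<in> space ?P" for z
  proof -
    have "?G z = (\<Sum>y\<in>F ` space ?P. if y = F z then y else 0)"
      using that by (intro sum.cong) (auto simp: indicator_def)
    also have "\<dots> = F z" using fin that by simp
    finally show ?thesis .
  qed
  have "L2_norm ?P (\<lambda>z. u z - ?G z) = L2_norm ?P (\<lambda>z. u z - F z)" by (intro L2_norm_cong) (simp only: G)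
  then have "L2_norm ?P (\<lambda>z. u z - ?G z) \<le> e" using F(3) by simp
  then show "\<exists>v. square_integrable ?P v \<and> L2_step_approximable M v \<and> L2_norm ?P (\<lambda>z. u z - v z) \<le> e"
    using part[OF fin] by blast
qed

lemma square_integrable_cell_approx:
  assumes u: "square_integrable M u" and e: "e > 0"
  obtains c :: "'a \<Rightarrow> nat" and v where "c \<in> measurable M (count_space UNIV)"
    "square_integrable M (\<lambda>x. v (c x))" "L2_norm M (\<lambda>x. u x - v (c x)) \<le> e"
proof -
  obtain F where F: "simple_function M F" "square_integrable M F" "L2_norm M (\<lambda>x. u x - F x) \<le> e"
    using square_integrable_simple_approx[OF u e] .
  have "countable (F ` space M)" using F(1) by (simp add: simple_function_def countable_finite)
  then have eq: "from_nat_into (F ` space M) (to_nat_on (F ` space M) (F x)) = F x" if "x \<in> space M" for x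
    using that by simp
  have "F \<in> measurable M (count_space UNIV)"
    using F(1) by (rule measurable_simple_function)
  then have "(\<lambda>x. to_nat_on (F ` space M) (F x)) \<in> measurable M (count_space UNIV)"
    by (rule measurable_compose) simp
  moreover have "square_integrable M (\<lambda>x. from_nat_into (F ` space M) (to_nat_on (F ` space M) (F x)))"
    using F(2) square_integrable_cong[of M _ F, OF eq] by simp
  moreover have "L2_norm M (\<lambda>x. u x - from_nat_into (F ` space M) (to_nat_on (F ` space M) (F x))) \<le> e"
    using F(3) L2_norm_cong[of M "\<lambda>x. u x - from_nat_into (F ` space M) (to_nat_on (F ` space M) (F x))" "\<lambda>x. u x - F x"] eq
    by simp
  ultimately show ?thesis by (rule that)
qed

text \<open>The common refinement of three partitions: one for u, one for d, and one into pieces of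
  finite measure, the last because \<open>glue_cells\<close> divides by the measure of each
  cell.\<close>

lemma cell_approx:
  assumes M: "sigma_finite_measure M" and u: "square_integrable (M \<Otimes>\<^sub>M M) u"
    and d: "square_integrable M d" and e: "e > 0"
  obtains c :: "'a \<Rightarrow> nat" and V v where "c \<in> measurable M (count_space UNIV)"
    "\<And>j. emeasure M {x \<in> space M. c x = j} < \<infinity>"
    "square_integrable (M \<Otimes>\<^sub>M M) (step_fun c V)" "L2_norm (M \<Otimes>\<^sub>M M) (\<lambda>z. u z - step_fun c V z) \<le> e"
    "square_integrable M (\<lambda>x. v (c x))" "L2_norm M (\<lambda>x. d x - v (c x)) \<le> e"
proof -
  interpret sigma_finite_measure M by fact
  obtain c1 V where c1: "c1 \<in> measurable M (count_space UNIV)"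
     "square_integrable (M \<Otimes>\<^sub>M M) (step_fun c1 V)" "L2_norm (M \<Otimes>\<^sub>M M) (\<lambda>z. u z - step_fun c1 V z) \<le> e"
    using L2_step_approximable_square_integrable[OF M u] e unfolding L2_step_approximable_def by blast
  obtain c2 :: "'a \<Rightarrow> nat" and v where c2: "c2 \<in> measurable M (count_space UNIV)"
    "square_integrable M (\<lambda>x. v (c2 x))" "L2_norm M (\<lambda>x. d x - v (c2 x)) \<le> e"
    using square_integrable_cell_approx[OF d e] by blast
  obtain A :: "nat \<Rightarrow> 'a set" where A: "range A \<subseteq> sets M" "(\<Union>i. A i) = space M" "\<And>i. emeasure M (A i) \<noteq> \<infinity>"
    using sigma_finite by blast
  have [measurable]: "A i \<in> sets M" for i using A(1) by auto
  define c3 where "c3 x = (LEAST i. x \<in> A i)" for x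
  have c3: "c3 \<in> measurable M (count_space UNIV)" unfolding c3_def by measurable
  have in_c3: "x \<in> A (c3 x)" if "x \<in> space M" for x
  proof -
    have "\<exists>i. x \<in> A i" using A(2) that by blast
    then show ?thesis unfolding c3_def by (rule LeastI_ex)
  qed
  define c where "c = pair_cells c1 (pair_cells c2 c3)"
  define V' where "V' i j = V (fst (prod_decode i)) (fst (prod_decode j))" for i j
  define v' where "v' i = v (fst (prod_decode (snd (prod_decode i))))" for i
  have 1: "c \<in> measurable M (count_space UNIV)"
    unfolding c_def by (intro pair_cells_measurable c1 c2 c3)
  have 2: "step_fun c V' = step_fun c1 V" by (simp add: fun_eq_iff step_fun_def c_def V'_def pair_cells_def)
  have 3: "v' (c x) = v (c2 x)" for x by (simp add: c_def v'_def pair_cells_def)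
  have 4: "emeasure M {x \<in> space M. c x = j} < \<infinity>" for j
  proof -
    let ?i = "snd (prod_decode (snd (prod_decode j)))"
    have "{x \<in> space M. c x = j} \<subseteq> A ?i"
      using in_c3 by (auto simp: c_def pair_cells_def)
    then have "emeasure M {x \<in> space M. c x = j} \<le> emeasure M (A ?i)" by (intro emeasure_mono) auto
    then show ?thesis using A(3)[of ?i] by (simp add: top.not_eq_extremum le_less_trans)
  qed
  show ?thesis
    by (rule that[of c V' v']) (use 1 4 c1 c2 in \<open>simp_all add: 2 3\<close>)
qed

section \<open>Gluing couplings along cells\<close>

text \<open>Couplings need not be composable over arbitrary measure spaces. Instead the two middle
  coordinates are only required to lie in the same cell of a countable partition, independently
  given the cell; kernels that are constant on cells cannot tell them apart.\<close>

lemma glue_cells: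
  fixes K :: "'k measure" and L :: "'l measure" and c :: "'y \<Rightarrow> nat"
  assumes Y: "sigma_finite_measure Y" and q: "measure_preserving q K Y" and p: "measure_preserving p L Y"
    and c[measurable]: "c \<in> measurable Y (count_space UNIV)"
    and fin: "\<And>j. emeasure Y {y \<in> space Y. c y = j} < \<infinity>"
  obtains Z where "sets Z = sets (K \<Otimes>\<^sub>M L)" "measure_preserving fst Z K" "measure_preserving snd Z L"
    "AE z in Z. c (q (fst z)) = c (p (snd z))"
proof -
  have [measurable]: "q \<in> measurable K Y" "p \<in> measurable L Y"
    using q p by (auto simp: measure_preserving_def)
  have sK: "sigma_finite_measure K" and sL: "sigma_finite_measure L"
    using measure_preserving_sigma_finite[OF _ Y] q p by auto
  interpret K: sigma_finite_measure K by fact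
  interpret L: sigma_finite_measure L by fact
  interpret pair_sigma_finite K L by unfold_locales
  define cell where "cell j = {y \<in> space Y. c y = j}" for j
  have cell[measurable]: "cell j \<in> sets Y" for j unfolding cell_def by measurable
  \<comment> \<open>The preimages of a cell under q and under p have the same mass, namely that of
    the cell, so one normalising factor serves both marginals.\<close>
  define k where "k j = ennreal (1 / measure Y (cell j))" for j
  have km: "k j * emeasure Y (cell j) = 1" if "emeasure Y (cell j) \<noteq> 0" for j
  proof -
    have "emeasure Y (cell j) = ennreal (measure Y (cell j))"
      using fin[of j] by (intro emeasure_eq_ennreal_measure) (simp add: cell_def top.not_eq_extremum)
    moreover from this have "measure Y (cell j) > 0" using that by (auto simp: less_le)
    ultimately show ?thesis by (simp add: k_def ennreal_mult[symmetric])
  qed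
  \<comment> \<open>On a cell of measure 0 the factor k is 0 and the fibre integral is not 1, but
    there are countably many cells, so these form a null set.\<close>
  have AEpos: "AE y in Y. emeasure Y (cell (c y)) \<noteq> 0"
  proof -
    have "(\<Union>j\<in>{j. emeasure Y (cell j) = 0}. cell j) \<in> null_sets Y"
      by (intro null_sets_UN') auto
    then show ?thesis by (rule AE_I') (auto simp: cell_def)
  qed
  define h where "h z = k (c (q (fst z))) * (if c (q (fst z)) = c (p (snd z)) then 1 else 0)" for z
  have [measurable]: "k \<in> borel_measurable (count_space UNIV)" by simp
  have [measurable]: "Measurable.pred (K \<Otimes>\<^sub>M L) (\<lambda>z. c (q (fst z)) = c (p (snd z)))"
    by (rule pred_eq_nat) measurable
  have [measurable]: "h \<in> borel_measurable (K \<Otimes>\<^sub>M L)" unfolding h_def by measurable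
  define Z where "Z = density (K \<Otimes>\<^sub>M L) h"
  have sZ: "sets Z = sets (K \<Otimes>\<^sub>M L)" by (simp add: Z_def)
  have fm: "fst \<in> measurable Z K" "snd \<in> measurable Z L"
    using sZ by (auto cong: measurable_cong_sets)
  have cellint: "(\<integral>\<^sup>+y. k j * (if j = c y then 1 else 0) \<partial>Y) = k j * emeasure Y (cell j)" for j
  proof -
    have "(\<integral>\<^sup>+y. k j * (if j = c y then 1 else 0) \<partial>Y) = (\<integral>\<^sup>+y. k j * indicator (cell j) y \<partial>Y)"
      by (intro nn_integral_cong) (auto simp: cell_def indicator_def)
    then show ?thesis by (simp add: nn_integral_cmult_indicator)
  qed
  have 1: "measure_preserving fst Z K"
    unfolding measure_preserving_def
  proof (intro conjI measure_eqI fm)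
    fix A assume "A \<in> sets (distr Z K fst)"
    then have A[measurable]: "A \<in> sets K" by simp
    have "fst -` A \<inter> space Z \<in> sets (K \<Otimes>\<^sub>M L)" using measurable_sets[OF fm(1) A] sZ by simp
    then have "emeasure (distr Z K fst) A = (\<integral>\<^sup>+z. h z * indicator (fst -` A \<inter> space Z) z \<partial>(K \<Otimes>\<^sub>M L))"
      using fm A unfolding Z_def by (subst emeasure_distr) (auto simp: emeasure_density)
    also have "\<dots> = (\<integral>\<^sup>+z. h z * indicator A (fst z) \<partial>(K \<Otimes>\<^sub>M L))"
      by (intro nn_integral_cong) (auto simp: indicator_def Z_def)
    also have "\<dots> = (\<integral>\<^sup>+u. \<integral>\<^sup>+v. h (u, v) * indicator A u \<partial>L \<partial>K)"
      by (subst L.nn_integral_fst[symmetric]) auto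
    also have "\<dots> = (\<integral>\<^sup>+u. indicator A u \<partial>K)"
    proof (rule nn_integral_cong_AE)
      have "AE u in K. emeasure Y (cell (c (q u))) \<noteq> 0"
        by (rule measure_preserving_AE[OF q AEpos])
      then show "AE u in K. (\<integral>\<^sup>+v. h (u, v) * indicator A u \<partial>L) = indicator A u"
        using AE_space
      proof eventually_elim
        case (elim u)
        have "(\<integral>\<^sup>+v. h (u, v) * indicator A u \<partial>L) = (\<integral>\<^sup>+v. h (u, v) \<partial>L) * indicator A u"
          using elim by (intro nn_integral_multc) measurable
        also have "(\<integral>\<^sup>+v. h (u, v) \<partial>L) = (\<integral>\<^sup>+y. k (c (q u)) * (if c (q u) = c y then 1 else 0) \<partial>Y)"
          using measure_preserving_nn_integral[OF p, of "\<lambda>y. k (c (q u)) * (if c (q u) = c y then 1 else 0)"]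
          by (simp add: h_def)
        also have "\<dots> = 1" unfolding cellint by (rule km[OF elim(1)])
        finally show ?case by simp
      qed
    qed
    finally show "emeasure (distr Z K fst) A = emeasure K A" by simp
  qed simp
  have 2: "measure_preserving snd Z L"
    unfolding measure_preserving_def
  proof (intro conjI measure_eqI fm)
    fix A assume "A \<in> sets (distr Z L snd)"
    then have A[measurable]: "A \<in> sets L" by simp
    have "snd -` A \<inter> space Z \<in> sets (K \<Otimes>\<^sub>M L)" using measurable_sets[OF fm(2) A] sZ by simp
    then have "emeasure (distr Z L snd) A = (\<integral>\<^sup>+z. h z * indicator (snd -` A \<inter> space Z) z \<partial>(K \<Otimes>\<^sub>M L))"
      using fm A unfolding Z_def by (subst emeasure_distr) (auto simp: emeasure_density)
    also have "\<dots> = (\<integral>\<^sup>+z. h z * indicator A (snd z) \<partial>(K \<Otimes>\<^sub>M L))"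
      by (intro nn_integral_cong) (auto simp: indicator_def Z_def)
    also have "\<dots> = (\<integral>\<^sup>+v. \<integral>\<^sup>+u. h (u, v) * indicator A v \<partial>K \<partial>L)"
      by (subst nn_integral_snd[symmetric]) auto
    also have "\<dots> = (\<integral>\<^sup>+v. indicator A v \<partial>L)"
    proof (rule nn_integral_cong_AE)
      have "AE v in L. emeasure Y (cell (c (p v))) \<noteq> 0"
        by (rule measure_preserving_AE[OF p AEpos])
      then show "AE v in L. (\<integral>\<^sup>+u. h (u, v) * indicator A v \<partial>K) = indicator A v"
        using AE_space
      proof eventually_elim
        case (elim v)
        have "(\<integral>\<^sup>+u. h (u, v) * indicator A v \<partial>K) = (\<integral>\<^sup>+u. h (u, v) \<partial>K) * indicator A v"
          using elim by (intro nn_integral_multc) measurable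
        also have "(\<integral>\<^sup>+u. h (u, v) \<partial>K) = (\<integral>\<^sup>+u. k (c (p v)) * (if c (p v) = c (q u) then 1 else 0) \<partial>K)"
          by (intro nn_integral_cong) (auto simp: h_def)
        also have "\<dots> = (\<integral>\<^sup>+y. k (c (p v)) * (if c (p v) = c y then 1 else 0) \<partial>Y)"
          by (intro measure_preserving_nn_integral[OF q, of "\<lambda>y. k (c (p v)) * (if c (p v) = c y then 1 else 0)"]) measurable
        also have "\<dots> = 1" unfolding cellint by (rule km[OF elim(1)])
        finally show ?case by simp
      qed
    qed
    finally show "emeasure (distr Z L snd) A = emeasure L A" by simp
  qed simp
  have 3: "AE z in Z. c (q (fst z)) = c (p (snd z))"
    unfolding Z_def by (subst AE_density) (auto simp: h_def)
  show ?thesis using that[OF sZ 1 2 3] .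
qed

lemma AE_pair_both:
  assumes Z: "sigma_finite_measure Z" and P: "Measurable.pred Z P" and ae: "AE z in Z. P z"
  shows "AE w in Z \<Otimes>\<^sub>M Z. P (fst w) \<and> P (snd w)"
proof -
  interpret Z: sigma_finite_measure Z by fact
  interpret pair_sigma_finite Z Z by unfold_locales
  note [measurable] = P
  show ?thesis
  proof (rule AE_pair_measure)
    show "{w \<in> space (Z \<Otimes>\<^sub>M Z). P (fst w) \<and> P (snd w)} \<in> sets (Z \<Otimes>\<^sub>M Z)" by measurable
    show "AE x in Z. AE y in Z. P (fst (x, y)) \<and> P (snd (x, y))"
      using ae by eventually_elim (use ae in simp)
  qed
qed

text \<open>Where r and t land in the same cell, the step functions cancel and only the two
  approximation errors remain, which gives 2 e in L2 and hence in operator norm. Both pullbacks have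
  the same \<open>rho\<close>, whence the bound 0.\<close>

lemma graphex_bound_same_cell:
  assumes T: "regular_graphex T" and r: "measure_preserving r Z (msp T)" and t: "measure_preserving t Z (msp T)"
    and c: "c \<in> measurable (msp T) (count_space UNIV)" and ae: "AE z in Z. c (r z) = c (t z)"
    and V: "square_integrable (msp T \<Otimes>\<^sub>M msp T) (step_fun c V)"
      "L2_norm (msp T \<Otimes>\<^sub>M msp T) (\<lambda>z. (case z of (x, y) \<Rightarrow> graphon T x y) - step_fun c V z) \<le> e"
    and v: "square_integrable (msp T) (\<lambda>x. v (c x))" "L2_norm (msp T) (\<lambda>x. marginal T x - v (c x)) \<le> e"
  shows "graphex_bound (graphex_diff (pullback r Z T) (pullback t Z T)) (2 * e) (2 * e) 0"
proof -
  let ?Y = "msp T"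
  note R = regular_graphexD[OF T]
  have Z: "sigma_finite_measure Z" by (rule measure_preserving_sigma_finite[OF r R(2)])
  have Rr: "regular_graphex (pullback r Z T)" and Rt: "regular_graphex (pullback t Z T)"
    using regular_graphex_pullback_iff[OF R(1)] T r t by auto
  have rm: "r \<in> measurable Z ?Y" "t \<in> measurable Z ?Y" using r t by (auto simp: measure_preserving_def)
  define u where "u = (\<lambda>w. graphon T (fst w) (snd w) - step_fun c V w)"
  have gT: "(\<lambda>(x, y). graphon T x y) = (\<lambda>w. graphon T (fst w) (snd w))" by (simp add: split_beta')
  have us: "square_integrable (?Y \<Otimes>\<^sub>M ?Y) u" "L2_norm (?Y \<Otimes>\<^sub>M ?Y) u \<le> e"
    using square_integrable_diff[OF R(4) V(1)] V(2) by (simp_all add: u_def gT split_beta')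
  have um: "u \<in> borel_measurable (?Y \<Otimes>\<^sub>M ?Y)" using us(1) by (rule square_integrable_measurable)
  note mr = measure_preserving_map_prod[OF r r R(2)] and mt = measure_preserving_map_prod[OF t t R(2)]
  have ur: "square_integrable (Z \<Otimes>\<^sub>M Z) (\<lambda>w. u (map_prod r r w))" "L2_norm (Z \<Otimes>\<^sub>M Z) (\<lambda>w. u (map_prod r r w)) \<le> e"
    using us measure_preserving_square_integrable[OF mr um] measure_preserving_L2_norm[OF mr um] by simp_all
  have ut: "square_integrable (Z \<Otimes>\<^sub>M Z) (\<lambda>w. u (map_prod t t w))" "L2_norm (Z \<Otimes>\<^sub>M Z) (\<lambda>w. u (map_prod t t w)) \<le> e"
    using us measure_preserving_square_integrable[OF mt um] measure_preserving_L2_norm[OF mt um] by simp_all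
  note sq = square_integrable_graphex_diff[OF Rr Rt, unfolded pullback_simps, OF refl]
  have pred: "Measurable.pred Z (\<lambda>z. c (r z) = c (t z))"
    by (intro pred_eq_nat measurable_compose[OF rm(1) c] measurable_compose[OF rm(2) c])
  have "L2_norm (Z \<Otimes>\<^sub>M Z) (\<lambda>(x, y). graphon T (r x) (r y) - graphon T (t x) (t y))
    = L2_norm (Z \<Otimes>\<^sub>M Z) (\<lambda>w. u (map_prod r r w) + - u (map_prod t t w))"
  proof (rule L2_norm_cong_AE)
    show "(\<lambda>(x, y). graphon T (r x) (r y) - graphon T (t x) (t y)) \<in> borel_measurable (Z \<Otimes>\<^sub>M Z)"
      using sq by (rule square_integrable_measurable)
    show "(\<lambda>w. u (map_prod r r w) + - u (map_prod t t w)) \<in> borel_measurable (Z \<Otimes>\<^sub>M Z)"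
      by (rule square_integrable_measurable[OF square_integrable_add[OF ur(1) square_integrable_uminus[OF ut(1)]]])
    show "AE w in Z \<Otimes>\<^sub>M Z. (case w of (x, y) \<Rightarrow> graphon T (r x) (r y) - graphon T (t x) (t y))
      = u (map_prod r r w) + - u (map_prod t t w)"
      using AE_pair_both[OF Z pred ae]
      by eventually_elim (simp add: u_def split_beta' step_fun_def)
  qed
  also have "\<dots> \<le> 2 * e"
    using L2_norm_triangle[OF ur(1) square_integrable_uminus[OF ut(1)]] ur(2) ut(2)
    unfolding L2_norm_uminus by linarith
  finally have 1: "kernel_le Z (\<lambda>x y. graphon T (r x) (r y) - graphon T (t x) (t y)) (2 * e)"
    by (rule kernel_le_mono[OF kernel_le_L2_norm[OF Z sq]])
  define d where "d = (\<lambda>x. marginal T x - v (c x))"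
  have ds: "square_integrable ?Y d" "L2_norm ?Y d \<le> e"
    using square_integrable_diff[OF regular_graphex_marginal(1)[OF T] v(1)] v(2) by (simp_all add: d_def)
  have dm: "d \<in> borel_measurable ?Y" using ds(1) by (rule square_integrable_measurable)
  have dr: "square_integrable Z (\<lambda>z. d (r z))" "L2_norm Z (\<lambda>z. d (r z)) \<le> e"
    using ds measure_preserving_square_integrable[OF r dm] measure_preserving_L2_norm[OF r dm] by simp_all
  have dt: "square_integrable Z (\<lambda>z. d (t z))" "L2_norm Z (\<lambda>z. d (t z)) \<le> e"
    using ds measure_preserving_square_integrable[OF t dm] measure_preserving_L2_norm[OF t dm] by simp_all
  have "L2_norm Z (\<lambda>z. marginal (pullback r Z T) z - marginal (pullback t Z T) z)
    = L2_norm Z (\<lambda>z. d (r z) + - d (t z))"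
  proof (rule L2_norm_cong_AE)
    show "(\<lambda>z. marginal (pullback r Z T) z - marginal (pullback t Z T) z) \<in> borel_measurable Z"
      using marginal_measurable[OF regular_graphexD(1)[OF Rr]] marginal_measurable[OF regular_graphexD(1)[OF Rt]]
      unfolding pullback_simps by (rule borel_measurable_diff)
    show "(\<lambda>z. d (r z) + - d (t z)) \<in> borel_measurable Z"
      by (rule square_integrable_measurable[OF square_integrable_add[OF dr(1) square_integrable_uminus[OF dt(1)]]])
    show "AE z in Z. marginal (pullback r Z T) z - marginal (pullback t Z T) z = d (r z) + - d (t z)"
      using ae AE_space
      by eventually_elim (simp add: d_def marginal_pullback[OF R(1) r] marginal_pullback[OF R(1) t])
  qed
  also have "\<dots> \<le> 2 * e"
    using L2_norm_triangle[OF dr(1) square_integrable_uminus[OF dt(1)]] dr(2) dt(2)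
    unfolding L2_norm_uminus by linarith
  finally have 2: "L2_norm Z (\<lambda>z. marginal (pullback r Z T) z - marginal (pullback t Z T) z) \<le> 2 * e" .
  show ?thesis
    using graphex_bound_diff_iff[OF Rr Rt, of "2 * e" "2 * e" 0] 1 2
    by (simp add: rho_pullback[OF R(1) r] rho_pullback[OF R(1) t])
qed

section \<open>Dominated measures as densities\<close>

lemma dominated_density:
  assumes M: "sigma_finite_measure M" and s: "sets N = sets M"
    and le: "\<And>A. A \<in> sets M \<Longrightarrow> emeasure N A \<le> emeasure M A"
  obtains w where "weight M w" "N = reweight M w"
proof -
  interpret sigma_finite_measure M by fact
  have "absolutely_continuous M N"
    using le s by (auto simp: absolutely_continuous_def null_sets_def) (metis le_zero_eq)
  then obtain f where f[measurable]: "f \<in> borel_measurable M" and N: "density M f = N"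
    using Radon_Nikodym s by blast
  have "AE x in M. f x \<le> 1"
  proof -
    obtain A :: "nat \<Rightarrow> 'a set" where A: "range A \<subseteq> sets M" "(\<Union>i. A i) = space M" "\<And>i. emeasure M (A i) \<noteq> \<infinity>"
      using sigma_finite by blast
    have [measurable]: "A i \<in> sets M" for i using A(1) by auto
    \<comment> \<open>On this set \<open>N\<close> is at least 1 + 1/(n + 1) times \<open>M\<close>,
      yet at most \<open>M\<close>. The part inside \<open>A i\<close> has finite measure, so it
      must be null.\<close>
    have "AE x in M. \<not> (x \<in> A i \<and> 1 + ennreal (1 / Suc n) \<le> f x)" for i n
    proof -
      let ?B = "{x \<in> space M. x \<in> A i \<and> 1 + ennreal (1 / Suc n) \<le> f x}"
      have B[measurable]: "?B \<in> sets M" by measurable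
      have "emeasure M ?B \<le> emeasure M (A i)" by (intro emeasure_mono) auto
      then have fin: "emeasure M ?B \<noteq> \<infinity>" using A(3)[of i] by (auto simp: top_unique)
      have "(1 + ennreal (1 / Suc n)) * emeasure M ?B \<le> emeasure N ?B"
        unfolding N[symmetric] emeasure_density[OF f B]
        by (subst nn_integral_cmult_indicator[symmetric]) (auto intro!: nn_integral_mono simp: indicator_def)
      also have "\<dots> \<le> emeasure M ?B" by (rule le[OF B])
      finally have "emeasure M ?B + ennreal (1 / Suc n) * emeasure M ?B \<le> emeasure M ?B + 0"
        by (simp add: distrib_right)
      then have "ennreal (1 / Suc n) * emeasure M ?B \<le> 0"
        using fin by (subst (asm) ennreal_add_left_cancel_le) auto
      then have "emeasure M ?B = 0" by simp
      then show ?thesis by (intro AE_I[of _ _ ?B]) auto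
    qed
    then have "AE x in M. \<forall>i n. \<not> (x \<in> A i \<and> 1 + ennreal (1 / Suc n) \<le> f x)"
      by (simp only: AE_all_countable) blast
    then show ?thesis
      using AE_space
    proof eventually_elim
      case (elim x)
      then obtain i where "x \<in> A i" using A(2) by blast
      then have lt: "f x < 1 + ennreal (1 / Suc n)" for n using elim(1) by (meson not_le)
      show "f x \<le> 1"
      proof (rule ennreal_le_epsilon)
        fix e :: real assume "e > 0"
        then obtain n where "inverse (real (Suc n)) < e" using reals_Archimedean by blast
        then have "ennreal (1 / Suc n) \<le> ennreal e" by (intro ennreal_leI) (simp add: divide_inverse)
        then have "1 + ennreal (1 / Suc n) \<le> 1 + ennreal e" by (rule add_left_mono)
        with lt[of n] show "f x \<le> 1 + ennreal e" by (meson less_imp_le order_trans)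
      qed
    qed
  qed
  \<comment> \<open>Cutting at 1 changes the density on a null set only and yields a finite weight
    that obeys its bounds at every point.\<close>
  then have eq: "density M f = density M (\<lambda>x. ennreal (enn2real (min (f x) 1)))"
    by (intro density_cong) (auto elim!: eventually_mono simp: min_def ennreal_enn2real_if top_unique)
  show ?thesis
  proof (rule that)
    show "weight M (\<lambda>x. enn2real (min (f x) 1))"
      by (auto simp: weight_def intro!: enn2real_leI)
    show "N = density M (\<lambda>x. ennreal (enn2real (min (f x) 1)))" using N eq by simp
  qed
qed

lemma weight_emeasure_le:
  assumes w: "weight M w" and A: "A \<in> sets M"
  shows "emeasure (reweight M w) A \<le> emeasure M A"
proof -
  have "emeasure (reweight M w) A = (\<integral>\<^sup>+x. ennreal (w x) * indicator A x \<partial>M)"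
    using w A by (intro emeasure_density) (auto simp: weight_def)
  also have "\<dots> \<le> (\<integral>\<^sup>+x. indicator A x \<partial>M)"
    using w by (intro nn_integral_mono) (auto simp: weight_def indicator_def ennreal_le_1)
  also have "\<dots> = emeasure M A" using A by simp
  finally show ?thesis .
qed

lemma weight_emeasure_split:
  assumes w: "weight M w" and A: "A \<in> sets M"
  shows "emeasure M A = emeasure (reweight M w) A + (\<integral>\<^sup>+x. ennreal (1 - w x) * indicator A x \<partial>M)"
proof -
  have [measurable]: "w \<in> borel_measurable M" "A \<in> sets M" using w A by (auto simp: weight_def)
  have "emeasure M A = (\<integral>\<^sup>+x. ennreal (w x) * indicator A x + ennreal (1 - w x) * indicator A x \<partial>M)"
  proof -
    have "(\<integral>\<^sup>+x. ennreal (w x) * indicator A x + ennreal (1 - w x) * indicator A x \<partial>M) = (\<integral>\<^sup>+x. indicator A x \<partial>M)"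
      using w by (intro nn_integral_cong) (auto simp: weight_def indicator_def ennreal_plus[symmetric] simp del: ennreal_plus)
    then show ?thesis by simp
  qed
  also have "\<dots> = (\<integral>\<^sup>+x. ennreal (w x) * indicator A x \<partial>M) + (\<integral>\<^sup>+x. ennreal (1 - w x) * indicator A x \<partial>M)"
    by (rule nn_integral_add) auto
  finally show ?thesis using emeasure_density[of "\<lambda>x. ennreal (w x)" M A] by simp
qed

lemma measure_within_iff:
  "measure_within M r N \<longleftrightarrow> sets N = sets M \<and>
    (\<forall>B\<in>sets M. emeasure M B \<le> emeasure N B + ennreal r \<and> emeasure N B \<le> emeasure M B)"
  unfolding measure_within_def by (auto simp: ennreal_minus_le_iff add.commute)

text \<open>On the whole space the lower bound may read \<infinity> \<le> \<infinity> and say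
  nothing. On sets of finite measure the common part can be cancelled, and an exhaustion by such
  sets gives the full integral.\<close>

lemma weight_defect_le:
  assumes M: "sigma_finite_measure M" and w: "weight M w"
    and within: "measure_within M r (reweight M w)"
  shows "(\<integral>\<^sup>+x. ennreal (1 - w x) \<partial>M) \<le> ennreal r"
proof -
  interpret sigma_finite_measure M by fact
  have [measurable]: "w \<in> borel_measurable M" using w by (auto simp: weight_def)
  obtain A :: "nat \<Rightarrow> 'a set" where A: "range A \<subseteq> sets M" "(\<Union>i. A i) = space M" "\<And>i. emeasure M (A i) \<noteq> \<infinity>" "incseq A"
    using sigma_finite_incseq by blast
  have As: "A i \<in> sets M" for i using A(1) by auto
  define D where "D = density M (\<lambda>x. ennreal (1 - w x))"
  have Ds: "emeasure D B = (\<integral>\<^sup>+x. ennreal (1 - w x) * indicator B x \<partial>M)" if "B \<in> sets M" for B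
    unfolding D_def using that by (intro emeasure_density) auto
  have "emeasure D (A i) \<le> ennreal r" for i
  proof -
    let ?N = "reweight M w"
    have "emeasure M (A i) \<le> emeasure ?N (A i) + ennreal r"
      using within As[of i] unfolding measure_within_iff by blast
    then have "emeasure ?N (A i) + emeasure D (A i) \<le> emeasure ?N (A i) + ennreal r"
      unfolding Ds[OF As] weight_emeasure_split[OF w As, symmetric] .
    moreover have "emeasure ?N (A i) \<noteq> \<infinity>"
      using weight_emeasure_le[OF w As, of i] A(3)[of i] by (auto simp: top_unique)
    ultimately show ?thesis using ennreal_add_left_cancel_le[of "emeasure ?N (A i)"] by auto
  qed
  then have "(SUP i. emeasure D (A i)) \<le> ennreal r" by (intro SUP_least)
  also have "(SUP i. emeasure D (A i)) = emeasure D (\<Union>i. A i)"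
    using A by (intro SUP_emeasure_incseq) (auto simp: D_def)
  also have "\<dots> = (\<integral>\<^sup>+x. ennreal (1 - w x) \<partial>M)"
    unfolding A(2) Ds[OF sets.top] by (intro nn_integral_cong) (simp add: indicator_def)
  finally show ?thesis .
qed

section \<open>Integrals and densities on the extended space\<close>

lemma density_indicator_range_Inr:
  "reweight (ext_measure M) (indicator (range Inr)) = distr lborel (ext_measure M) Inr"
proof (rule measure_eqI)
  fix B assume "B \<in> sets (reweight (ext_measure M) (indicator (range Inr)))"
  then have B: "B \<in> sets (ext_measure M)" by simp
  have RB: "range Inr \<inter> B \<in> sets (ext_measure M)" using B Inr_range_sets by blast
  have v: "Inl -` (range Inr \<inter> B) = {}" "Inr -` (range Inr \<inter> B) = Inr -` B" by auto
  have "emeasure (reweight (ext_measure M) (indicator (range Inr))) B = emeasure (ext_measure M) (range Inr \<inter> B)"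
    by (rule emeasure_density_indicator[OF Inr_range_sets B])
  also have "\<dots> = emeasure lborel (Inr -` B)"
    unfolding emeasure_ext_measure[OF RB] v by simp
  also have "\<dots> = emeasure (distr lborel (ext_measure M) Inr) B"
    using B by (simp add: emeasure_distr)
  finally show "emeasure (reweight (ext_measure M) (indicator (range Inr))) B
    = emeasure (distr lborel (ext_measure M) Inr) B" .
qed simp

lemma nn_integral_ext_measure:
  assumes f[measurable]: "f \<in> borel_measurable (ext_measure M)"
  shows "(\<integral>\<^sup>+u. f u \<partial>ext_measure M) = (\<integral>\<^sup>+x. f (Inl x) \<partial>M) + (\<integral>\<^sup>+t. f (Inr t) \<partial>lborel)"
proof -
  let ?X = "ext_measure M"
  have [measurable]: "Inl ` space M \<in> sets ?X" by (simp add: Inl_sets_ext)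
  have "(\<integral>\<^sup>+u. f u \<partial>?X) = (\<integral>\<^sup>+u. ennreal (indicator (Inl ` space M) u) * f u + ennreal (indicator (range Inr) u) * f u \<partial>?X)"
    by (intro nn_integral_cong) (auto simp: indicator_def)
  also have "\<dots> = (\<integral>\<^sup>+u. ennreal (indicator (Inl ` space M) u) * f u \<partial>?X) + (\<integral>\<^sup>+u. ennreal (indicator (range Inr) u) * f u \<partial>?X)"
    by (intro nn_integral_add) measurable
  also have "(\<integral>\<^sup>+u. ennreal (indicator (Inl ` space M) u) * f u \<partial>?X) = (\<integral>\<^sup>+u. f u \<partial>finite_part M)"
    by (rule nn_integral_density[symmetric]) measurable
  also have "\<dots> = (\<integral>\<^sup>+x. f (Inl x) \<partial>M)"
    by (rule measure_preserving_nn_integral[OF measure_preserving_Inl, symmetric]) simp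
  also have "(\<integral>\<^sup>+u. ennreal (indicator (range Inr) u) * f u \<partial>?X) = (\<integral>\<^sup>+u. f u \<partial>reweight ?X (indicator (range Inr)))"
    by (rule nn_integral_density[symmetric]) measurable
  also have "\<dots> = (\<integral>\<^sup>+t. f (Inr t) \<partial>lborel)"
    unfolding density_indicator_range_Inr by (rule nn_integral_distr) measurable
  finally show ?thesis .
qed

lemma ext_measure_density:
  assumes [measurable]: "h \<in> borel_measurable M"
  shows "ext_measure (density M h) = density (ext_measure M) (case_sum h (\<lambda>_. 1))"
proof (rule measure_eqI)
  show s: "sets (ext_measure (density M h)) = sets (density (ext_measure M) (case_sum h (\<lambda>_. 1)))"
    using sets_ext_measure_cong[of "density M h" M] by simp
  have [measurable]: "case_sum h (\<lambda>_. 1) \<in> borel_measurable (ext_measure M)"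
    by (rule measurable_case_ext) auto
  fix B assume B: "B \<in> sets (ext_measure (density M h))"
  then have B'[measurable]: "B \<in> sets (ext_measure M)" using s by simp
  have "emeasure (density (ext_measure M) (case_sum h (\<lambda>_. 1))) B = (\<integral>\<^sup>+u. case_sum h (\<lambda>_. 1) u * indicator B u \<partial>ext_measure M)"
    by (rule emeasure_density) measurable
  also have "\<dots> = (\<integral>\<^sup>+x. h x * indicator (Inl -` B) x \<partial>M) + (\<integral>\<^sup>+t. indicator (Inr -` B) t \<partial>lborel)"
    by (subst nn_integral_ext_measure) (auto simp: indicator_def cong: nn_integral_cong)
  also have "\<dots> = emeasure (density M h) (Inl -` B) + emeasure lborel (Inr -` B)"
    using vimage_Inl_ext[OF B'] vimage_Inr_ext[OF B'] by (simp add: emeasure_density)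
  also have "\<dots> = emeasure (ext_measure (density M h)) B" by (rule emeasure_ext_measure[OF B, symmetric])
  finally show "emeasure (ext_measure (density M h)) B = emeasure (density (ext_measure M) (case_sum h (\<lambda>_. 1))) B" ..
qed

text \<open>\<open>pullback\<close> installs its own measure, so the measure of the graphex is
  forgotten. Bounds on differences can therefore be reused when the measure of the middle or an
  outer graphex changes.\<close>

lemma pullback_trivial_ext_msp[simp]:
  "pullback p Z (trivial_ext (G\<lparr>msp := N\<rparr>)) = pullback p Z (trivial_ext G)"
  by (auto simp: pullback_def trivial_ext_def fun_eq_iff split: sum.split)

section \<open>Reweighting a coupling through one of its marginals\<close>

text \<open>With the weight h composed with the second projection, the second marginal becomes the
  reweighted one, and the coupling loses as much mass as h does. The new first marginal is dominated
  by the old one, hence has a density, and it too loses at most e^2. The bounds are those of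
  \<open>graphex_bound_weight\<close> for the difference graphex.\<close>

lemma reweight_coupling:
  fixes G :: "'a graphex" and H :: "'b graphex"
  assumes G: "regular_graphex G" and H: "regular_graphex H"
    and K: "coupling (ext_measure (msp G)) (ext_measure (msp H)) K"
    and h: "weight (msp H) h" and c: "c \<ge> 0" and e: "e \<ge> 0"
    and defect: "(\<integral>\<^sup>+x. ennreal (1 - h x) \<partial>msp H) \<le> ennreal (e\<^sup>2)"
    and bound: "graphex_bound (coupling_diff G H K) c (c\<^sup>2) (c^3)"
  obtains v L where "weight (msp G) v" "sets L = sets (ext_measure (msp G) \<Otimes>\<^sub>M ext_measure (msp H))"
    "sigma_finite_measure (distr L (ext_measure (msp G)) fst)"
    "regular_graphex (pullback fst L (trivial_ext G))"
    "measure_preserving snd L (ext_measure (reweight (msp H) h))"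
    "ext_preserving fst L (reweight (msp G) v)"
    "\<And>A. A \<in> sets (msp G) \<Longrightarrow> emeasure (msp G) A \<le> emeasure (reweight (msp G) v) A + ennreal (e\<^sup>2)"
    "graphex_bound (coupling_diff G H L) c (c * (c + e)) (c * (c + e)\<^sup>2)"
proof -
  let ?M = "msp G" and ?N = "msp H"
  let ?X = "ext_measure ?M" and ?Y = "ext_measure ?N"
  note RG = regular_graphexD[OF G] and RH = regular_graphexD[OF H]
  have sX: "sigma_finite_measure ?X" by (rule sigma_finite_ext_measure[OF RG(2)])
  note mp = coupling_measure_preserving[OF K]
  have sK: "sets K = sets (?X \<Otimes>\<^sub>M ?Y)" using K by (simp add: coupling_def)
  have Kf: "sigma_finite_measure K" by (rule measure_preserving_sigma_finite[OF mp(1) sX])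
  have fm[measurable]: "fst \<in> measurable K ?X" "snd \<in> measurable K ?Y"
    using mp by (auto simp: measure_preserving_def)
  have [measurable]: "h \<in> borel_measurable ?N" using h by (simp add: weight_def)
  \<comment> \<open>Weight 1 on the added line: the extended second marginal keeps its Lebesgue
    part, and the line contributes nothing to the defect.\<close>
  define g where "g = case_sum h (\<lambda>_ :: real. 1)"
  have gm[measurable]: "g \<in> borel_measurable ?Y" unfolding g_def by (rule measurable_case_ext) auto
  define w where "w = (\<lambda>z :: ('a + real) \<times> ('b + real). g (snd z))"
  have w: "weight K w"
    unfolding weight_def w_def
  proof (intro conjI ballI)
    show "(\<lambda>z. g (snd z)) \<in> borel_measurable K" by measurable
    fix z assume "z \<in> space K"
    then have "snd z \<in> space ?Y" using measurable_space[OF fm(2)] by blast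
    then show "0 \<le> g (snd z)" "g (snd z) \<le> 1" using h by (auto simp: g_def weight_def)
  qed
  define L where "L = reweight K w"
  have sL: "sets L = sets (?X \<Otimes>\<^sub>M ?Y)" by (simp add: L_def sK)
  have spL: "space L = space K" by (simp add: L_def)
  have fL: "fst \<in> measurable L ?X" "snd \<in> measurable L ?Y"
    using sL by (auto cong: measurable_cong_sets)
  have wdef: "(\<integral>\<^sup>+z. ennreal (1 - w z) \<partial>K) \<le> ennreal (e\<^sup>2)"
  proof -
    have "(\<integral>\<^sup>+z. ennreal (1 - w z) \<partial>K) = (\<integral>\<^sup>+u. ennreal (1 - g u) \<partial>?Y)"
      unfolding w_def by (rule measure_preserving_nn_integral[OF mp(2), of "\<lambda>u. ennreal (1 - g u)"]) measurable
    also have "\<dots> = (\<integral>\<^sup>+x. ennreal (1 - g (Inl x)) \<partial>?N) + (\<integral>\<^sup>+t. ennreal (1 - g (Inr t)) \<partial>lborel)"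
      by (rule nn_integral_ext_measure) measurable
    also have "\<dots> = (\<integral>\<^sup>+x. ennreal (1 - h x) \<partial>?N)" by (simp add: g_def)
    finally show ?thesis using defect by simp
  qed
  have b: "graphex_bound (coupling_diff G H L) c (c * (c + e)) (c * (c + e)\<^sup>2)"
  proof -
    have "regular_graphex (coupling_diff G H K)"
      by (intro regular_graphex_diff regular_graphex_pullback_ext measure_preserving_ext_preserving mp Kf G H) simp
    from graphex_bound_weight[OF this _ c e _ bound, of w]
    have "graphex_bound ((coupling_diff G H K)\<lparr>msp := reweight K w\<rparr>) c (c * (c + e)) (c * (c + e)\<^sup>2)"
      using w wdef by simp
    then show ?thesis by (simp add: graphex_diff_def pullback_def L_def)
  qed
  have rL: "regular_graphex (pullback fst L (trivial_ext G))"
  proof -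
    have "regular_graphex (pullback fst K (trivial_ext G))"
      by (intro regular_graphex_pullback_ext measure_preserving_ext_preserving mp Kf G)
    from regular_graphex_weight[OF this, of w] w
    have "regular_graphex ((pullback fst K (trivial_ext G))\<lparr>msp := reweight K w\<rparr>)" by simp
    then show ?thesis by (simp add: pullback_def L_def)
  qed
  have mpL: "measure_preserving snd L (ext_measure (reweight ?N h))"
  proof -
    have gg: "(\<lambda>u. ennreal (g u)) = case_sum (\<lambda>x. ennreal (h x)) (\<lambda>_. 1)"
      by (auto simp: g_def fun_eq_iff split: sum.split)
    have eq: "ext_measure (reweight ?N h) = reweight ?Y g"
      unfolding gg by (rule ext_measure_density) simp
    have "distr L ?Y snd = reweight (distr K ?Y snd) g"
      unfolding L_def w_def by (rule density_distr[symmetric]) measurable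
    also have "distr K ?Y snd = ?Y" using mp(2) by (simp add: measure_preserving_def)
    finally have d: "distr L ?Y snd = reweight ?Y g" .
    have "distr L (reweight ?Y g) snd = distr L ?Y snd" by (rule distr_cong) auto
    then show ?thesis unfolding measure_preserving_def eq using d fL by simp
  qed
  define n where "n = distr L ?X fst"
  have n: "emeasure n B = emeasure L (fst -` B \<inter> space K)" if "B \<in> sets ?X" for B
    unfolding n_def spL[symmetric] using fL(1) that by (rule emeasure_distr)
  have XK: "emeasure ?X B = emeasure K (fst -` B \<inter> space K)" if "B \<in> sets ?X" for B
  proof -
    have "emeasure (distr K ?X fst) B = emeasure K (fst -` B \<inter> space K)" using fm(1) that by (rule emeasure_distr)
    then show ?thesis using mp(1) by (simp add: measure_preserving_def)
  qed
  have nle: "emeasure n B \<le> emeasure ?X B" if B: "B \<in> sets ?X" for B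
    unfolding n[OF B] XK[OF B] L_def by (intro weight_emeasure_le[OF w] measurable_sets[OF fm(1) B])
  have sn: "sets n = sets ?X" by (simp add: n_def)
  obtain v' where v': "weight ?X v'" "n = reweight ?X v'"
    using dominated_density[OF sX sn nle] .
  \<comment> \<open>On the added line v' may fall below 1 and the first marginal stops being
    Lebesgue measure. Only its values on the original space are kept, so the conclusion is
    \<open>ext_preserving\<close>.\<close>
  define v where "v = (\<lambda>x. v' (Inl x))"
  have [measurable]: "v' \<in> borel_measurable ?X" using v' by (simp add: weight_def)
  have v: "weight ?M v"
    using v'(1) measurable_compose[OF measurable_Inl_ext[of ?M], of v' borel] by (auto simp: weight_def v_def)
  have nv: "emeasure n (Inl ` A) = emeasure (reweight ?M v) A" if A[measurable]: "A \<in> sets ?M" for A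
  proof -
    have [measurable]: "Inl ` A \<in> sets ?X" by (rule Inl_sets_ext[OF A])
    have "emeasure n (Inl ` A) = (\<integral>\<^sup>+u. ennreal (v' u) * indicator (Inl ` A) u \<partial>?X)"
      unfolding v'(2) by (rule emeasure_density) measurable
    also have "\<dots> = (\<integral>\<^sup>+x. ennreal (v' (Inl x)) * indicator (Inl ` A) (Inl x :: 'a + real) \<partial>?M)
        + (\<integral>\<^sup>+t. ennreal (v' (Inr t)) * indicator (Inl ` A) (Inr t :: 'a + real) \<partial>lborel)"
      by (rule nn_integral_ext_measure) measurable
    also have "(\<integral>\<^sup>+t. ennreal (v' (Inr t)) * indicator (Inl ` A) (Inr t :: 'a + real) \<partial>lborel) = (\<integral>\<^sup>+t. 0 \<partial>(lborel :: real measure))"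
      by (intro nn_integral_cong) (auto simp: indicator_def)
    also have "(\<integral>\<^sup>+x. ennreal (v' (Inl x)) * indicator (Inl ` A) (Inl x :: 'a + real) \<partial>?M) = (\<integral>\<^sup>+x. ennreal (v x) * indicator A x \<partial>?M)"
      by (intro nn_integral_cong) (auto simp: indicator_def v_def)
    also have "\<dots> = emeasure (reweight ?M v) A"
      using v A by (intro emeasure_density[symmetric]) (auto simp: weight_def)
    finally show ?thesis by simp
  qed
  have ep: "ext_preserving fst L (reweight ?M v)"
    unfolding ext_preserving_def
  proof (intro conjI ballI)
    have s: "sets (ext_measure (reweight ?M v)) = sets ?X" by (rule sets_ext_measure_cong) simp
    show "fst \<in> measurable L (ext_measure (reweight ?M v))"
      using fL(1) measurable_cong_sets[OF refl s] by blast
    fix A assume "A \<in> sets (reweight ?M v)"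
    then have A: "A \<in> sets ?M" by simp
    show "emeasure L (fst -` Inl ` A \<inter> space L) = emeasure (reweight ?M v) A"
      unfolding nv[OF A, symmetric] n[OF Inl_sets_ext[OF A]] spL ..
  qed
  have le: "emeasure ?M A \<le> emeasure (reweight ?M v) A + ennreal (e\<^sup>2)" if A: "A \<in> sets ?M" for A
  proof -
    let ?B = "fst -` (Inl ` A) \<inter> space K"
    have B: "?B \<in> sets K" by (rule measurable_sets[OF fm(1) Inl_sets_ext[OF A]])
    have "emeasure ?M A = emeasure K ?B"
      using XK[OF Inl_sets_ext[OF A]] by (simp add: emeasure_ext_Inl[OF A])
    also have "\<dots> = emeasure L ?B + (\<integral>\<^sup>+z. ennreal (1 - w z) * indicator ?B z \<partial>K)"
      unfolding L_def by (rule weight_emeasure_split[OF w B])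
    also have "\<dots> \<le> emeasure L ?B + (\<integral>\<^sup>+z. ennreal (1 - w z) \<partial>K)"
      by (intro add_left_mono nn_integral_mono) (simp add: indicator_def)
    also have "\<dots> \<le> emeasure L ?B + ennreal (e\<^sup>2)" by (intro add_left_mono wdef)
    also have "emeasure L ?B = emeasure (reweight ?M v) A"
      unfolding nv[OF A, symmetric] n[OF Inl_sets_ext[OF A]] ..
    finally show ?thesis .
  qed
  have "sigma_finite_measure (distr L ?X fst)"
    unfolding n_def[symmetric] by (rule sigma_finite_le[OF sX sn nle])
  then show ?thesis using that v sL rL mpL ep le b by blast
qed

section \<open>Symmetry\<close>

lemma coupling_swap:
  assumes "coupling M N K"
  shows "coupling N M (distr K (N \<Otimes>\<^sub>M M) prod.swap)"
    and "measure_preserving prod.swap K (distr K (N \<Otimes>\<^sub>M M) prod.swap)"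
proof -
  have s: "sets K = sets (M \<Otimes>\<^sub>M N)" using assms by (simp add: coupling_def)
  have "prod.swap = (\<lambda>(x, y). (y, x))" by (auto simp: fun_eq_iff)
  then have "prod.swap \<in> measurable (M \<Otimes>\<^sub>M N) (N \<Otimes>\<^sub>M M)"
    using measurable_pair_swap'[of M N] by metis
  then have sw: "prod.swap \<in> measurable K (N \<Otimes>\<^sub>M M)" using s by (simp cong: measurable_cong_sets)
  show "coupling N M (distr K (N \<Otimes>\<^sub>M M) prod.swap)"
    using assms sw by (simp add: coupling_def distr_distr comp_def)
  have "distr K (distr K (N \<Otimes>\<^sub>M M) prod.swap) prod.swap = distr K (N \<Otimes>\<^sub>M M) prod.swap"
    by (rule distr_cong) auto
  then show "measure_preserving prod.swap K (distr K (N \<Otimes>\<^sub>M M) prod.swap)"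
    using sw by (simp add: measure_preserving_def)
qed

lemma regular_coupling_diff:
  assumes G: "regular_graphex G" and H: "regular_graphex H"
    and K: "coupling (ext_measure (msp G)) (ext_measure (msp H)) K"
  shows "regular_graphex (pullback fst K (trivial_ext G))" "regular_graphex (pullback snd K (trivial_ext H))"
    "regular_graphex (coupling_diff G H K)"
proof -
  note mp = coupling_measure_preserving[OF K]
  have Kf: "sigma_finite_measure K"
    by (rule measure_preserving_sigma_finite[OF mp(1) sigma_finite_ext_measure[OF regular_graphexD(2)[OF G]]])
  show r: "regular_graphex (pullback fst K (trivial_ext G))" "regular_graphex (pullback snd K (trivial_ext H))"
    by (intro regular_graphex_pullback_ext measure_preserving_ext_preserving mp Kf G H)+
  show "regular_graphex (coupling_diff G H K)" by (rule regular_graphex_diff[OF r]) simp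
qed

lemma coupling_diff_swap:
  assumes G: "regular_graphex G" and H: "regular_graphex H"
    and K: "coupling (ext_measure (msp G)) (ext_measure (msp H)) K" and a: "a \<ge> 0"
    and b: "graphex_bound (coupling_diff G H K) a b r"
  obtains K' where "coupling (ext_measure (msp H)) (ext_measure (msp G)) K'" "graphex_bound (coupling_diff H G K') a b r"
proof -
  let ?K = "distr K (ext_measure (msp H) \<Otimes>\<^sub>M ext_measure (msp G)) prod.swap"
  note sw = coupling_swap[OF K]
  note R = regular_coupling_diff[OF G H K] and R' = regular_coupling_diff[OF H G sw(1)]
  have "graphex_bound (graphex_diff (pullback snd K (trivial_ext H)) (pullback fst K (trivial_ext G))) a b r"
    by (rule graphex_bound_diff_commute[OF R(1,2) _ b]) simp
  then have "graphex_bound (pullback prod.swap K (coupling_diff H G ?K)) a b r"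
    by (simp add: pullback_graphex_diff pullback_pullback)
  then have "graphex_bound (coupling_diff H G ?K) a b r"
    using graphex_bound_pullback_iff[OF R'(3) _ a, of prod.swap K] sw(2) by simp
  then show ?thesis using that sw(1) by blast
qed

text \<open>The infimum over couplings need not be attained, so a coupling within c is available
  only under a strict inequality; later estimates carry an extra e for this reason.\<close>

lemma delta22_less_obtain:
  assumes G: "regular_graphex G" and H: "regular_graphex H" and c: "delta22 G H < ereal c" "c \<ge> 0"
  obtains K where "coupling (ext_measure (msp G)) (ext_measure (msp H)) K"
    "graphex_bound (coupling_diff G H K) c (c\<^sup>2) (c^3)"
proof -
  obtain K where K: "coupling (ext_measure (msp G)) (ext_measure (msp H)) K"
    and d: "d22 (pullback fst K (trivial_ext G)) (pullback snd K (trivial_ext H)) < ereal c"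
    using c(1) by (auto simp: delta22_def coupling_dist22_def INF_less_iff)
  have "graphex_bound (coupling_diff G H K) c (c\<^sup>2) (c^3)"
    using d22_le_iff[OF regular_coupling_diff(1,2)[OF G H K] _ c(2)] less_imp_le[OF d] by simp
  then show ?thesis using that K by blast
qed

lemma delta22_le_coupling:
  assumes G: "regular_graphex G" and H: "regular_graphex H" and c: "c \<ge> 0"
    and K: "coupling (ext_measure (msp G)) (ext_measure (msp H)) K"
    and b: "graphex_bound (coupling_diff G H K) c (c\<^sup>2) (c^3)"
  shows "delta22 G H \<le> ereal c"
proof -
  have "d22 (pullback fst K (trivial_ext G)) (pullback snd K (trivial_ext H)) \<le> ereal c"
    using d22_le_iff[OF regular_coupling_diff(1,2)[OF G H K] _ c] b by simp
  then show ?thesis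
    unfolding delta22_def coupling_dist22_def using K by (intro INF_lower2[of K]) simp_all
qed

lemma d22_nonneg: "0 \<le> d22 G H"
proof -
  have "(0 :: ereal) \<le> ereal (sqrt (L2_norm (msp G) (\<lambda>x. marginal G x - marginal H x)))" by simp
  also have "\<dots> \<le> d22 G H" unfolding d22_def by (intro max.coboundedI2 max.coboundedI1 order_refl)
  finally show ?thesis .
qed

lemma delta22_nonneg: "0 \<le> delta22 G H"
  unfolding delta22_def coupling_dist22_def by (intro INF_greatest d22_nonneg)

lemma delta22_le_commute:
  assumes G: "regular_graphex G" and H: "regular_graphex H" and le: "delta22 G H \<le> ereal c"
  shows "delta22 H G \<le> ereal c"
proof (rule ereal_le_epsilon2)
  fix e :: real assume e: "e > 0"
  have c: "c \<ge> 0" using order_trans[OF delta22_nonneg le] by simp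
  have lt: "delta22 G H < ereal (c + e)" using le e by (simp add: le_less_trans)
  have ce: "c + e \<ge> 0" using c e by simp
  obtain K where K: "coupling (ext_measure (msp G)) (ext_measure (msp H)) K"
      "graphex_bound (coupling_diff G H K) (c + e) ((c + e)\<^sup>2) ((c + e)^3)"
    using delta22_less_obtain[OF G H lt ce] by blast
  obtain K' where "coupling (ext_measure (msp H)) (ext_measure (msp G)) K'"
      "graphex_bound (coupling_diff H G K') (c + e) ((c + e)\<^sup>2) ((c + e)^3)"
    using coupling_diff_swap[OF G H K(1) ce K(2)] by blast
  then show "delta22 H G \<le> ereal c + ereal e"
    using delta22_le_coupling[OF H G, of "c + e"] c e by simp
qed

section \<open>The triangle inequality\<close>

lemma ext_preserving_comp:
  assumes q: "measure_preserving q Z L" and p: "p \<in> measurable L (ext_measure M)"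
  shows "ext_preserving (\<lambda>z. p (q z)) Z M \<longleftrightarrow> ext_preserving p L M"
proof -
  have qm: "q \<in> measurable Z L" and qd: "distr Z L q = L" using q by (auto simp: measure_preserving_def)
  have "emeasure Z ((\<lambda>z. p (q z)) -` (Inl ` A) \<inter> space Z) = emeasure L (p -` (Inl ` A) \<inter> space L)"
    if A: "A \<in> sets M" for A
  proof -
    have "p -` (Inl ` A) \<inter> space L \<in> sets L" by (rule measurable_sets[OF p Inl_sets_ext[OF A]])
    then have "emeasure (distr Z L q) (p -` (Inl ` A) \<inter> space L) = emeasure Z (q -` (p -` (Inl ` A) \<inter> space L) \<inter> space Z)"
      by (rule emeasure_distr[OF qm])
    also have "q -` (p -` (Inl ` A) \<inter> space L) \<inter> space Z = (\<lambda>z. p (q z)) -` (Inl ` A) \<inter> space Z"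
      using measurable_space[OF qm] by auto
    finally show ?thesis unfolding qd ..
  qed
  then show ?thesis
    using p measurable_compose[OF qm p] by (simp add: ext_preserving_def)
qed

text \<open>The weight that takes h to min(h, h') is their quotient, and its defect under the
  measure with density h is the integral of h - min(h, h'), which is at most that of 1 - h'. So each
  coupling loses no more than the defect of the other weight.\<close>

lemma common_weight:
  assumes h: "weight M h" and h': "weight M h'"
    and defect: "(\<integral>\<^sup>+x. ennreal (1 - h' x) \<partial>M) \<le> ennreal r"
  obtains k where "weight (reweight M h) k"
    "reweight (reweight M h) k = density M (\<lambda>x. ennreal (min (h x) (h' x)))"
    "(\<integral>\<^sup>+x. ennreal (1 - k x) \<partial>reweight M h) \<le> ennreal r"
proof
  \<comment> \<open>Where h x = 0 the quotient is 0 by convention, and the minimum is 0 as well, so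
    h k = min(h, h') holds everywhere.\<close>
  define k where "k x = min (h x) (h' x) / h x" for x
  have [measurable]: "h \<in> borel_measurable M" "h' \<in> borel_measurable M" using h h' by (auto simp: weight_def)
  have [measurable]: "k \<in> borel_measurable M" unfolding k_def by measurable
  have h01: "0 \<le> h x" "h x \<le> 1" "0 \<le> h' x" "h' x \<le> 1" if "x \<in> space M" for x
    using h h' that by (auto simp: weight_def)
  have k01: "0 \<le> k x" "k x \<le> 1" if "x \<in> space M" for x
    using h01[OF that] by (auto simp: k_def divide_le_eq_1)
  show "weight (reweight M h) k" using k01 by (simp add: weight_def)
  have hk: "h x * k x = min (h x) (h' x)" if "x \<in> space M" for x
    using h01[OF that] by (cases "h x = 0") (auto simp: k_def)
  show "reweight (reweight M h) k = density M (\<lambda>x. ennreal (min (h x) (h' x)))"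
    using h01 k01 hk by (subst density_density_eq) (auto intro!: density_cong AE_I2 simp: ennreal_mult[symmetric])
  have "(\<integral>\<^sup>+x. ennreal (1 - k x) \<partial>reweight M h) = (\<integral>\<^sup>+x. ennreal (h x) * ennreal (1 - k x) \<partial>M)"
    by (rule nn_integral_density) measurable
  also have "\<dots> \<le> (\<integral>\<^sup>+x. ennreal (1 - h' x) \<partial>M)"
  proof (rule nn_integral_mono)
    fix x assume x: "x \<in> space M"
    have "h x * (1 - k x) = h x - min (h x) (h' x)" using hk[OF x] by (simp add: right_diff_distrib)
    also have "\<dots> \<le> 1 - h' x" using h01[OF x] by linarith
    finally show "ennreal (h x) * ennreal (1 - k x) \<le> ennreal (1 - h' x)"
      using h01[OF x] k01[OF x] by (simp add: ennreal_mult[symmetric] ennreal_leI)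
  qed
  finally show "(\<integral>\<^sup>+x. ennreal (1 - k x) \<partial>reweight M h) \<le> ennreal r"
    using defect by simp
qed

text \<open>On the space glued along cells all four pullbacks live together: the first outer
  graphex, two copies of the middle one, and the second outer graphex. The bounds are chained
  through the two copies, and the result is pushed forward to the outer coordinates, where it is a
  partial coupling.\<close>

lemma compose_couplings:
  fixes G :: "'a graphex" and H :: "'b graphex" and J :: "'c graphex"
  assumes H: "regular_graphex H"
    and L: "measure_preserving snd L (ext_measure (msp H))" "regular_graphex (pullback fst L (trivial_ext G))"
      "ext_preserving fst L (msp G)" "sigma_finite_measure (distr L (ext_measure (msp G)) fst)"
      "graphex_bound (coupling_diff G H L) a b r"
    and L': "measure_preserving snd L' (ext_measure (msp H))" "regular_graphex (pullback fst L' (trivial_ext J))"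
      "ext_preserving fst L' (msp J)"
      "graphex_bound (coupling_diff J H L') a' b' r'"
    and G: "regular_graphex G" and J: "regular_graphex J" and a: "a \<ge> 0" "a' \<ge> 0" and e: "e > 0"
  shows "delta22 G J \<le> ereal (max (a + a' + e) (max (sqrt (b + b' + e)) (root 3 (r + r'))))"
proof -
  define T where "T = trivial_ext H"
  let ?Y = "ext_measure (msp H)" and ?X = "ext_measure (msp G)" and ?X' = "ext_measure (msp J)"
  have T: "regular_graphex T" unfolding T_def by (rule regular_graphex_trivial_ext[OF H])
  note RT = regular_graphexD[OF T]
  have mT: "msp T = ?Y" by (simp add: T_def)
  have e2: "e / 2 > 0" using e by simp
  obtain c :: "'b + real \<Rightarrow> nat" and V v where c: "c \<in> measurable ?Y (count_space UNIV)"
    "\<And>j. emeasure ?Y {x \<in> space ?Y. c x = j} < \<infinity>"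
    "square_integrable (?Y \<Otimes>\<^sub>M ?Y) (step_fun c V)"
    "L2_norm (?Y \<Otimes>\<^sub>M ?Y) (\<lambda>z. (case z of (x, y) \<Rightarrow> graphon T x y) - step_fun c V z) \<le> e / 2"
    "square_integrable ?Y (\<lambda>x. v (c x))" "L2_norm ?Y (\<lambda>x. marginal T x - v (c x)) \<le> e / 2"
    using cell_approx[OF RT(2,4) regular_graphex_marginal(1)[OF T] e2, unfolded mT] by blast
  obtain Z where Z: "sets Z = sets (L \<Otimes>\<^sub>M L')" "measure_preserving fst Z L" "measure_preserving snd Z L'"
    "AE z in Z. c (snd (fst z)) = c (snd (snd z))"
    using glue_cells[OF RT(2)[unfolded mT] L(1) L'(1) c(1,2)] by blast
  have m1: "measure_preserving (\<lambda>z. snd (fst z)) Z ?Y" by (rule measure_preserving_comp[OF L(1) Z(2)])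
  have m2: "measure_preserving (\<lambda>z. snd (snd z)) Z ?Y" by (rule measure_preserving_comp[OF L'(1) Z(3)])
  let ?P = "pullback (\<lambda>z. fst (fst z)) Z (trivial_ext G)" and ?Q = "pullback (\<lambda>z. snd (fst z)) Z T"
    and ?Q' = "pullback (\<lambda>z. snd (snd z)) Z T" and ?P' = "pullback (\<lambda>z. fst (snd z)) Z (trivial_ext J)"
  have rQ: "regular_graphex ?Q" "regular_graphex ?Q'"
    using regular_graphex_pullback_iff[OF RT(1)] T m1 m2 by (auto simp: mT)
  have rP: "regular_graphex ?P"
    using regular_graphex_pullback_iff[OF regular_graphexD(1)[OF L(2)], of fst Z] Z(2) L(2)
    by (simp add: pullback_pullback)
  have rP': "regular_graphex ?P'"
    using regular_graphex_pullback_iff[OF regular_graphexD(1)[OF L'(2)], of snd Z] Z(3) L'(2)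
    by (simp add: pullback_pullback)
  have rsnd: "regular_graphex (pullback snd L T)" "regular_graphex (pullback snd L' T)"
    using regular_graphex_pullback_iff[OF RT(1)] T L(1) L'(1) by (auto simp: mT)
  have b1: "graphex_bound (graphex_diff ?P ?Q) a b r"
  proof -
    have "regular_graphex (coupling_diff G H L)" using L(2) rsnd(1) by (intro regular_graphex_diff) (simp_all add: T_def)
    from graphex_bound_pullback_iff[OF this _ a(1), of fst Z] L(5) Z(2) show ?thesis
      by (simp add: pullback_graphex_diff pullback_pullback T_def)
  qed
  have "graphex_bound (graphex_diff ?P' ?Q') a' b' r'"
  proof -
    have "regular_graphex (coupling_diff J H L')" using L'(2) rsnd(2) by (intro regular_graphex_diff) (simp_all add: T_def)
    from graphex_bound_pullback_iff[OF this _ a(2), of snd Z] L'(4) Z(3) show ?thesis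
      by (simp add: pullback_graphex_diff pullback_pullback T_def)
  qed
  then have b3: "graphex_bound (graphex_diff ?Q' ?P') a' b' r'"
    by (intro graphex_bound_diff_commute[OF rP' rQ(2)]) simp_all
  \<comment> \<open>The cells approximate within e / 2, and each of the two copies contributes one
    such error.\<close>
  have b2: "graphex_bound (graphex_diff ?Q ?Q') e e 0"
    using graphex_bound_same_cell[OF T, unfolded mT, OF m1 m2 c(1) Z(4) c(3-6)] by simp
  have "graphex_bound (graphex_diff ?P ?Q') (a + e) (b + e) (r + 0)"
    by (rule graphex_bound_diff_trans[OF rP rQ(1,2) _ _ b1 b2]) simp_all
  then have "graphex_bound (graphex_diff ?P ?P') (a + e + a') (b + e + b') (r + 0 + r')"
    by (intro graphex_bound_diff_trans[OF rP rQ(2) rP' _ _ _ b3]) simp_all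
  then have b4: "graphex_bound (graphex_diff ?P ?P') (a + a' + e) (b + b' + e) (r + r')"
    by (simp add: ac_simps)
  define f where "f = (\<lambda>z :: (('a + real) \<times> ('b + real)) \<times> (('c + real) \<times> ('b + real)). (fst (fst z), fst (snd z)))"
  have fL: "fst \<in> measurable L ?X" "fst \<in> measurable L' ?X'" using L(3) L'(3) by (auto simp: ext_preserving_def)
  have fZ: "fst \<in> measurable Z L" "snd \<in> measurable Z L'" using Z(2,3) by (auto simp: measure_preserving_def)
  have fm: "f \<in> measurable Z (?X \<Otimes>\<^sub>M ?X')"
    unfolding f_def by (intro measurable_Pair measurable_compose[OF fZ(1) fL(1)] measurable_compose[OF fZ(2) fL(2)])
  define Y where "Y = distr Z (?X \<Otimes>\<^sub>M ?X') f"
  have sY: "sets Y = sets (?X \<Otimes>\<^sub>M ?X')" by (simp add: Y_def)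
  have mf: "measure_preserving f Z Y"
  proof -
    have "distr Z Y f = distr Z (?X \<Otimes>\<^sub>M ?X') f" by (rule distr_cong) (auto simp: Y_def)
    then show ?thesis using fm by (simp add: measure_preserving_def Y_def)
  qed
  have pm: "fst \<in> measurable Y ?X" "snd \<in> measurable Y ?X'" using sY by (auto cong: measurable_cong_sets)
  have ep1: "ext_preserving fst Y (msp G)"
    using ext_preserving_comp[OF mf pm(1)] ext_preserving_comp[OF Z(2) fL(1)] L(3) by (simp add: f_def)
  have ep2: "ext_preserving snd Y (msp J)"
    using ext_preserving_comp[OF mf pm(2)] ext_preserving_comp[OF Z(3) fL(2)] L'(3) by (simp add: f_def)
  \<comment> \<open>An image of a sigma-finite measure need not be sigma-finite. Here it follows
    from the first marginal, which is the first marginal of \<open>L\<close>.\<close>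
  have Yf: "sigma_finite_measure Y"
  proof (rule sigma_finite_measure_distr[OF _ pm(1)])
    have "distr Y ?X fst = distr Z ?X (fst \<circ> f)" unfolding Y_def using fm by (intro distr_distr) auto
    also have "fst \<circ> f = fst \<circ> fst" by (auto simp: f_def)
    also have "distr Z ?X (fst \<circ> fst) = distr (distr Z L fst) ?X fst" using fZ fL by (intro distr_distr[symmetric]) auto
    also have "distr Z L fst = L" using Z(2) by (simp add: measure_preserving_def)
    finally show "sigma_finite_measure (distr Y ?X fst)" using L(4) by simp
  qed
  have "regular_graphex (coupling_diff G J Y)"
    by (intro regular_graphex_diff regular_graphex_pullback_ext ep1 ep2 Yf G J) simp
  moreover have "pullback f Z (coupling_diff G J Y) = graphex_diff ?P ?P'"
    by (simp add: pullback_graphex_diff pullback_pullback f_def)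
  moreover have "0 \<le> a + a' + e" using a e by simp
  ultimately have "graphex_bound (coupling_diff G J Y) (a + a' + e) (b + b' + e) (r + r')"
    using graphex_bound_pullback_iff[of "coupling_diff G J Y" f Z "a + a' + e"] mf b4 by simp
  then show ?thesis
    using delta22_le[OF G J Yf sY ep1 ep2] \<open>0 \<le> a + a' + e\<close> by blast
qed

lemma delta22_triangle_reweighted:
  fixes G :: "'a graphex" and H :: "'b graphex" and J :: "'c graphex"
  assumes G: "regular_graphex G" and J: "regular_graphex J"
    and h: "weight (msp H) h" "regular_graphex (H\<lparr>msp := reweight (msp H) h\<rparr>)"
      "(\<integral>\<^sup>+x. ennreal (1 - h x) \<partial>msp H) \<le> ennreal (c\<^sup>2)"
    and h': "weight (msp H) h'" "regular_graphex (H\<lparr>msp := reweight (msp H) h'\<rparr>)"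
      "(\<integral>\<^sup>+x. ennreal (1 - h' x) \<partial>msp H) \<le> ennreal (c'\<^sup>2)"
    and c: "c > 0" "c' > 0"
    and d: "delta22 G (H\<lparr>msp := reweight (msp H) h\<rparr>) < ereal c"
    and d': "delta22 (H\<lparr>msp := reweight (msp H) h'\<rparr>) J < ereal c'"
  obtains v v' where "weight (msp G) v" "weight (msp J) v'"
    "\<And>A. A \<in> sets (msp G) \<Longrightarrow> emeasure (msp G) A \<le> emeasure (reweight (msp G) v) A + ennreal (c'\<^sup>2)"
    "\<And>A. A \<in> sets (msp J) \<Longrightarrow> emeasure (msp J) A \<le> emeasure (reweight (msp J) v') A + ennreal (c\<^sup>2)"
    "delta22 (G\<lparr>msp := reweight (msp G) v\<rparr>) (J\<lparr>msp := reweight (msp J) v'\<rparr>) \<le> ereal (c + c')"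
proof -
  let ?N = "reweight (msp H) h" and ?N' = "reweight (msp H) h'"
  let ?N'' = "density (msp H) (\<lambda>x. ennreal (min (h x) (h' x)))"
  let ?H = "H\<lparr>msp := ?N\<rparr>" and ?H' = "H\<lparr>msp := ?N'\<rparr>" and ?H'' = "H\<lparr>msp := ?N''\<rparr>"
  have c0: "c \<ge> 0" "c' \<ge> 0" using c by auto
  obtain K where K: "coupling (ext_measure (msp G)) (ext_measure (msp ?H)) K"
    "graphex_bound (coupling_diff G ?H K) c (c\<^sup>2) (c^3)"
    using delta22_less_obtain[OF G h(2) d c0(1)] .
  obtain K0 where K0: "coupling (ext_measure (msp ?H')) (ext_measure (msp J)) K0"
    "graphex_bound (coupling_diff ?H' J K0) c' (c'\<^sup>2) (c'^3)"
    using delta22_less_obtain[OF h'(2) J d' c0(2)] .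
  obtain K' where K': "coupling (ext_measure (msp J)) (ext_measure (msp ?H')) K'"
    "graphex_bound (coupling_diff J ?H' K') c' (c'\<^sup>2) (c'^3)"
    using coupling_diff_swap[OF h'(2) J K0(1) c0(2) K0(2)] .
  obtain k where k: "weight ?N k" "reweight ?N k = ?N''" "(\<integral>\<^sup>+x. ennreal (1 - k x) \<partial>?N) \<le> ennreal (c'\<^sup>2)"
    using common_weight[OF h(1) h'(1) h'(3)] .
  obtain k' where k'0: "weight ?N' k'" "reweight ?N' k' = density (msp H) (\<lambda>x. ennreal (min (h' x) (h x)))"
    "(\<integral>\<^sup>+x. ennreal (1 - k' x) \<partial>?N') \<le> ennreal (c\<^sup>2)"
    using common_weight[OF h'(1) h(1) h(3)] .
  \<comment> \<open>Both reweightings end at the same middle measure, because the minimum is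
    symmetric; this is what makes the two new couplings composable.\<close>
  have k': "reweight ?N' k' = ?N''" unfolding k'0(2) by (simp add: min.commute)
  have mH: "msp ?H = ?N" "msp ?H' = ?N'" "msp ?H'' = ?N''" by simp_all
  obtain v L where L: "weight (msp G) v"
    "sigma_finite_measure (distr L (ext_measure (msp G)) fst)"
    "regular_graphex (pullback fst L (trivial_ext G))"
    "measure_preserving snd L (ext_measure (reweight (msp ?H) k))"
    "ext_preserving fst L (reweight (msp G) v)"
    "\<And>A. A \<in> sets (msp G) \<Longrightarrow> emeasure (msp G) A \<le> emeasure (reweight (msp G) v) A + ennreal (c'\<^sup>2)"
    "graphex_bound (coupling_diff G ?H L) c (c * (c + c')) (c * (c + c')\<^sup>2)"
    using reweight_coupling[OF G h(2) K(1) _ c0 _ K(2), of k] k(1,3) unfolding mH by metis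
  obtain v' L' where L': "weight (msp J) v'"
    "sigma_finite_measure (distr L' (ext_measure (msp J)) fst)"
    "regular_graphex (pullback fst L' (trivial_ext J))"
    "measure_preserving snd L' (ext_measure (reweight (msp ?H') k'))"
    "ext_preserving fst L' (reweight (msp J) v')"
    "\<And>A. A \<in> sets (msp J) \<Longrightarrow> emeasure (msp J) A \<le> emeasure (reweight (msp J) v') A + ennreal (c\<^sup>2)"
    "graphex_bound (coupling_diff J ?H' L') c' (c' * (c' + c)) (c' * (c' + c)\<^sup>2)"
    using reweight_coupling[OF J h'(2) K'(1) _ c0(2,1) _ K'(2), of k'] k'0(1,3) unfolding mH by metis
  let ?G = "G\<lparr>msp := reweight (msp G) v\<rparr>" and ?J = "J\<lparr>msp := reweight (msp J) v'\<rparr>"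
  have rG: "regular_graphex ?G" by (rule regular_graphex_weight[OF G L(1)])
  have rJ: "regular_graphex ?J" by (rule regular_graphex_weight[OF J L'(1)])
  have rH: "regular_graphex ?H''"
    using regular_graphex_weight[OF h(2), of k] k(1,2) by simp
  have s: "distr L (ext_measure (msp ?G)) fst = distr L (ext_measure (msp G)) fst"
    using sets_ext_measure_cong[of "msp ?G" "msp G"] by (intro distr_cong) simp_all
  have le: "delta22 ?G ?J \<le> ereal (max (c + c' + e) (max (sqrt (c * (c + c') + c' * (c' + c) + e)) (root 3 (c * (c + c')\<^sup>2 + c' * (c' + c)\<^sup>2))))"
    if "e > 0" for e
  proof (rule compose_couplings[OF rH _ _ _ _ _ _ _ _ _ rG rJ c0 that, where L = L and L' = L'])
    show "measure_preserving snd L (ext_measure (msp ?H''))" using L(4) k(2) by simp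
    show "measure_preserving snd L' (ext_measure (msp ?H''))" using L'(4) k' by simp
    show "sigma_finite_measure (distr L (ext_measure (msp ?G)) fst)" unfolding s by (rule L(2))
  qed (use L L' in simp_all)
  have "delta22 ?G ?J \<le> ereal (c + c')"
  proof (rule ereal_le_epsilon2)
    fix t :: real assume t: "t > 0"
    \<comment> \<open>The kernel component needs e \<le> t, the marginal component is compared under
      a square root and needs e \<le> t^2.\<close>
    define e where "e = min t (t\<^sup>2)"
    have e: "e > 0" "e \<le> t" "e \<le> t\<^sup>2" using t by (auto simp: e_def)
    have "c * (c + c') + c' * (c' + c) + e \<le> (c + c' + t)\<^sup>2"
    proof -
      have "(c + c' + t)\<^sup>2 = c * (c + c') + c' * (c' + c) + t\<^sup>2 + 2 * t * (c + c')"
        by (simp add: power2_eq_square algebra_simps)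
      moreover have "0 \<le> 2 * t * (c + c')" using t c0 by simp
      ultimately show ?thesis using e(3) by linarith
    qed
    then have "sqrt (c * (c + c') + c' * (c' + c) + e) \<le> c + c' + t"
      using t c0 by (intro real_le_lsqrt) auto
    moreover have "root 3 (c * (c + c')\<^sup>2 + c' * (c' + c)\<^sup>2) \<le> c + c' + t"
    proof -
      have "c * (c + c')\<^sup>2 + c' * (c' + c)\<^sup>2 = (c + c')^3"
        by (simp add: power2_eq_square power3_eq_cube algebra_simps)
      then show ?thesis using t c0 by (simp add: real_root_power_cancel)
    qed
    ultimately have "max (c + c' + e) (max (sqrt (c * (c + c') + c' * (c' + c) + e)) (root 3 (c * (c + c')\<^sup>2 + c' * (c' + c)\<^sup>2))) \<le> c + c' + t"
      using e(2) by (intro max.boundedI) auto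
    then have "delta22 ?G ?J \<le> ereal (c + c' + t)" using le[OF e(1)] order_trans ereal_less_eq(3) by blast
    then show "delta22 ?G ?J \<le> ereal (c + c') + ereal t" by simp
  qed
  then show ?thesis using that L(1,6) L'(1,6) by blast
qed

section \<open>Truncation to a regular graphex\<close>

lemma signed_graphex_measurable: "signed_graphex G \<Longrightarrow> measurable_graphex G"
  unfolding signed_graphex_def measurable_graphex_def by blast

text \<open>The bound is raised to a nonnegative number; on a null product space the essential
  supremum is -\<infinity>, and 0 serves.\<close>

lemma bounded_graphonD:
  assumes "bounded_graphon G"
  obtains C where "C \<ge> 0" "AE z in msp G \<Otimes>\<^sub>M msp G. \<bar>case z of (x, y) \<Rightarrow> graphon G x y\<bar> \<le> C"
proof -
  let ?s = "esssup (msp G \<Otimes>\<^sub>M msp G) (\<lambda>(x, y). ereal \<bar>graphon G x y\<bar>)"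
  obtain C where C: "?s \<le> ereal C" "C \<ge> 0"
  proof (cases ?s)
    case (real r)
    then show ?thesis using that[of "max r 0"] by simp
  next
    case PInf
    then show ?thesis using assms by (simp add: bounded_graphon_def)
  next
    case MInf
    then show ?thesis using that[of 0] by simp
  qed
  have "AE z in msp G \<Otimes>\<^sub>M msp G. (case z of (x, y) \<Rightarrow> ereal \<bar>graphon G x y\<bar>) \<le> ?s" by (rule esssup_AE)
  then have "AE z in msp G \<Otimes>\<^sub>M msp G. \<bar>case z of (x, y) \<Rightarrow> graphon G x y\<bar> \<le> C"
  proof eventually_elim
    case (elim z)
    then have "(case z of (x, y) \<Rightarrow> ereal \<bar>graphon G x y\<bar>) \<le> ereal C" using C(1) by (rule order_trans)
    then show ?case by (cases z) simp
  qed
  then show ?thesis using that C(2) by blast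
qed

text \<open>Equality for integrable functions; otherwise the left integral defaults to 0. So
  pointwise bounds on rows need no integrability of the row.\<close>

lemma ennreal_integral_le:
  assumes "\<And>x. 0 \<le> f x"
  shows "ennreal (integral\<^sup>L M f) \<le> (\<integral>\<^sup>+x. ennreal (f x) \<partial>M)"
proof (cases "integrable M f")
  case True
  then show ?thesis using nn_integral_eq_integral[of M f] assms by simp
next
  case False
  then show ?thesis by (simp add: not_integrable_integral_eq)
qed

text \<open>On the finite-measure complement of the set in the definition of a signed graphex, almost
  every point has finite marginal, so bounding the marginal there costs little measure; after that
  the graphex is integrable and a second truncation of the marginal makes it bounded.\<close>

lemma regular_truncation:
  fixes G :: "'a graphex"
  assumes G: "signed_graphex G" and bd: "bounded_graphon G" and r: "r > 0"
  obtains N where "measure_within (msp G) r N" "graphex_L1_L2 (G\<lparr>msp := N\<rparr>)"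
proof -
  define M where "M = msp G"
  define W where "W = graphon G"
  define S where "S = star G"
  note m = signed_graphex_measurable[OF G]
  note D = measurable_graphexD[OF m, folded M_def W_def S_def]
  interpret sigma_finite_measure M using D(1) .
  interpret pair_sigma_finite M M by unfold_locales
  let ?P = "M \<Otimes>\<^sub>M M"
  note [measurable] = D(2,4)
  obtain A where A[measurable]: "A \<in> sets M" and Afin: "emeasure M (space M - A) < \<infinity>"
    and Aint: "(\<integral>\<^sup>+(x, y)\<in>A \<times> A. ennreal \<bar>W x y\<bar> \<partial>?P) + 2 * (\<integral>\<^sup>+x\<in>A. ennreal \<bar>S x\<bar> \<partial>M) + 2 * ennreal \<bar>iso G\<bar> < \<infinity>"
    using G unfolding signed_graphex_def M_def W_def S_def by blast
  have AW: "(\<integral>\<^sup>+(x, y)\<in>A \<times> A. ennreal \<bar>W x y\<bar> \<partial>?P) < \<infinity>" and AS: "(\<integral>\<^sup>+x\<in>A. ennreal \<bar>S x\<bar> \<partial>M) < \<infinity>"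
    using Aint by (auto simp: ennreal_mult_less_top)
  have AEint: "AE x in M. integrable M (\<lambda>y. W y x)"
    using G unfolding signed_graphex_def M_def W_def by blast
  obtain C where C: "C \<ge> 0" "AE z in ?P. \<bar>case z of (x, y) \<Rightarrow> W x y\<bar> \<le> C"
    using bounded_graphonD[OF bd] unfolding M_def W_def by blast
  define F where "F = (\<lambda>z. ennreal \<bar>case z of (x, y) \<Rightarrow> W x y\<bar>)"
  have F[measurable]: "F \<in> borel_measurable ?P" unfolding F_def by measurable
  define d where "d x = (\<integral>\<^sup>+y. F (x, y) \<partial>M)" for x
  have d[measurable]: "d \<in> borel_measurable M" unfolding d_def by measurable
  have Fsym: "F (x, y) = F (y, x)" if "x \<in> space M" "y \<in> space M" for x y
    using D(3)[OF that] by (simp add: F_def)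
  have dfin: "AE x in M. d x < \<infinity>"
    using AEint AE_space
  proof eventually_elim
    case (elim x)
    have "d x = (\<integral>\<^sup>+y. ennreal (norm (W y x)) \<partial>M)"
      unfolding d_def using Fsym elim by (intro nn_integral_cong) (simp add: F_def)
    then show ?case using elim(1) by (simp add: integrable_iff_bounded)
  qed
  have d': "(\<integral>\<^sup>+x. F (x, y) \<partial>M) = d y" if "y \<in> space M" for y
    unfolding d_def using Fsym that by (intro nn_integral_cong) simp
  define B where "B = (\<lambda>n :: nat. {x \<in> space M - A. d x \<le> of_nat n \<and> ennreal \<bar>S x\<bar> \<le> of_nat n})"
  have B[measurable]: "B n \<in> sets M" for n unfolding B_def by measurable
  have cA[measurable]: "space M - A \<in> sets M" by simp
  have "(\<lambda>n. emeasure M (space M - A - B n)) \<longlonglongrightarrow> emeasure M (\<Inter>n. space M - A - B n)"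
  proof (rule Lim_emeasure_decseq)
    show "decseq (\<lambda>n. space M - A - B n)"
      unfolding decseq_def B_def using order_trans[OF _ of_nat_mono[where 'a=ennreal]] by blast
    show "emeasure M (space M - A - B n) \<noteq> \<infinity>" for n
      using emeasure_mono[of "space M - A - B n" "space M - A" M] Afin by (auto simp: top_unique)
  qed auto
  moreover have "emeasure M (\<Inter>n. space M - A - B n) = 0"
  proof -
    have "AE x in M. x \<notin> (\<Inter>n. space M - A - B n)"
      using dfin
    proof eventually_elim
      case (elim x)
      then have "max (d x) (ennreal \<bar>S x\<bar>) < \<infinity>" by simp
      then obtain n where "max (d x) (ennreal \<bar>S x\<bar>) \<le> of_nat n"
        using ennreal_Ex_less_of_nat[of "max (d x) (ennreal \<bar>S x\<bar>)"] less_imp_le by (metis infinity_ennreal_def)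
      then have "d x \<le> of_nat n" "ennreal \<bar>S x\<bar> \<le> of_nat n" by simp_all
      then show ?case unfolding B_def by blast
    qed
    moreover have "(\<Inter>n. space M - A - B n) \<in> sets M" by measurable
    ultimately show ?thesis using AE_iff_null_sets by blast
  qed
  ultimately have "(\<lambda>n. emeasure M (space M - A - B n)) \<longlonglongrightarrow> 0" by simp
  then have "eventually (\<lambda>n. emeasure M (space M - A - B n) < ennreal (r / 2)) sequentially"
    using r by (intro order_tendstoD) auto
  then obtain n where n: "emeasure M (space M - A - B n) < ennreal (r / 2)" by (auto simp: eventually_sequentially)
  have Bfin: "emeasure M (B n) < \<infinity>"
  proof -
    have "emeasure M (B n) \<le> emeasure M (space M - A)" by (intro emeasure_mono) (auto simp: B_def)
    then show ?thesis using Afin by (rule le_less_trans)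
  qed
  define A1 where "A1 = A \<union> B n"
  have A1[measurable]: "A1 \<in> sets M" unfolding A1_def by measurable
  have nB: "of_nat n * emeasure M (B n) < \<infinity>" using Bfin by (simp add: ennreal_mult_less_top of_nat_less_top)
  have FB: "(\<integral>\<^sup>+x. d x * indicator (B n) x \<partial>M) \<le> of_nat n * emeasure M (B n)"
  proof -
    have "(\<integral>\<^sup>+x. d x * indicator (B n) x \<partial>M) \<le> (\<integral>\<^sup>+x. of_nat n * indicator (B n) x \<partial>M)"
      by (intro nn_integral_mono) (auto simp: B_def indicator_def)
    then show ?thesis by (simp add: nn_integral_cmult_indicator)
  qed
  have Ffst: "(\<integral>\<^sup>+z. F z * indicator (B n) (fst z) \<partial>?P) = (\<integral>\<^sup>+x. d x * indicator (B n) x \<partial>M)"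
  proof -
    have "(\<integral>\<^sup>+z. F z * indicator (B n) (fst z) \<partial>?P) = (\<integral>\<^sup>+x. \<integral>\<^sup>+y. F (x, y) * indicator (B n) (fst (x, y)) \<partial>M \<partial>M)"
      by (rule sigma_finite_measure.nn_integral_fst[OF D(1), of "\<lambda>z. F z * indicator (B n) (fst z)" M, symmetric]) measurable
    also have "\<dots> = (\<integral>\<^sup>+x. d x * indicator (B n) x \<partial>M)"
      by (intro nn_integral_cong) (simp add: d_def nn_integral_multc)
    finally show ?thesis .
  qed
  have Fsnd: "(\<integral>\<^sup>+z. F z * indicator (B n) (snd z) \<partial>?P) = (\<integral>\<^sup>+y. d y * indicator (B n) y \<partial>M)"
  proof -
    have "(\<integral>\<^sup>+z. F z * indicator (B n) (snd z) \<partial>?P) = (\<integral>\<^sup>+y. \<integral>\<^sup>+x. F (x, y) * indicator (B n) (snd (x, y)) \<partial>M \<partial>M)"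
      by (rule nn_integral_snd[of "\<lambda>z. F z * indicator (B n) (snd z)", symmetric]) measurable
    also have "\<dots> = (\<integral>\<^sup>+y. d y * indicator (B n) y \<partial>M)"
      by (intro nn_integral_cong) (simp add: d' nn_integral_multc)
    finally show ?thesis .
  qed
  \<comment> \<open>A1 x A1 lies in A x A together with the two strips over \<open>B n\<close>. On
    \<open>B n\<close> the row integral \<open>d\<close> is at most n, so each strip carries at most
    n times the finite measure of \<open>B n\<close>.\<close>
  have F1: "(\<integral>\<^sup>+z. F z * indicator (A1 \<times> A1) z \<partial>?P) < \<infinity>"
  proof -
    have "(\<integral>\<^sup>+z. F z * indicator (A1 \<times> A1) z \<partial>?P) \<le>
      (\<integral>\<^sup>+z. F z * indicator (A \<times> A) z + (F z * indicator (B n) (fst z) + F z * indicator (B n) (snd z)) \<partial>?P)"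
      by (intro nn_integral_mono) (auto simp: A1_def indicator_def)
    also have "\<dots> = (\<integral>\<^sup>+z. F z * indicator (A \<times> A) z \<partial>?P) + ((\<integral>\<^sup>+z. F z * indicator (B n) (fst z) \<partial>?P) + (\<integral>\<^sup>+z. F z * indicator (B n) (snd z) \<partial>?P))"
      by (simp add: nn_integral_add)
    also have "(\<integral>\<^sup>+z. F z * indicator (A \<times> A) z \<partial>?P) = (\<integral>\<^sup>+(x, y)\<in>A \<times> A. ennreal \<bar>W x y\<bar> \<partial>?P)"
      by (intro nn_integral_cong) (auto simp: F_def split: prod.split)
    also have "(\<integral>\<^sup>+z. F z * indicator (B n) (fst z) \<partial>?P) = (\<integral>\<^sup>+x. d x * indicator (B n) x \<partial>M)"
      by (rule Ffst)
    also have "(\<integral>\<^sup>+z. F z * indicator (B n) (snd z) \<partial>?P) = (\<integral>\<^sup>+y. d y * indicator (B n) y \<partial>M)"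
      by (rule Fsnd)
    finally show ?thesis using AW FB nB by (auto simp: less_top[symmetric] top_unique intro: le_less_trans)
  qed
  have S1: "(\<integral>\<^sup>+x. ennreal \<bar>S x\<bar> * indicator A1 x \<partial>M) < \<infinity>"
  proof -
    have "(\<integral>\<^sup>+x. ennreal \<bar>S x\<bar> * indicator A1 x \<partial>M) \<le> (\<integral>\<^sup>+x. ennreal \<bar>S x\<bar> * indicator A x + of_nat n * indicator (B n) x \<partial>M)"
      by (intro nn_integral_mono) (auto simp: A1_def indicator_def B_def)
    also have "\<dots> = (\<integral>\<^sup>+x\<in>A. ennreal \<bar>S x\<bar> \<partial>M) + of_nat n * emeasure M (B n)"
      by (subst nn_integral_add) (auto simp: nn_integral_cmult_indicator)
    finally show ?thesis using AS nB by (auto simp: less_top[symmetric] top_unique)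
  qed
  \<comment> \<open>The absolute marginal with the second variable restricted to \<open>A1\<close>.
    It dominates the one restricted to \<open>A2\<close>, so the cut that defines \<open>A2\<close>
    remains valid for the smaller measure.\<close>
  define E where "E x = (\<integral>\<^sup>+y. F (x, y) * indicator A1 y \<partial>M) + ennreal \<bar>S x\<bar>" for x
  have E[measurable]: "E \<in> borel_measurable M" unfolding E_def by measurable
  have E1: "(\<integral>\<^sup>+x. E x * indicator A1 x \<partial>M) < \<infinity>"
  proof -
    have "(\<integral>\<^sup>+z. F z * indicator (A1 \<times> A1) z \<partial>?P) = (\<integral>\<^sup>+x. (\<integral>\<^sup>+y. F (x, y) * indicator A1 y \<partial>M) * indicator A1 x \<partial>M)"
    proof -
      have "(\<integral>\<^sup>+z. F z * indicator (A1 \<times> A1) z \<partial>?P) = (\<integral>\<^sup>+x. (\<integral>\<^sup>+y. F (x, y) * indicator (A1 \<times> A1) (x, y) \<partial>M) \<partial>M)"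
        by (rule sigma_finite_measure.nn_integral_fst[OF D(1), of "\<lambda>z. F z * indicator (A1 \<times> A1) z" M, symmetric]) measurable
      also have "\<dots> = (\<integral>\<^sup>+x. (\<integral>\<^sup>+y. F (x, y) * indicator A1 y \<partial>M) * indicator A1 x \<partial>M)"
        by (intro nn_integral_cong) (simp add: indicator_def)
      finally show ?thesis .
    qed
    moreover have "(\<integral>\<^sup>+x. E x * indicator A1 x \<partial>M) = (\<integral>\<^sup>+x. (\<integral>\<^sup>+y. F (x, y) * indicator A1 y \<partial>M) * indicator A1 x \<partial>M)
        + (\<integral>\<^sup>+x. ennreal \<bar>S x\<bar> * indicator A1 x \<partial>M)"
      unfolding E_def distrib_right by (rule nn_integral_add) measurable
    ultimately show ?thesis using F1 S1 by simp
  qed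
  define e where "e = enn2real (\<integral>\<^sup>+x. E x * indicator A1 x \<partial>M)"
  have e: "(\<integral>\<^sup>+x. E x * indicator A1 x \<partial>M) = ennreal e" "e \<ge> 0"
    using E1 by (simp_all add: e_def less_top[symmetric])
  \<comment> \<open>By Markov's inequality the cut at height k removes measure at most e / k, which
    is at most r / 2; the added 1 keeps k positive when e = 0.\<close>
  define k where "k = 2 * (e + 1) / r"
  have k: "k > 0" using e r by (simp add: k_def)
  define A2 where "A2 = {x \<in> A1. E x \<le> ennreal k}"
  have A2eq: "A2 = {x \<in> space M. x \<in> A1 \<and> E x \<le> ennreal k}" using sets.sets_into_space[OF A1] by (auto simp: A2_def)
  have A2[measurable]: "A2 \<in> sets M" unfolding A2eq by measurable
  have A12: "emeasure M (A1 - A2) \<le> ennreal (r / 2)"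
  proof -
    have "ennreal k * emeasure M (A1 - A2) = (\<integral>\<^sup>+x. ennreal k * indicator (A1 - A2) x \<partial>M)"
      by (simp add: nn_integral_cmult_indicator)
    also have "\<dots> \<le> (\<integral>\<^sup>+x. E x * indicator A1 x \<partial>M)"
      by (intro nn_integral_mono) (auto simp: A2_def indicator_def)
    finally have le: "ennreal k * emeasure M (A1 - A2) \<le> ennreal e" unfolding e .
    have "ennreal (1 / k) * (ennreal k * emeasure M (A1 - A2)) \<le> ennreal (1 / k) * ennreal e"
      using le by (rule mult_left_mono) simp
    moreover have "ennreal (1 / k) * (ennreal k * emeasure M (A1 - A2)) = emeasure M (A1 - A2)"
      unfolding mult.assoc[symmetric] using k by (simp add: ennreal_mult[symmetric])
    moreover have "ennreal (1 / k) * ennreal e = ennreal (e / k)" using k e by (simp add: ennreal_mult[symmetric])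
    moreover have "e / k \<le> r / 2" using e r by (simp add: k_def field_simps)
    ultimately show ?thesis by (metis ennreal_leI order_trans)
  qed
  define w where "w = (indicator A2 :: 'a \<Rightarrow> real)"
  have w: "weight M w" unfolding w_def by (rule weight_indicator[OF A2])
  define N where "N = reweight M w"
  have Nem: "emeasure N X = emeasure M (A2 \<inter> X)" if "X \<in> sets M" for X
    unfolding N_def w_def by (rule emeasure_density_indicator[OF A2 that])
  have within: "measure_within (msp G) r N"
    unfolding measure_within_iff M_def[symmetric]
  proof (intro conjI ballI)
    show "sets N = sets M" by (simp add: N_def)
    fix X assume X: "X \<in> sets M"
    then show "emeasure N X \<le> emeasure M X" unfolding Nem[OF X] by (intro emeasure_mono) auto
    \<comment> \<open>What is removed lies either in \<open>A1 - A2\<close> or outside both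
      \<open>A\<close> and \<open>B n\<close>; each of the two sets accounts for r / 2.\<close>
    have "X \<subseteq> (A2 \<inter> X) \<union> ((A1 - A2) \<union> (space M - A - B n))"
      using sets.sets_into_space[OF X] by (auto simp: A1_def)
    then have "emeasure M X \<le> emeasure M ((A2 \<inter> X) \<union> ((A1 - A2) \<union> (space M - A - B n)))"
      using X by (intro emeasure_mono) auto
    also have "\<dots> \<le> emeasure M (A2 \<inter> X) + emeasure M ((A1 - A2) \<union> (space M - A - B n))"
      using X by (intro emeasure_subadditive) auto
    also have "\<dots> \<le> emeasure M (A2 \<inter> X) + (emeasure M (A1 - A2) + emeasure M (space M - A - B n))"
      by (intro add_left_mono emeasure_subadditive) auto
    also have "\<dots> \<le> emeasure M (A2 \<inter> X) + (ennreal (r / 2) + ennreal (r / 2))"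
      using n A12 by (intro add_left_mono add_mono) auto
    also have "ennreal (r / 2) + ennreal (r / 2) = ennreal r" using r by (simp add: ennreal_plus[symmetric] del: ennreal_plus)
    finally show "emeasure M X \<le> emeasure N X + ennreal r" unfolding Nem[OF X] .
  qed
  let ?H = "G\<lparr>msp := N\<rparr>"
  have mH: "measurable_graphex ?H"
    using measurable_graphex_weight[OF m, of w] w unfolding N_def M_def by simp
  have msH: "msp ?H = N" by simp
  have NN: "N \<Otimes>\<^sub>M N = reweight ?P (indicator (A2 \<times> A2))"
    unfolding N_def w_def by (rule density_indicator_pair[OF D(1) A2])
  have sub: "A2 \<subseteq> A1" by (auto simp: A2_def)
  have Wint: "integrable (N \<Otimes>\<^sub>M N) (\<lambda>(x, y). W x y)"
  proof (rule integrableI_bounded)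
    show "(\<lambda>(x, y). W x y) \<in> borel_measurable (N \<Otimes>\<^sub>M N)" unfolding NN using D(2) by simp
    have "(\<integral>\<^sup>+z. ennreal (norm (case z of (x, y) \<Rightarrow> W x y)) \<partial>(N \<Otimes>\<^sub>M N)) = (\<integral>\<^sup>+z. ennreal (indicator (A2 \<times> A2) z) * F z \<partial>?P)"
      unfolding NN F_def by (subst nn_integral_density) auto
    also have "\<dots> \<le> (\<integral>\<^sup>+z. F z * indicator (A1 \<times> A1) z \<partial>?P)"
      using sub by (intro nn_integral_mono) (auto simp: indicator_def)
    finally show "(\<integral>\<^sup>+z. ennreal (norm (case z of (x, y) \<Rightarrow> W x y)) \<partial>(N \<Otimes>\<^sub>M N)) < \<infinity>"
      using F1 by (rule le_less_trans)
  qed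
  have WL: "L1_L2 (N \<Otimes>\<^sub>M N) (\<lambda>(x, y). W x y)"
  proof (rule L1_L2_bounded[OF Wint])
    show "AE z in N \<Otimes>\<^sub>M N. \<bar>case z of (x, y) \<Rightarrow> W x y\<bar> \<le> C"
      unfolding NN using A2 by (intro weight_AE_density[OF weight_indicator C(2)]) simp
  qed
  have Sint: "integrable N S"
  proof (rule integrableI_bounded)
    show "S \<in> borel_measurable N" unfolding N_def using D(4) by simp
    have "(\<integral>\<^sup>+x. ennreal (norm (S x)) \<partial>N) = (\<integral>\<^sup>+x. ennreal (indicator A2 x) * ennreal \<bar>S x\<bar> \<partial>M)"
      unfolding N_def w_def by (subst nn_integral_density) auto
    also have "\<dots> \<le> (\<integral>\<^sup>+x. ennreal \<bar>S x\<bar> * indicator A1 x \<partial>M)"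
      using sub by (intro nn_integral_mono) (auto simp: indicator_def)
    finally show "(\<integral>\<^sup>+x. ennreal (norm (S x)) \<partial>N) < \<infinity>" using S1 by (rule le_less_trans)
  qed
  have DL: "L1_L2 N (\<lambda>x. abs_row ?H x + \<bar>S x\<bar>)"
  proof (rule L1_L2_bounded)
    interpret N: sigma_finite_measure N using measurable_graphexD(1)[OF mH] by simp
    interpret PN: pair_sigma_finite N N by unfold_locales
    have "integrable (N \<Otimes>\<^sub>M N) (\<lambda>(x, y). \<bar>W x y\<bar>)"
      using integrable_abs[OF Wint] by (simp add: split_beta')
    from PN.integrable_fst'[OF this] have "integrable N (abs_row ?H)"
      unfolding abs_row_def W_def by simp
    then show "integrable N (\<lambda>x. abs_row ?H x + \<bar>S x\<bar>)" using Sint by simp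
    have "AE x in N. x \<in> A2" unfolding N_def w_def by (subst AE_density) (auto simp: indicator_def)
    then show "AE x in N. \<bar>abs_row ?H x + \<bar>S x\<bar>\<bar> \<le> k"
      using AE_space
    proof eventually_elim
      case (elim x)
      then have x: "x \<in> space M" by (simp add: N_def)
      have [measurable]: "(\<lambda>y. W x y) \<in> borel_measurable M" using x by measurable
      have "ennreal (abs_row ?H x) \<le> (\<integral>\<^sup>+y. ennreal \<bar>W x y\<bar> \<partial>N)"
        using ennreal_integral_le[of "\<lambda>y. \<bar>W x y\<bar>" N] by (simp add: abs_row_def W_def)
      also have "\<dots> = (\<integral>\<^sup>+y. ennreal (indicator A2 y) * ennreal \<bar>W x y\<bar> \<partial>M)"
        unfolding N_def w_def by (subst nn_integral_density) auto
      also have "\<dots> \<le> (\<integral>\<^sup>+y. F (x, y) * indicator A1 y \<partial>M)"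
        using sub by (intro nn_integral_mono) (auto simp: indicator_def F_def)
      finally have "ennreal (abs_row ?H x) + ennreal \<bar>S x\<bar> \<le> E x" unfolding E_def by (rule add_right_mono)
      also have "\<dots> \<le> ennreal k" using elim(1) by (simp add: A2_def)
      finally have "ennreal (abs_row ?H x + \<bar>S x\<bar>) \<le> ennreal k" by simp
      then have "abs_row ?H x + \<bar>S x\<bar> \<le> k" using k by (simp only: ennreal_le_iff less_imp_le)
      then show ?case by simp
    qed
  qed
  have "graphex_L1_L2 ?H"
    using WL DL unfolding graphex_L1_L2_def marginal_abs_graphex[abs_def] W_def S_def by simp
  then show ?thesis by (rule that[OF within])
qed

section \<open>The weak kernel distance\<close>

lemma measure_within_weight:
  assumes M: "sigma_finite_measure M" and N: "measure_within M r N"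
  obtains w where "weight M w" "N = reweight M w" "(\<integral>\<^sup>+x. ennreal (1 - w x) \<partial>M) \<le> ennreal r"
proof -
  have s: "sets N = sets M" and le: "\<And>A. A \<in> sets M \<Longrightarrow> emeasure N A \<le> emeasure M A"
    using N by (auto simp: measure_within_iff)
  obtain w where w: "weight M w" "N = reweight M w"
    using dominated_density[OF M s le] .
  show ?thesis
    using that[OF w] weight_defect_le[OF M w(1)] N w(2) by simp
qed

lemma measure_within_regular:
  assumes "measurable_graphex G" "measure_within (msp G) r N" "graphex_L1_L2 (G\<lparr>msp := N\<rparr>)"
  shows "regular_graphex (G\<lparr>msp := N\<rparr>)"
proof -
  obtain w where "weight (msp G) w" "N = reweight (msp G) w"
    using measure_within_weight[OF measurable_graphexD(1)[OF assms(1)] assms(2)] .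
  then show ?thesis
    using measurable_graphex_weight[OF assms(1)] assms(3) by (intro regular_graphexI) simp_all
qed

definition admissible :: "'a graphex \<Rightarrow> 'b graphex \<Rightarrow> real set" where
  "admissible G H = {c. \<exists>M N. measure_within (msp G) (c\<^sup>2) M \<and> measure_within (msp H) (c\<^sup>2) N \<and>
     graphex_L1_L2 (G\<lparr>msp := M\<rparr>) \<and> graphex_L1_L2 (H\<lparr>msp := N\<rparr>) \<and>
     delta22 (G\<lparr>msp := M\<rparr>) (H\<lparr>msp := N\<rparr>) \<le> ereal c}"

lemma delta_diamond_admissible: "delta_diamond G H = Inf (ereal ` admissible G H)"
  by (simp add: delta_diamond_def admissible_def)

text \<open>The measures are constrained by c^2 only, which is blind to the sign; nonnegativity
  comes from the bound on \<open>delta22\<close>.\<close>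

lemma admissible_nonneg: "c \<in> admissible G H \<Longrightarrow> 0 \<le> c"
  using order_trans[OF delta22_nonneg] by (fastforce simp: admissible_def)

lemma delta_diamond_nonneg: "0 \<le> delta_diamond G H"
  unfolding delta_diamond_admissible by (intro INF_greatest) (simp add: admissible_nonneg)

lemma admissible_commute_subset:
  assumes G: "measurable_graphex G" and H: "measurable_graphex H"
  shows "admissible G H \<subseteq> admissible H G"
proof
  fix c assume "c \<in> admissible G H"
  then obtain M N where *: "measure_within (msp G) (c\<^sup>2) M" "measure_within (msp H) (c\<^sup>2) N"
     "graphex_L1_L2 (G\<lparr>msp := M\<rparr>)" "graphex_L1_L2 (H\<lparr>msp := N\<rparr>)"
     "delta22 (G\<lparr>msp := M\<rparr>) (H\<lparr>msp := N\<rparr>) \<le> ereal c" by (auto simp: admissible_def)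
  have "delta22 (H\<lparr>msp := N\<rparr>) (G\<lparr>msp := M\<rparr>) \<le> ereal c"
    by (rule delta22_le_commute[OF measure_within_regular[OF G *(1,3)] measure_within_regular[OF H *(2,4)] *(5)])
  with * show "c \<in> admissible H G" unfolding admissible_def by blast
qed

text \<open>Under the diagonal coupling: pulled back along x \<mapsto> (x, x), the difference of the
  two copies is identically 0.\<close>

lemma delta22_self:
  assumes G: "regular_graphex G"
  shows "delta22 G G \<le> 0"
proof -
  let ?X = "ext_measure (msp G)"
  let ?K = "distr ?X (?X \<Otimes>\<^sub>M ?X) (\<lambda>x. (x, x))"
  have m: "(\<lambda>x. (x, x)) \<in> measurable ?X (?X \<Otimes>\<^sub>M ?X)" by measurable
  have K: "coupling ?X ?X ?K"
    using m by (simp add: coupling_def distr_distr comp_def)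
  have mp: "measure_preserving (\<lambda>x. (x, x)) ?X ?K"
  proof -
    have "distr ?X ?K (\<lambda>x. (x, x)) = ?K" by (rule distr_cong) auto
    then show ?thesis using m by (simp add: measure_preserving_def)
  qed
  have 0: "marginal (pullback (\<lambda>x. (x, x)) ?X (coupling_diff G G ?K)) = (\<lambda>_. 0)"
    by (simp add: marginal_def fun_eq_iff)
  have "graphex_bound (pullback (\<lambda>x. (x, x)) ?X (coupling_diff G G ?K)) 0 0 0"
    unfolding graphex_bound_def 0 by (simp add: kernel_le_def L2_norm_def rho_def split_beta')
  then have "graphex_bound (coupling_diff G G ?K) 0 0 0"
    using graphex_bound_pullback_iff[OF regular_coupling_diff(3)[OF G G K] _ order_refl, of "\<lambda>x. (x, x)" ?X] mp by simp
  then show ?thesis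
    using delta22_le_coupling[OF G G order_refl K] by (simp add: zero_ereal_def)
qed

text \<open>Each original space is coupled by a product measure with a unit interval of the other
  added line. Length 1 gives the right marginals on the original spaces, and the three bounds of a
  regular difference are finite.\<close>

lemma delta22_finite:
  fixes G :: "'a graphex" and H :: "'b graphex"
  assumes G: "regular_graphex G" and H: "regular_graphex H"
  obtains c where "delta22 G H \<le> ereal c"
proof -
  let ?M = "msp G" and ?N = "msp H"
  let ?X = "ext_measure ?M" and ?Y = "ext_measure ?N"
  interpret X: sigma_finite_measure ?X by (rule sigma_finite_ext_measure[OF regular_graphexD(2)[OF G]])
  interpret Y: sigma_finite_measure ?Y by (rule sigma_finite_ext_measure[OF regular_graphexD(2)[OF H]])
  interpret pair_sigma_finite ?X ?Y by unfold_locales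
  have XY: "sigma_finite_measure (?X \<Otimes>\<^sub>M ?Y)" by (rule sigma_finite_measure_axioms)
  let ?I = "{0..<1} :: real set"
  define U where "U = (Inl ` space ?M :: ('a + real) set) \<times> (Inr ` ?I :: ('b + real) set)"
  define U' where "U' = (Inr ` ?I :: ('a + real) set) \<times> (Inl ` space ?N :: ('b + real) set)"
  have [measurable]: "Inl ` space ?M \<in> sets ?X" "Inr ` ?I \<in> sets ?X" "Inl ` space ?N \<in> sets ?Y" "Inr ` ?I \<in> sets ?Y"
    by (auto intro: Inl_sets_ext Inr_sets_ext)
  have U: "U \<union> U' \<in> sets (?X \<Otimes>\<^sub>M ?Y)" unfolding U_def U'_def by measurable
  define Z where "Z = reweight (?X \<Otimes>\<^sub>M ?Y) (indicator (U \<union> U'))"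
  have Zf: "sigma_finite_measure Z" unfolding Z_def by (rule weight_sigma_finite[OF XY weight_indicator[OF U]])
  have sZ: "sets Z = sets (?X \<Otimes>\<^sub>M ?Y)" by (simp add: Z_def)
  have spZ: "space Z = space ?X \<times> space ?Y" by (simp add: Z_def space_pair_measure)
  have Inr1: "emeasure (ext_measure L) (Inr ` ?I) = 1" for L :: "'l measure"
  proof -
    have v: "Inl -` (Inr ` ?I) = ({} :: 'l set)" "Inr -` (Inr ` ?I :: ('l + real) set) = ?I" by auto
    have R: "Inr ` ?I \<in> sets (ext_measure L)" by (rule Inr_sets_ext) simp
    show ?thesis unfolding emeasure_ext_measure[OF R] v by simp
  qed
  have fm: "fst \<in> measurable Z ?X" "snd \<in> measurable Z ?Y" using sZ by (auto cong: measurable_cong_sets)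
  have Zem: "emeasure Z S = emeasure (?X \<Otimes>\<^sub>M ?Y) ((U \<union> U') \<inter> S)" if "S \<in> sets (?X \<Otimes>\<^sub>M ?Y)" for S
    unfolding Z_def by (rule emeasure_density_indicator[OF U that])
  have p: "ext_preserving fst Z ?M"
    unfolding ext_preserving_def
  proof (intro conjI ballI fm)
    fix A assume A: "A \<in> sets ?M"
    have "fst -` (Inl ` A) \<inter> space Z \<in> sets (?X \<Otimes>\<^sub>M ?Y)"
      using measurable_sets[OF fm(1) Inl_sets_ext[OF A]] sZ by simp
    moreover have "(U \<union> U') \<inter> (fst -` (Inl ` A) \<inter> space Z) = Inl ` A \<times> Inr ` ?I"
      using sets.sets_into_space[OF A] by (auto simp: U_def U'_def spZ)
    ultimately have "emeasure Z (fst -` (Inl ` A) \<inter> space Z) = emeasure (?X \<Otimes>\<^sub>M ?Y) (Inl ` A \<times> Inr ` ?I)"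
      using Zem by simp
    also have "\<dots> = emeasure ?X (Inl ` A) * emeasure ?Y (Inr ` ?I)"
      by (rule Y.emeasure_pair_measure_Times) (auto intro: Inl_sets_ext Inr_sets_ext A)
    finally show "emeasure Z (fst -` (Inl ` A) \<inter> space Z) = emeasure ?M A"
      by (simp add: Inr1 emeasure_ext_Inl[OF A])
  qed
  have q: "ext_preserving snd Z ?N"
    unfolding ext_preserving_def
  proof (intro conjI ballI fm)
    fix A assume A: "A \<in> sets ?N"
    have "snd -` (Inl ` A) \<inter> space Z \<in> sets (?X \<Otimes>\<^sub>M ?Y)"
      using measurable_sets[OF fm(2) Inl_sets_ext[OF A]] sZ by simp
    moreover have "(U \<union> U') \<inter> (snd -` (Inl ` A) \<inter> space Z) = Inr ` ?I \<times> Inl ` A"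
      using sets.sets_into_space[OF A] by (auto simp: U_def U'_def spZ)
    ultimately have "emeasure Z (snd -` (Inl ` A) \<inter> space Z) = emeasure (?X \<Otimes>\<^sub>M ?Y) (Inr ` ?I \<times> Inl ` A)"
      using Zem by simp
    also have "\<dots> = emeasure ?X (Inr ` ?I) * emeasure ?Y (Inl ` A)"
      by (rule Y.emeasure_pair_measure_Times) (auto intro: Inl_sets_ext Inr_sets_ext A)
    finally show "emeasure Z (snd -` (Inl ` A) \<inter> space Z) = emeasure ?N A"
      by (simp add: Inr1 emeasure_ext_Inl[OF A])
  qed
  have R: "regular_graphex (coupling_diff G H Z)"
    by (intro regular_graphex_diff regular_graphex_pullback_ext p q Zf G H) simp
  let ?a = "L2_norm (Z \<Otimes>\<^sub>M Z) (\<lambda>(x, y). graphon (coupling_diff G H Z) x y)"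
  have "kernel_le Z (graphon (coupling_diff G H Z)) ?a"
    using kernel_le_L2_norm[OF regular_graphexD(2,4)[OF R]] unfolding graphex_diff_simps(1) pullback_simps(1) .
  then have "graphex_bound (coupling_diff G H Z) ?a (L2_norm Z (marginal (coupling_diff G H Z))) \<bar>rho (coupling_diff G H Z)\<bar>"
    unfolding graphex_bound_def graphex_diff_simps(1) pullback_simps(1) by (intro conjI order_refl)
  from delta22_le[OF G H Zf sZ p q L2_norm_nonneg this] show ?thesis by (rule that)
qed

lemma measure_within_mono:
  assumes "measure_within M r N" "r \<le> s"
  shows "measure_within M s N"
proof -
  have "a \<le> b + ennreal s" if "a \<le> b + ennreal r" for a b
    using that add_left_mono[OF ennreal_leI[OF assms(2)], of b] by (rule order_trans)
  then show ?thesis using assms(1) unfolding measure_within_iff by blast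
qed

lemma delta_diamond_finite:
  assumes G: "signed_graphex G" "bounded_graphon G" and H: "signed_graphex H" "bounded_graphon H"
  shows "delta_diamond G H < \<infinity>"
proof -
  obtain M where M: "measure_within (msp G) 1 M" "graphex_L1_L2 (G\<lparr>msp := M\<rparr>)"
    using regular_truncation[OF G zero_less_one] .
  obtain N where N: "measure_within (msp H) 1 N" "graphex_L1_L2 (H\<lparr>msp := N\<rparr>)"
    using regular_truncation[OF H zero_less_one] .
  obtain c where c: "delta22 (G\<lparr>msp := M\<rparr>) (H\<lparr>msp := N\<rparr>) \<le> ereal c"
    using delta22_finite[OF measure_within_regular[OF signed_graphex_measurable[OF G(1)] M]
      measure_within_regular[OF signed_graphex_measurable[OF H(1)] N]] .
  \<comment> \<open>The number has to bound the distance and also to permit both truncations, each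
    of which removes mass up to 1.\<close>
  have "1 \<le> (max 1 c)\<^sup>2" by simp
  moreover have "delta22 (G\<lparr>msp := M\<rparr>) (H\<lparr>msp := N\<rparr>) \<le> ereal (max 1 c)"
    using c by (rule order_trans) simp
  ultimately have "max 1 c \<in> admissible G H"
    using measure_within_mono[OF M(1)] measure_within_mono[OF N(1)] M(2) N(2)
    unfolding admissible_def by blast
  then have "delta_diamond G H \<le> ereal (max 1 c)"
    unfolding delta_diamond_admissible by (rule INF_lower)
  then show ?thesis by (rule le_less_trans) (simp del: ereal_max)
qed

text \<open>The graphex itself need not lie in L1 and L2, so for every e > 0 both arguments are
  replaced by the same truncation with mass loss at most e^2, whose distance to itself is 0.\<close>

lemma delta_diamond_self:
  assumes G: "signed_graphex G" "bounded_graphon G"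
  shows "delta_diamond G G = 0"
proof (rule antisym)
  show "delta_diamond G G \<le> 0"
  proof (rule ereal_le_epsilon2)
    fix e :: real assume e: "e > 0"
    then have "e\<^sup>2 > 0" by simp
    then obtain M where M: "measure_within (msp G) (e\<^sup>2) M" "graphex_L1_L2 (G\<lparr>msp := M\<rparr>)"
      using regular_truncation[OF G] by blast
    have "delta22 (G\<lparr>msp := M\<rparr>) (G\<lparr>msp := M\<rparr>) \<le> 0"
      by (rule delta22_self[OF measure_within_regular[OF signed_graphex_measurable[OF G(1)] M]])
    also have "0 \<le> ereal e" using e by simp
    finally have "e \<in> admissible G G" using M unfolding admissible_def by blast
    then have "delta_diamond G G \<le> ereal e" unfolding delta_diamond_admissible by (rule INF_lower)
    then show "delta_diamond G G \<le> 0 + ereal e" by simp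
  qed
qed (rule delta_diamond_nonneg)

text \<open>The slack e makes both bounds on \<open>delta22\<close> strict and both constants
  positive, as \<open>delta22_triangle_reweighted\<close> demands.\<close>

lemma admissible_add:
  assumes G: "measurable_graphex G" and H: "measurable_graphex H" and J: "measurable_graphex J"
    and c: "c \<in> admissible G H" and c': "c' \<in> admissible H J" and e: "e > 0"
  shows "(c + e) + (c' + e) \<in> admissible G J"
proof -
  have c0: "c \<ge> 0" "c' \<ge> 0" using c c' by (auto intro: admissible_nonneg)
  have sf: "sigma_finite_measure (msp H)" using measurable_graphexD(1)[OF H] .
  obtain M N where M: "measure_within (msp G) (c\<^sup>2) M" "graphex_L1_L2 (G\<lparr>msp := M\<rparr>)"
    and N: "measure_within (msp H) (c\<^sup>2) N" "graphex_L1_L2 (H\<lparr>msp := N\<rparr>)"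
    and d: "delta22 (G\<lparr>msp := M\<rparr>) (H\<lparr>msp := N\<rparr>) \<le> ereal c"
    using c unfolding admissible_def by blast
  obtain N' L where N': "measure_within (msp H) (c'\<^sup>2) N'" "graphex_L1_L2 (H\<lparr>msp := N'\<rparr>)"
    and L: "measure_within (msp J) (c'\<^sup>2) L" "graphex_L1_L2 (J\<lparr>msp := L\<rparr>)"
    and d': "delta22 (H\<lparr>msp := N'\<rparr>) (J\<lparr>msp := L\<rparr>) \<le> ereal c'"
    using c' unfolding admissible_def by blast
  have sq: "c\<^sup>2 \<le> (c + e)\<^sup>2" "c'\<^sup>2 \<le> (c' + e)\<^sup>2" using c0 e by (auto intro!: power_mono)
  obtain h where h: "weight (msp H) h" "N = reweight (msp H) h" "(\<integral>\<^sup>+x. ennreal (1 - h x) \<partial>msp H) \<le> ennreal ((c + e)\<^sup>2)"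
    using measure_within_weight[OF sf measure_within_mono[OF N(1) sq(1)]] .
  obtain h' where h': "weight (msp H) h'" "N' = reweight (msp H) h'" "(\<integral>\<^sup>+x. ennreal (1 - h' x) \<partial>msp H) \<le> ennreal ((c' + e)\<^sup>2)"
    using measure_within_weight[OF sf measure_within_mono[OF N'(1) sq(2)]] .
  have rN: "regular_graphex (H\<lparr>msp := reweight (msp H) h\<rparr>)"
    using measure_within_regular[OF H N] by (simp add: h(2))
  have rN': "regular_graphex (H\<lparr>msp := reweight (msp H) h'\<rparr>)"
    using measure_within_regular[OF H N'] by (simp add: h'(2))
  have ce: "c + e > 0" "c' + e > 0" using c0 e by auto
  have dlt: "delta22 (G\<lparr>msp := M\<rparr>) (H\<lparr>msp := reweight (msp H) h\<rparr>) < ereal (c + e)"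
    using d e by (simp add: h(2)[symmetric] le_less_trans)
  have dlt': "delta22 (H\<lparr>msp := reweight (msp H) h'\<rparr>) (J\<lparr>msp := L\<rparr>) < ereal (c' + e)"
    using d' e by (simp add: h'(2)[symmetric] le_less_trans)
  note rM = measure_within_regular[OF G M] and rL = measure_within_regular[OF J L]
  obtain v v' where v: "weight M v" "weight L v'"
    "\<And>A. A \<in> sets M \<Longrightarrow> emeasure M A \<le> emeasure (reweight M v) A + ennreal ((c' + e)\<^sup>2)"
    "\<And>A. A \<in> sets L \<Longrightarrow> emeasure L A \<le> emeasure (reweight L v') A + ennreal ((c + e)\<^sup>2)"
    "delta22 (G\<lparr>msp := reweight M v\<rparr>) (J\<lparr>msp := reweight L v'\<rparr>) \<le> ereal ((c + e) + (c' + e))"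
    using delta22_triangle_reweighted[OF rM rL h(1) rN h(3) h'(1) rN' h'(3) ce dlt dlt'] by (simp, blast)
  \<comment> \<open>At each outer space the mass already removed and the mass removed by reweighting
    add up; the cross term of the square is nonnegative, so the total fits.\<close>
  let ?s = "((c + e) + (c' + e))\<^sup>2"
  have s: "c\<^sup>2 + (c' + e)\<^sup>2 \<le> ?s" "c'\<^sup>2 + (c + e)\<^sup>2 \<le> ?s"
  proof -
    have "?s = (c + e)\<^sup>2 + (c' + e)\<^sup>2 + 2 * (c + e) * (c' + e)" by (rule power2_sum)
    moreover have "2 * (c + e) * (c' + e) \<ge> 0" using ce by simp
    ultimately show "c\<^sup>2 + (c' + e)\<^sup>2 \<le> ?s" "c'\<^sup>2 + (c + e)\<^sup>2 \<le> ?s" using sq by linarith+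
  qed
  have within: "measure_within R t (reweight Q u)"
    if Q: "measure_within R p Q" and u: "weight Q u" and q: "q + p \<le> t" "q \<ge> 0" "p \<ge> 0"
      and le: "\<And>A. A \<in> sets Q \<Longrightarrow> emeasure Q A \<le> emeasure (reweight Q u) A + ennreal q"
    for R Q :: "'z measure" and p q t u
    unfolding measure_within_iff
  proof (intro conjI ballI)
    have sQ: "sets Q = sets R" using Q by (simp add: measure_within_iff)
    then show "sets (reweight Q u) = sets R" by simp
    fix B assume B: "B \<in> sets R"
    have "emeasure R B \<le> emeasure Q B + ennreal p" using Q B by (simp add: measure_within_iff)
    also have "\<dots> \<le> (emeasure (reweight Q u) B + ennreal q) + ennreal p"
      using le[of B] B sQ by (intro add_right_mono) simp
    also have "\<dots> = emeasure (reweight Q u) B + ennreal (q + p)"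
      using q by (simp add: add.assoc)
    also have "\<dots> \<le> emeasure (reweight Q u) B + ennreal t"
      using q by (intro add_left_mono ennreal_leI)
    finally show "emeasure R B \<le> emeasure (reweight Q u) B + ennreal t" .
    have "emeasure (reweight Q u) B \<le> emeasure Q B"
      using weight_emeasure_le[OF u] B sQ by simp
    also have "\<dots> \<le> emeasure R B" using Q B by (simp add: measure_within_iff)
    finally show "emeasure (reweight Q u) B \<le> emeasure R B" .
  qed
  have w1: "measure_within (msp G) ?s (reweight M v)"
    by (rule within[OF M(1) v(1) _ _ _ v(3)]) (use s in auto)
  have w2: "measure_within (msp J) ?s (reweight L v')"
    by (rule within[OF L(1) v(2) _ _ _ v(4)]) (use s in auto)
  have "graphex_L1_L2 (G\<lparr>msp := reweight M v\<rparr>)"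
    using regular_graphex_L1_L2[OF regular_graphex_weight[OF rM, of v]] v(1) by simp
  moreover have "graphex_L1_L2 (J\<lparr>msp := reweight L v'\<rparr>)"
    using regular_graphex_L1_L2[OF regular_graphex_weight[OF rL, of v']] v(2) by simp
  ultimately show ?thesis using w1 w2 v(5) unfolding admissible_def by blast
qed

lemma delta_diamond_triangle:
  assumes G: "measurable_graphex G" and H: "measurable_graphex H" and J: "measurable_graphex J"
    and fin: "delta_diamond G H < \<infinity>" "delta_diamond H J < \<infinity>"
  shows "delta_diamond G J \<le> delta_diamond G H + delta_diamond H J"
proof (rule ereal_le_epsilon2)
  obtain a where a: "delta_diamond G H = ereal a"
    using fin(1) delta_diamond_nonneg[of G H] by (cases "delta_diamond G H") auto
  obtain b where b: "delta_diamond H J = ereal b"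
    using fin(2) delta_diamond_nonneg[of H J] by (cases "delta_diamond H J") auto
  fix t :: real assume t: "t > 0"
  \<comment> \<open>Two quarters of t pay for nearly optimal c and c', the other two for the slack
    in \<open>admissible_add\<close>.\<close>
  have "delta_diamond G H < ereal (a + t / 4)" "delta_diamond H J < ereal (b + t / 4)" using t by (simp_all add: a b)
  then obtain c c' where c: "c \<in> admissible G H" "c < a + t / 4" and c': "c' \<in> admissible H J" "c' < b + t / 4"
    unfolding delta_diamond_admissible INF_less_iff by auto
  have "(c + t / 4) + (c' + t / 4) \<in> admissible G J"
    using t by (intro admissible_add[OF G H J c(1) c'(1)]) simp
  then have "delta_diamond G J \<le> ereal ((c + t / 4) + (c' + t / 4))"
    unfolding delta_diamond_admissible by (rule INF_lower)
  also have "\<dots> \<le> ereal (a + b + t)" using c(2) c'(2) by simp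
  finally show "delta_diamond G J \<le> delta_diamond G H + delta_diamond H J + ereal t"
    by (simp add: a b)
qed

theorem theorem2p15:
  fixes W\<^sub>1 :: "'a graphex" and W\<^sub>2 :: "'b graphex" and W\<^sub>3 :: "'c graphex"
  assumes "signed_graphex W\<^sub>1" and "bounded_graphon W\<^sub>1"
    and "signed_graphex W\<^sub>2" and "bounded_graphon W\<^sub>2"
    and "signed_graphex W\<^sub>3" and "bounded_graphon W\<^sub>3"
  shows "delta_diamond W\<^sub>1 W\<^sub>3 \<le> delta_diamond W\<^sub>1 W\<^sub>2 + delta_diamond W\<^sub>2 W\<^sub>3 \<and>
    0 \<le> delta_diamond W\<^sub>1 W\<^sub>2 \<and>
    delta_diamond W\<^sub>1 W\<^sub>2 < \<infinity> \<and>
    delta_diamond W\<^sub>1 W\<^sub>1 = 0 \<and>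
    delta_diamond W\<^sub>1 W\<^sub>2 = delta_diamond W\<^sub>2 W\<^sub>1"
proof (intro conjI)
  note m = assms(1,3,5)[THEN signed_graphex_measurable]
  show "delta_diamond W\<^sub>1 W\<^sub>3 \<le> delta_diamond W\<^sub>1 W\<^sub>2 + delta_diamond W\<^sub>2 W\<^sub>3"
    by (intro delta_diamond_triangle m delta_diamond_finite assms)
  show "delta_diamond W\<^sub>1 W\<^sub>2 = delta_diamond W\<^sub>2 W\<^sub>1"
    unfolding delta_diamond_admissible
    using admissible_commute_subset[OF m(1,2)] admissible_commute_subset[OF m(2,1)] by (simp add: subset_antisym)
qed (intro delta_diamond_nonneg delta_diamond_finite delta_diamond_self assms)+

end
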